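(* Let $k,n\in\mathbb{N}$ with $3\leq k\leq n-1$. Let $\{D_I\}_{I\in\binom{[n]}{k}}$ be a p-l-treelike family of positive real numbers, and let $U$ be the set of positive-weighted trees with leaf set $[n]$ realizing the family. Let $\mathcal{P}$ be the unique essential pseudostar of kind $(n,k)$ in $U$. Then: (i) $\sup_{\mathcal{T}\in U} D_{tot}(\mathcal{T}) = D_{tot}(\mathcal{P})$, and the supremum is attained only by $\mathcal{P}$; (ii) if $\#U>1$, then $\inf_{\mathcal{T}\in U} D_{tot}(\mathcal{T}) = D_{tot}(\mathcal{P}) - (n-k)\,m$, where $m$ is the minimum of the weights of the twigs of $\mathcal{P}$, and this infimum is not attained.
   Context: A weighted tree $\mathcal{T}=(T,w)$ is a finite tree with $w:E(T)\to\mathbb{R}$; positive-weighted means all weights are positive. $D_I(\mathcal{T})$ is the total weight of the minimal subtree containing $I$; $D_{tot}(\mathcal{T})$ is the sum of the weights of all edges. A weighted tree with leaf set $[n]$ realizes $\{D_I\}_I$ if $D_I(\mathcal{T})=D_I$ for all $I\in\binom{[n]}{k}$. The family is p-l-treelike if there is a positive-weighted tree and a subset $S$ of its leaves, identified with $[n]$, with $D_I(\mathcal{T})=D_I$ for all $k$-subsets $I\subseteq S$. A node is a vertex of degree $>2$; a tree is essential if it has no vertex of degree $2$. The twig of a leaf $F$ is the path from $F$ to the node $N$ such that the path contains no node other than $N$; its weight is the sum of its edge weights. A tree $P$ is a pseudostar of kind $(n,k)$ if $\#L(P)=n$ and every edge divides $L(P)$ into two sets at least one of which has cardinality $\geq k$.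 Weighted trees are considered up to isomorphism preserving leaf labels and weights, and a weighted tree is identified with the essential weighted tree obtained by suppressing its vertices of degree $2$ (replacing the two edges at such a vertex by one edge whose weight is their sum). *)

theory Defs
  imports Complex_Main
begin

record 'v graph =
  verts :: "'v set"
  edges :: "'v set set"

definition simple_graph :: "'v graph \<Rightarrow> bool" where
  "simple_graph G \<longleftrightarrow> finite (verts G) \<and> (\<forall>e\<in>edges G. e \<subseteq> verts G \<and> card e = 2)"

definition adj :: "'v graph \<Rightarrow> 'v \<Rightarrow> 'v \<Rightarrow> bool" where
  "adj G u v \<longleftrightarrow> {u, v} \<in> edges G"

definition is_path :: "'v graph \<Rightarrow> 'v list \<Rightarrow> bool" where
  "is_path G xs \<longleftrightarrow> xs \<noteq> [] \<and> set xs \<subseteq> verts G \<and> distinct xs \<and> successively (adj G) xs"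

definition path_edges :: "'v list \<Rightarrow> 'v set set" where
  "path_edges xs = {{xs ! i, xs ! Suc i} | i. Suc i < length xs}"

definition connected_graph :: "'v graph \<Rightarrow> bool" where
  "connected_graph G \<longleftrightarrow> (\<forall>u\<in>verts G. \<forall>v\<in>verts G. (adj G)\<^sup>*\<^sup>* u v)"

definition acyclic_graph :: "'v graph \<Rightarrow> bool" where
  "acyclic_graph G \<longleftrightarrow> \<not> (\<exists>xs. is_path G xs \<and> 3 \<le> length xs \<and> adj G (last xs) (hd xs))"

definition tree :: "'v graph \<Rightarrow> bool" where
  "tree G \<longleftrightarrow> simple_graph G \<and> verts G \<noteq> {} \<and> connected_graph G \<and> acyclic_graph G"

definition degree :: "'v graph \<Rightarrow> 'v \<Rightarrow> nat" where
  "degree G v = card {e \<in> edges G. v \<in> e}"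

definition leaves :: "'v graph \<Rightarrow> 'v set" where
  "leaves G = {v \<in> verts G. degree G v = 1}"

definition nodes :: "'v graph \<Rightarrow> 'v set" where
  "nodes G = {v \<in> verts G. degree G v > 2}"

definition essential :: "'v graph \<Rightarrow> bool" where
  "essential G \<longleftrightarrow> \<not> (\<exists>v\<in>verts G. degree G v = 2)"

definition subtree :: "'v graph \<Rightarrow> 'v graph \<Rightarrow> bool" where
  "subtree H G \<longleftrightarrow> tree H \<and> verts H \<subseteq> verts G \<and> edges H \<subseteq> edges G"

definition is_minimal_subtree :: "'v graph \<Rightarrow> 'v set \<Rightarrow> 'v graph \<Rightarrow> bool" where
  "is_minimal_subtree G I H \<longleftrightarrow>
     subtree H G \<and> I \<subseteq> verts H \<and> (\<forall>H'. subtree H' H \<and> I \<subseteq> verts H' \<longrightarrow> H' = H)"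

definition minimal_subtree :: "'v graph \<Rightarrow> 'v set \<Rightarrow> 'v graph" where
  "minimal_subtree G I = (THE H. is_minimal_subtree G I H)"

definition delete_edge :: "'v graph \<Rightarrow> 'v set \<Rightarrow> 'v graph" where
  "delete_edge G e = G\<lparr>edges := edges G - {e}\<rparr>"

text \<open>For an edge \<open>{u, v}\<close> of a tree, \<open>leaf_side G {u, v} u\<close> and \<open>leaf_side G {u, v} v\<close> are the
  two sets into which the edge divides the leaves.\<close>

definition leaf_side :: "'v graph \<Rightarrow> 'v set \<Rightarrow> 'v \<Rightarrow> 'v set" where
  "leaf_side G e u = {x \<in> leaves G. (adj (delete_edge G e))\<^sup>*\<^sup>* u x}"

definition pseudostar :: "nat \<Rightarrow> nat \<Rightarrow> 'v graph \<Rightarrow> bool" where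
  "pseudostar n k G \<longleftrightarrow> tree G \<and> card (leaves G) = n \<and>
     (\<forall>u v. {u, v} \<in> edges G \<longrightarrow>
        k \<le> card (leaf_side G {u, v} u) \<or> k \<le> card (leaf_side G {u, v} v))"

definition is_twig :: "'v graph \<Rightarrow> 'v \<Rightarrow> 'v list \<Rightarrow> bool" where
  "is_twig G F xs \<longleftrightarrow> F \<in> leaves G \<and> is_path G xs \<and> hd xs = F \<and> last xs \<in> nodes G \<and>
     set (butlast xs) \<inter> nodes G = {}"

text \<open>The values of the weight function outside the edge set are irrelevant.\<close>

record 'v wtree =
  shape :: "'v graph"
  weight :: "'v set \<Rightarrow> real"

definition positive_weighted_tree :: "'v wtree \<Rightarrow> bool" where
  "positive_weighted_tree T \<longleftrightarrow> tree (shape T) \<and> (\<forall>e\<in>edges (shape T). weight T e > 0)"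

definition D_tot :: "'v wtree \<Rightarrow> real" where
  "D_tot T = (\<Sum>e\<in>edges (shape T). weight T e)"

definition D_of :: "'v wtree \<Rightarrow> 'v set \<Rightarrow> real" where
  "D_of T I = (\<Sum>e\<in>edges (minimal_subtree (shape T) I). weight T e)"

definition twig_weights :: "'v wtree \<Rightarrow> real set" where
  "twig_weights T = {\<Sum>e\<in>path_edges xs. weight T e | F xs. is_twig (shape T) F xs}"

definition wtree_iso :: "'v wtree \<Rightarrow> 'v wtree \<Rightarrow> bool" where
  "wtree_iso T T' \<longleftrightarrow> (\<exists>f. bij_betw f (verts (shape T)) (verts (shape T')) \<and>
     edges (shape T') = (\<lambda>e. f ` e) ` edges (shape T) \<and>
     (\<forall>e\<in>edges (shape T). weight T' (f ` e) = weight T e) \<and>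
     (\<forall>x\<in>leaves (shape T). f x = x))"

text \<open>Suppression of one vertex of degree 2. In a tree, \<open>{a, b}\<close> is not already an edge.\<close>

definition suppress_step :: "'v wtree \<Rightarrow> 'v wtree \<Rightarrow> bool" where
  "suppress_step T T' \<longleftrightarrow> (\<exists>v a b. v \<in> verts (shape T) \<and> a \<noteq> b \<and>
     {e \<in> edges (shape T). v \<in> e} = {{a, v}, {v, b}} \<and>
     T' = \<lparr>shape = \<lparr>verts = verts (shape T) - {v},
                    edges = (edges (shape T) - {{a, v}, {v, b}}) \<union> {{a, b}}\<rparr>,
           weight = (weight T)({a, b} := weight T {a, v} + weight T {v, b})\<rparr>)"

text \<open>Weighted trees are identified when their essential forms are isomorphic.\<close>

definition same_wtree :: "'v wtree \<Rightarrow> 'v wtree \<Rightarrow> bool" where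
  "same_wtree T T' \<longleftrightarrow> (\<exists>Q Q'. suppress_step\<^sup>*\<^sup>* T Q \<and> essential (shape Q) \<and>
     suppress_step\<^sup>*\<^sup>* T' Q' \<and> essential (shape Q') \<and> wtree_iso Q Q')"

definition subsets_of_card :: "nat \<Rightarrow> nat \<Rightarrow> nat set set" where
  "subsets_of_card n k = {I. I \<subseteq> {1..n} \<and> card I = k}"

text \<open>As all trees are finite, vertices of type \<open>nat\<close> give every tree up to isomorphism.\<close>

definition pl_treelike :: "nat \<Rightarrow> nat \<Rightarrow> (nat set \<Rightarrow> real) \<Rightarrow> bool" where
  "pl_treelike n k D \<longleftrightarrow> (\<exists>(T :: nat wtree) S \<phi>. positive_weighted_tree T \<and>
     S \<subseteq> leaves (shape T) \<and> bij_betw \<phi> {1..n} S \<and>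
     (\<forall>I\<in>subsets_of_card n k. D_of T (\<phi> ` I) = D I))"

definition realizing_trees :: "nat \<Rightarrow> nat \<Rightarrow> (nat set \<Rightarrow> real) \<Rightarrow> nat wtree set" where
  "realizing_trees n k D = {T. positive_weighted_tree T \<and> leaves (shape T) = {1..n} \<and>
     (\<forall>I\<in>subsets_of_card n k. D_of T I = D I)}"

definition essential_pseudostars :: "nat \<Rightarrow> nat \<Rightarrow> (nat set \<Rightarrow> real) \<Rightarrow> nat wtree set" where
  "essential_pseudostars n k D =
     {P \<in> realizing_trees n k D. essential (shape P) \<and> pseudostar n k (shape P)}"

end

theory Submission
  imports Defs
begin

text \<open>Every edge of a tree with leaf set \<open>X\<close> splits \<open>X\<close> into two sets, and \<open>D_I\<close> is the total weight of
  the edges whose split separates \<open>I\<close>. Let \<open>A\<close> have at least \<open>k\<close> elements and let \<open>X - A\<close> have at least two.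
  The weight that a tree gives to the split \<open>A | X - A\<close> can be read off from the numbers
  \<open>D_ilR + D_jmR - D_ijR - D_lmR\<close> with \<open>i\<close>, \<open>j\<close> and the \<open>(k - 2)\<close>-set \<open>R\<close> in \<open>A\<close> and \<open>l\<close>, \<open>m\<close> outside \<open>A\<close>,
  so it is the same for all trees that realize the family. The remaining inner edges, called bad below,
  have fewer than \<open>k\<close> leaves on each side and hence contribute their total weight \<open>b\<close> to every \<open>D_I\<close>.
  Comparing the sums over \<open>k\<close>-subsets shows that passing from a realizing tree to the pseudostar,
  which has no bad edge, adds \<open>b / k\<close> to the weight of each leaf edge, and thus \<open>(n - k) b / k\<close> to the
  total weight. The leaf edges of the original tree have positive weight, so \<open>b / k\<close> is smaller than
  every twig weight of the pseudostar; scaling the bad edges of a single tree with \<open>b > 0\<close> realizes all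
  values of \<open>b / k\<close> strictly between \<open>0\<close> and the minimal twig weight.\<close>

section \<open>Edge cuts of trees\<close>

text \<open>The argument uses cuts instead of paths: vertex sets crossed by exactly one edge. A
  connected simple graph is a tree iff each edge has such a set, and these sets pass easily to
  subtrees, contractions and renamings.

  The obstacle in reading off weights is that the four-term number equals the weight of
  \<open>A | X - A\<close> only for suitable \<open>i, j, l, m\<close>, and what suits one tree need
  not suit another. Hence two one-sided bounds: in a tree that has the split the number is at least
  the split weight for every choice of leaves, and in every tree it is at most the split weight for
  one adapted quartet. The quartet adapted to the second tree bounds the weight in the first by that
  in the second; exchanging the trees gives equality. Since \<open>i\<close>, \<open>j\<close> and
  the \<open>k - 2\<close> elements of \<open>R\<close> must fit into \<open>A\<close>, one side
  needs \<open>k\<close> leaves, and a nonempty \<open>R\<close>, that is \<open>k \<ge> 3\<close>,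
  makes the coefficient of the split exactly 1.

  The constant \<open>b / k\<close> arises because the changes of the leaf edges have the same sum
  over every \<open>k\<close>-subset; as \<open>k < n\<close>, any leaf can be exchanged for any
  other, so all changes are equal.\<close>

definition crosses :: "'v set \<Rightarrow> 'v set \<Rightarrow> bool" where
  "crosses e A \<longleftrightarrow> e \<inter> A \<noteq> {} \<and> \<not> e \<subseteq> A"

text \<open>\<open>A\<close> may contain elements outside the graph. This makes \<open>- A\<close> a
  cut of the same edge whenever \<open>A\<close> is one; in a tree, \<open>A\<close> is determined
  only up to complement and up to its trace on the vertices.\<close>

definition is_cut :: "'v graph \<Rightarrow> 'v set \<Rightarrow> 'v set \<Rightarrow> bool" where
  "is_cut G e A \<longleftrightarrow> e \<in> edges G \<and> (\<forall>f\<in>edges G. crosses f A \<longleftrightarrow> f = e)"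

lemma crosses_Compl [simp]: "crosses e (- A) \<longleftrightarrow> crosses e A"
  unfolding crosses_def by auto

lemma cut_Compl [simp]: "is_cut G e (- A) \<longleftrightarrow> is_cut G e A"
  unfolding is_cut_def by simp

lemma crosses_pair [simp]: "crosses {u, v} A \<longleftrightarrow> (u \<in> A) \<noteq> (v \<in> A)"
  unfolding crosses_def by auto

lemma cut_edge: "is_cut G e A \<Longrightarrow> e \<in> edges G"
  by (simp add: is_cut_def)

lemma cut_crosses: "is_cut G e A \<Longrightarrow> f \<in> edges G \<Longrightarrow> crosses f A \<longleftrightarrow> f = e"
  by (simp add: is_cut_def)

lemma cut_same_side: "is_cut G e A \<Longrightarrow> {p, q} \<in> edges G \<Longrightarrow> {p, q} \<noteq> e \<Longrightarrow> p \<in> A \<longleftrightarrow> q \<in> A"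
  using cut_crosses[of G e A "{p, q}"] by simp

lemma cut_other_side: "is_cut G {p, q} A \<Longrightarrow> p \<in> A \<longleftrightarrow> q \<notin> A"
  using cut_crosses[of G "{p, q}" A "{p, q}"] cut_edge[of G "{p, q}" A] by auto

lemma adj_sym: "adj G u v \<Longrightarrow> adj G v u"
  by (simp add: adj_def insert_commute)

lemma adj_rtranclp_sym: "(adj G)\<^sup>*\<^sup>* u v \<Longrightarrow> (adj G)\<^sup>*\<^sup>* v u"
  by (metis adj_sym symp_def symp_rtranclp)

lemma simple_adjD:
  assumes "simple_graph G" "adj G u v"
  shows "u \<noteq> v" "u \<in> verts G" "v \<in> verts G"
  using assms by (auto simp: simple_graph_def adj_def dest!: bspec)

lemma simple_edgeE:
  assumes "simple_graph G" "e \<in> edges G"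
  obtains u v where "e = {u, v}" "u \<noteq> v" "u \<in> verts G" "v \<in> verts G"
proof -
  have "card e = 2" "e \<subseteq> verts G"
    using assms by (auto simp: simple_graph_def)
  then show ?thesis
    using that by (auto simp: card_2_iff)
qed

lemma finite_edges: "simple_graph G \<Longrightarrow> finite (edges G)"
  unfolding simple_graph_def by (meson Pow_iff finite_Pow_iff finite_subset subsetI)

lemma rtranclp_invariant:
  assumes "R\<^sup>*\<^sup>* x y" "\<And>u v. R u v \<Longrightarrow> P u = P v"
  shows "P x = P y"
  using assms by (induction rule: rtranclp_induct) auto

lemma rtranclp_weaken:
  assumes "R\<^sup>*\<^sup>* x y" "\<And>u v. R u v \<Longrightarrow> S u v"
  shows "S\<^sup>*\<^sup>* x y"
  using assms mono_rtranclp[of R S] by blast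

lemma rtranclp_leaves_set:
  assumes "R\<^sup>*\<^sup>* x y" "x \<in> A" "y \<notin> A"
  shows "\<exists>p q. R\<^sup>*\<^sup>* x p \<and> p \<in> A \<and> R p q \<and> q \<notin> A \<and> R\<^sup>*\<^sup>* q y"
  using assms
proof (induction rule: converse_rtranclp_induct)
  case (step a b)
  show ?case
  proof (cases "b \<in> A")
    case True
    then obtain p q where "R\<^sup>*\<^sup>* b p" "p \<in> A" "R p q" "q \<notin> A" "R\<^sup>*\<^sup>* q y"
      using step by auto
    then show ?thesis
      using step(1) by (meson converse_rtranclp_into_rtranclp)
  next
    case False
    then show ?thesis
      using step by blast
  qed
qed simp

lemma connected_invariant:
  assumes "connected_graph G" "\<And>u v. adj G u v \<Longrightarrow> P u = P v" "x \<in> verts G" "y \<in> verts G"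
  shows "P x = P y"
  using assms rtranclp_invariant[of "adj G" x y P] by (auto simp: connected_graph_def)

lemma rtranclp_adj_path:
  assumes "(adj G)\<^sup>*\<^sup>* u v" "simple_graph G" "u \<in> verts G"
  shows "\<exists>xs. is_path G xs \<and> hd xs = u \<and> last xs = v"
  using assms
proof (induction rule: converse_rtranclp_induct)
  case base
  then have "is_path G [v]"
    by (simp add: is_path_def)
  then show ?case
    by force
next
  case (step u w)
  then obtain xs where xs: "is_path G xs" "hd xs = w" "last xs = v"
    using simple_adjD by metis
  show ?case
  proof (cases "u \<in> set xs")
    case True
    then obtain ys zs where "xs = ys @ u # zs"
      by (meson split_list)
    then have "is_path G (u # zs) \<and> hd (u # zs) = u \<and> last (u # zs) = v"
      using xs by (auto simp: is_path_def successively_append_iff)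
    then show ?thesis
      by blast
  next
    case False
    then have "is_path G (u # xs) \<and> hd (u # xs) = u \<and> last (u # xs) = v"
      using xs step by (auto simp: is_path_def successively_Cons)
    then show ?thesis
      by blast
  qed
qed

lemma adj_delete_edge: "adj (delete_edge G e) u v \<longleftrightarrow> adj G u v \<and> {u, v} \<noteq> e"
  by (auto simp: adj_def delete_edge_def)

lemma verts_delete_edge [simp]: "verts (delete_edge G e) = verts G"
  by (simp add: delete_edge_def)

text \<open>The cut is the component of one end \<open>u\<close> after deletion of \<open>e\<close>.
  A path from \<open>u\<close> to the other end that avoids \<open>e\<close> has at least three
  vertices, so \<open>e\<close> would close it to a cycle.\<close>

lemma acyclic_cut:
  assumes s: "simple_graph G" and a: "acyclic_graph G" and e: "e \<in> edges G"
  shows "\<exists>A. is_cut G e A"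
proof -
  obtain u v where uv: "e = {u, v}" "u \<noteq> v" "u \<in> verts G" "v \<in> verts G"
    using s e simple_edgeE by metis
  let ?H = "delete_edge G e"
  let ?A = "{x. (adj ?H)\<^sup>*\<^sup>* u x}"
  have sH: "simple_graph ?H"
    using s by (auto simp: simple_graph_def delete_edge_def)
  have "v \<notin> ?A"
  proof
    assume "v \<in> ?A"
    then obtain xs where xs: "is_path ?H xs" "hd xs = u" "last xs = v"
      using rtranclp_adj_path[OF _ sH, of u v] uv by (auto simp: delete_edge_def)
    have "is_path G xs"
      using xs(1) unfolding is_path_def
      by (auto simp: adj_delete_edge elim!: successively_mono)
    moreover have "3 \<le> length xs"
    proof (rule ccontr)
      assume "\<not> 3 \<le> length xs"
      then consider "xs = []" | x where "xs = [x]" | x y where "xs = [x, y]"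
        by (cases xs rule: remdups_adj.cases) (auto simp: not_le less_Suc_eq numeral_3_eq_3)
      then show False
        by cases (use xs uv in \<open>auto simp: is_path_def adj_delete_edge\<close>)
    qed
    moreover have "adj G (last xs) (hd xs)"
      using xs uv e by (simp add: adj_def insert_commute)
    ultimately show False
      using a by (auto simp: acyclic_graph_def)
  qed
  moreover have "f = e" if f: "f \<in> edges G" and c: "crosses f ?A" for f
  proof (rule ccontr)
    assume ne: "f \<noteq> e"
    obtain p q where pq: "f = {p, q}" using s f simple_edgeE by metis
    have pq': "adj ?H p q" "adj ?H q p"
      using f ne pq by (simp_all add: adj_delete_edge, simp_all add: adj_def insert_commute)
    have "(p \<in> ?A) = (q \<in> ?A)"
      using pq' by (auto intro: rtranclp.rtrancl_into_rtrancl)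
    then show False
      using c pq by auto
  qed
  ultimately show ?thesis
    using e uv by (intro exI[of _ ?A]) (auto simp: is_cut_def)
qed

text \<open>On a cycle, the set that cuts the closing edge is crossed by no other edge, so all
  vertices of the cycle lie on one side, both ends of the closing edge included.\<close>

lemma cuts_acyclic:
  assumes c: "\<And>e. e \<in> edges G \<Longrightarrow> \<exists>A. is_cut G e A"
  shows "acyclic_graph G"
  unfolding acyclic_graph_def
proof
  assume "\<exists>xs. is_path G xs \<and> 3 \<le> length xs \<and> adj G (last xs) (hd xs)"
  then obtain xs where xs: "is_path G xs" "3 \<le> length xs" "adj G (last xs) (hd xs)"
    by blast
  then obtain A where A: "is_cut G {last xs, hd xs} A"
    using c by (auto simp: adj_def)
  have ne: "xs \<noteq> []" "distinct xs"
    using xs by (auto simp: is_path_def)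
  have "i < length xs \<Longrightarrow> (xs ! i \<in> A) = (hd xs \<in> A)" for i
  proof (induction i)
    case (Suc i)
    have e: "{xs ! i, xs ! Suc i} \<in> edges G"
      using xs(1) Suc.prems by (auto simp: is_path_def adj_def successively_conv_nth)
    have "{xs ! i, xs ! Suc i} \<noteq> {last xs, hd xs}"
      using Suc.prems xs(2) ne by (auto simp: doubleton_eq_iff hd_conv_nth last_conv_nth nth_eq_iff_index_eq)
    then show ?case
      using cut_same_side[OF A e] Suc by simp
  qed (use ne in \<open>simp add: hd_conv_nth\<close>)
  from this[of "length xs - 1"] have "(last xs \<in> A) = (hd xs \<in> A)"
    using ne by (simp add: last_conv_nth)
  then show False
    using cut_other_side[OF A] by simp
qed

lemma tree_iff_cuts:
  "tree G \<longleftrightarrow> simple_graph G \<and> verts G \<noteq> {} \<and> connected_graph G \<and> (\<forall>e\<in>edges G. \<exists>A. is_cut G e A)"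
  using acyclic_cut cuts_acyclic unfolding tree_def by metis

text \<open>An arbitrary choice among the cuts of \<open>e\<close>; statements that use
  \<open>side\<close> treat the two sides alike.\<close>

definition side :: "'v graph \<Rightarrow> 'v set \<Rightarrow> 'v set" where
  "side G e = (SOME A. is_cut G e A)"

lemma cut_side: "tree G \<Longrightarrow> e \<in> edges G \<Longrightarrow> is_cut G e (side G e)"
  unfolding side_def tree_iff_cuts by (meson someI_ex)

lemma tree_simple: "tree G \<Longrightarrow> simple_graph G"
  by (simp add: tree_def)

lemma tree_connected: "tree G \<Longrightarrow> connected_graph G"
  by (simp add: tree_def)

lemma tree_finite: "tree G \<Longrightarrow> finite (verts G)" "tree G \<Longrightarrow> finite (edges G)"
  using finite_edges by (auto simp: tree_def simple_graph_def)

text \<open>No edge crosses the set on which \<open>A\<close> and \<open>B\<close> agree, because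
  both are crossed by \<open>e\<close> only. By connectedness they agree on all vertices or on
  none.\<close>

lemma cut_unique:
  assumes t: "tree G" and A: "is_cut G e A" and B: "is_cut G e B" and "x \<in> verts G" "y \<in> verts G"
  shows "((x \<in> A) = (x \<in> B)) = ((y \<in> A) = (y \<in> B))"
proof (rule connected_invariant[OF tree_connected[OF t], where P = "\<lambda>x. (x \<in> A) = (x \<in> B)"])
  fix u v assume "adj G u v"
  then have "crosses {u, v} A = crosses {u, v} B"
    using cut_crosses[OF A, of "{u, v}"] cut_crosses[OF B, of "{u, v}"] unfolding adj_def by metis
  then show "((u \<in> A) = (u \<in> B)) = ((v \<in> A) = (v \<in> B))"
    by auto
qed (use assms in auto)

lemma cut_unique_crosses:
  assumes "tree G" "is_cut G e A" "is_cut G e B" "I \<subseteq> verts G"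
  shows "crosses I A = crosses I B"
proof -
  have "(x \<in> A \<and> y \<notin> A \<longrightarrow> (x \<in> B) \<noteq> (y \<in> B)) \<and> (x \<in> B \<and> y \<notin> B \<longrightarrow> (x \<in> A) \<noteq> (y \<in> A))"
    if "x \<in> I" "y \<in> I" for x y
    using cut_unique[OF assms(1-3), of x y] assms(4) that by blast
  then show ?thesis
    unfolding crosses_def by blast
qed

lemma cut_eq_or_Compl:
  assumes "tree G" "is_cut G e A" "is_cut G e B"
  shows "A \<inter> verts G = B \<inter> verts G \<or> A \<inter> verts G = verts G - B"
  using cut_unique[OF assms] by blast

text \<open>No edge leaves \<open>B - A\<close>: it would have to cross \<open>A\<close> or \<open>B\<close>.\<close>

lemma cut_corner:
  assumes t: "tree G" and A: "is_cut G e A" and B: "is_cut G f B"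
    and eB: "e \<inter> B = {}" and fA: "f \<subseteq> A"
  shows "verts G \<inter> B \<subseteq> A"
proof
  fix x assume x: "x \<in> verts G \<inter> B"
  obtain u v where uv: "e = {u, v}" "u \<in> verts G"
    using A tree_simple[OF t] simple_edgeE by (metis is_cut_def)
  have "(x \<in> B - A) = (u \<in> B - A)"
  proof (rule connected_invariant[OF tree_connected[OF t], where P = "\<lambda>x. x \<in> B - A"])
    fix p q assume "adj G p q"
    then have pq: "{p, q} \<in> edges G" by (simp add: adj_def)
    have "crosses {p, q} A \<longleftrightarrow> {p, q} = e" "crosses {p, q} B \<longleftrightarrow> {p, q} = f"
      using cut_crosses[OF A pq] cut_crosses[OF B pq] by blast+
    then show "(p \<in> B - A) = (q \<in> B - A)"
      using eB fA by auto
  qed (use x uv in auto)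
  then show "x \<in> A"
    using x uv eB by auto
qed

lemma cut_edge_cases:
  assumes "is_cut G e A" "f \<in> edges G" "f \<noteq> e"
  shows "f \<subseteq> A \<or> f \<inter> A = {}"
  using assms unfolding is_cut_def crosses_def by blast

text \<open>If \<open>e\<close> and \<open>f\<close> differ, each lies entirely on one side of the
  cut of the other, and each of the four combinations empties one corner. This pairwise
  compatibility of the splits of a tree later excludes crossing quartets.\<close>

lemma cut_compatible:
  assumes t: "tree G" and A: "is_cut G e A" and B: "is_cut G f B"
  shows "verts G \<inter> A \<inter> B = {} \<or> verts G \<inter> A - B = {} \<or> verts G \<inter> B - A = {} \<or> verts G - A - B = {}"
proof (cases "e = f")
  case True
  then show ?thesis
    using cut_eq_or_Compl[OF t A, of B] B by blast
next
  case False
  have e: "e \<subseteq> B \<or> e \<inter> B = {}" and f: "f \<subseteq> A \<or> f \<inter> A = {}"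
    using cut_edge_cases[OF B] cut_edge_cases[OF A] A B False by (auto simp: is_cut_def)
  have A': "is_cut G e (- A)" and B': "is_cut G f (- B)"
    using A B by auto
  from e f show ?thesis
    using cut_corner[OF t A B] cut_corner[OF t A' B] cut_corner[OF t A B'] cut_corner[OF t A' B']
    by blast
qed

text \<open>Retracting the complement of \<open>A\<close> onto the end of \<open>e\<close> in \<open>A\<close> turns a walk between
  vertices of \<open>A\<close> into one that avoids \<open>e\<close>.\<close>

lemma cut_retract:
  assumes A: "is_cut G e A" and F: "F \<subseteq> edges G"
    and r: "(\<lambda>p q. {p, q} \<in> F)\<^sup>*\<^sup>* x y" and "x \<in> A" "y \<in> A"
  shows "(\<lambda>p q. {p, q} \<in> F - {e})\<^sup>*\<^sup>* x y"
proof -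
  obtain u where u: "u \<in> e" "u \<in> A"
    using A by (auto simp: is_cut_def crosses_def)
  define g where "g z = (if z \<in> A then z else u)" for z
  have "(\<lambda>p q. {p, q} \<in> F - {e})\<^sup>*\<^sup>* (g x) (g y)"
    using r
  proof (induction rule: rtranclp_induct)
    case (step p q)
    have c: "crosses {p, q} A \<longleftrightarrow> {p, q} = e"
      using cut_crosses[OF A] F step(2) by blast
    have "{g p, g q} \<in> F - {e} \<or> g p = g q"
    proof (cases "{p, q} = e")
      case True
      then show ?thesis
        using c u by (auto simp: g_def)
    next
      case False
      then show ?thesis
        using c step(2) by (auto simp: g_def)
    qed
    then show ?case
    proof
      assume "{g p, g q} \<in> F - {e}"
      then show ?thesis
        using step(3) by (rule rtranclp.rtrancl_into_rtrancl[rotated])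
    qed (use step(3) in simp)
  qed simp
  then show ?thesis
    using assms by (simp add: g_def)
qed

section \<open>Minimal subtrees\<close>

text \<open>A smallest edge set connecting \<open>x\<close> with \<open>y\<close> contains no edge
  with \<open>x\<close> and \<open>y\<close> on the same side: the walk could be retracted to that
  side and the edge dropped. This stands in for the unique path between two vertices.\<close>

lemma connecting_edges_separate:
  assumes t: "tree G" and "x \<in> verts G" "y \<in> verts G"
  shows "(\<lambda>p q. {p, q} \<in> {e \<in> edges G. crosses {x, y} (side G e)})\<^sup>*\<^sup>* x y"
proof -
  let ?conn = "\<lambda>F. F \<subseteq> edges G \<and> (\<lambda>p q. {p, q} \<in> F)\<^sup>*\<^sup>* x y"
  have "?conn (edges G)"
    using assms tree_connected[OF t] by (auto simp: connected_graph_def adj_def[abs_def])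
  then obtain F where F: "?conn F" and min: "\<And>F'. ?conn F' \<Longrightarrow> card F \<le> card F'"
    using arg_min_natI[of ?conn "edges G" card] arg_min_nat_le[of ?conn _ card] by blast
  have "crosses {x, y} (side G e)" if e: "e \<in> F" for e
  proof (rule ccontr)
    assume n: "\<not> crosses {x, y} (side G e)"
    define A where "A = (if x \<in> side G e then side G e else - side G e)"
    have A: "is_cut G e A"
      using cut_side[OF t, of e] e F by (auto simp: A_def)
    have "x \<in> A" "y \<in> A"
      using n by (auto simp: A_def)
    then have "?conn (F - {e})"
      using cut_retract[OF A] F by auto
    then have "card F \<le> card (F - {e})"
      by (rule min)
    moreover have "finite F"
      using F tree_finite[OF t] finite_subset by auto
    ultimately show False
      using e by (metis card_Diff1_less not_le)
  qed
  then show ?thesis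
    using rtranclp_weaken[OF conjunct2[OF F], of "\<lambda>p q. {p, q} \<in> {e \<in> edges G. crosses {x, y} (side G e)}"] F
    by blast
qed

lemma edge_towards:
  assumes t: "tree G" and u: "u \<in> verts G" and z: "z \<in> verts G" and ne: "u \<noteq> z"
  obtains w C where "{u, w} \<in> edges G" "is_cut G {u, w} C" "u \<notin> C" "w \<in> C" "z \<in> C"
proof -
  obtain w where w: "{u, w} \<in> edges G" "crosses {u, z} (side G {u, w})"
    using connecting_edges_separate[OF t u z] ne by (auto elim: converse_rtranclpE)
  define C where "C = (if u \<in> side G {u, w} then - side G {u, w} else side G {u, w})"
  have "is_cut G {u, w} C" "u \<notin> C" "z \<in> C"
    using cut_side[OF t w(1)] w(2) by (auto simp: C_def)
  with that w(1) cut_other_side show ?thesis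
    by metis
qed

text \<open>An explicit candidate for the minimal subtree, made of the edges whose removal separates
  \<open>I\<close>. Adding \<open>I\<close> to the vertices matters when \<open>I\<close> is a
  single vertex, which no edge separates.\<close>

definition spanned_subtree :: "'v graph \<Rightarrow> 'v set \<Rightarrow> 'v graph" where
  "spanned_subtree G I = (let F = {e \<in> edges G. crosses I (side G e)} in \<lparr>verts = I \<union> \<Union>F, edges = F\<rparr>)"

lemma spanned_subtree_simps [simp]:
  "edges (spanned_subtree G I) = {e \<in> edges G. crosses I (side G e)}"
  "verts (spanned_subtree G I) = I \<union> \<Union>{e \<in> edges G. crosses I (side G e)}"
  by (simp_all add: spanned_subtree_def Let_def)

lemma spanned_subtree_tree:
  assumes t: "tree G" and I: "I \<subseteq> verts G" "I \<noteq> {}"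
  shows "tree (spanned_subtree G I)"
proof -
  let ?S = "spanned_subtree G I"
  have sub: "edges ?S \<subseteq> edges G" "verts ?S \<subseteq> verts G"
    using I tree_simple[OF t] by (auto simp: simple_graph_def)
  have simple: "simple_graph ?S"
    using tree_simple[OF t] sub unfolding simple_graph_def
    by (auto intro: finite_subset)
  have I_conn: "(adj ?S)\<^sup>*\<^sup>* x y" if "x \<in> I" "y \<in> I" for x y
  proof -
    have r: "(\<lambda>p q. {p, q} \<in> {e \<in> edges G. crosses {x, y} (side G e)})\<^sup>*\<^sup>* x y"
      using connecting_edges_separate[OF t] that I by blast
    have c: "crosses {x, y} A \<Longrightarrow> crosses I A" for A
      using that unfolding crosses_def by blast
    show ?thesis
      by (rule rtranclp_weaken[OF r]) (use c in \<open>simp add: adj_def del: crosses_pair\<close>)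
  qed
  obtain x0 where x0: "x0 \<in> I" using I by auto
  have "(adj ?S)\<^sup>*\<^sup>* x0 v" if v: "v \<in> verts ?S" for v
  proof (cases "v \<in> I")
    case True
    then show ?thesis using I_conn x0 by auto
  next
    case False
    then obtain e where e: "e \<in> edges G" "crosses I (side G e)" "v \<in> e"
      using v by auto
    define A where "A = (if v \<in> side G e then side G e else - side G e)"
    have A: "is_cut G e A" "v \<in> A" "crosses I A"
      using cut_side[OF t e(1)] e(2) by (auto simp: A_def)
    \<comment> \<open>As \<open>e\<close> is the only edge leaving \<open>A\<close>, the walk from
      \<open>x\<close> to \<open>y\<close> inside the spanned graph leaves \<open>A\<close> through
      \<open>e\<close>, and it does so at the end of \<open>e\<close> in \<open>A\<close>, which is
      \<open>v\<close>.\<close>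
    obtain x y where xy: "x \<in> I" "y \<in> I" "x \<in> A" "y \<notin> A"
      using A(3) by (auto simp: crosses_def)
    obtain p q where pq: "(adj ?S)\<^sup>*\<^sup>* x p" "p \<in> A" "adj ?S p q" "q \<notin> A"
      using rtranclp_leaves_set[OF I_conn[OF xy(1,2)] xy(3,4)] by blast
    have pqG: "{p, q} \<in> edges G"
      using pq(3) sub by (auto simp: adj_def)
    have "{p, q} = e"
      using cut_crosses[OF A(1) pqG] pq by auto
    then have "p = v"
      using e(3) A(2) pq by auto
    then show ?thesis
      using I_conn[OF x0 xy(1)] pq(1) by auto
  qed
  then have "connected_graph ?S"
    unfolding connected_graph_def by (meson adj_rtranclp_sym rtranclp_trans)
  moreover have "\<exists>A. is_cut ?S e A" if "e \<in> edges ?S" for e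
    using cut_side[OF t, of e] that by (auto simp: is_cut_def)
  ultimately show ?thesis
    using simple x0 by (auto simp: tree_iff_cuts)
qed

text \<open>A subtree containing \<open>I\<close> joins elements of \<open>I\<close> on different
  sides of the cut of \<open>e\<close>, and \<open>e\<close> is the only edge available for the
  crossing.\<close>

lemma spanned_subtree_subset:
  assumes t: "tree G" and H: "subtree H G" and I: "I \<subseteq> verts H"
  shows "edges (spanned_subtree G I) \<subseteq> edges H" "verts (spanned_subtree G I) \<subseteq> verts H"
proof -
  have "e \<in> edges H" if e: "e \<in> edges G" "crosses I (side G e)" for e
  proof -
    obtain x y where xy: "x \<in> I" "y \<in> I" "x \<in> side G e" "y \<notin> side G e"
      using e(2) by (auto simp: crosses_def)
    have "(adj H)\<^sup>*\<^sup>* x y"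
      using H I xy(1,2) unfolding subtree_def tree_def connected_graph_def by blast
    then obtain p q where pq: "p \<in> side G e" "adj H p q" "q \<notin> side G e"
      using rtranclp_leaves_set xy by metis
    have pqH: "{p, q} \<in> edges H" "{p, q} \<in> edges G"
      using pq(2) H by (auto simp: adj_def subtree_def)
    then show ?thesis
      using cut_crosses[OF cut_side[OF t e(1)] pqH(2)] pq by auto
  qed
  then show "edges (spanned_subtree G I) \<subseteq> edges H"
    by auto
  then show "verts (spanned_subtree G I) \<subseteq> verts H"
    using I H by (auto simp: subtree_def tree_def simple_graph_def)
qed

lemma minimal_subtree_eq:
  assumes t: "tree G" and I: "I \<subseteq> verts G" "I \<noteq> {}"
  shows "minimal_subtree G I = spanned_subtree G I"
proof -
  have sub: "subtree (spanned_subtree G I) G"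
    using spanned_subtree_tree[OF assms] tree_simple[OF t] I
    by (auto simp: subtree_def simple_graph_def)
  have trans: "subtree H' G" if "subtree H' H" "subtree H G" for H H'
    using that by (auto simp: subtree_def)
  have "is_minimal_subtree G I (spanned_subtree G I)"
    unfolding is_minimal_subtree_def
  proof (intro conjI allI impI)
    fix H' assume H': "subtree H' (spanned_subtree G I) \<and> I \<subseteq> verts H'"
    then have "edges (spanned_subtree G I) \<subseteq> edges H'" "verts (spanned_subtree G I) \<subseteq> verts H'"
      using spanned_subtree_subset[OF t trans[OF _ sub]] by auto
    then show "H' = spanned_subtree G I"
      using H' by (intro graph.equality) (auto simp: subtree_def)
  qed (use sub in auto)
  moreover have "H = spanned_subtree G I" if H: "is_minimal_subtree G I H" for H
  proof -
    have "subtree (spanned_subtree G I) H"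
      using H spanned_subtree_subset[OF t, of H I] spanned_subtree_tree[OF assms]
      by (auto simp: is_minimal_subtree_def subtree_def)
    then show ?thesis
      using H by (auto simp: is_minimal_subtree_def)
  qed
  ultimately show ?thesis
    unfolding minimal_subtree_def by blast
qed

text \<open>The only access to \<open>D_of\<close> from here on: minimal subtrees give way to a test
  on the cut of each edge.\<close>

lemma D_of_eq_sum:
  assumes "tree (shape T)" "I \<subseteq> verts (shape T)" "I \<noteq> {}"
  shows "D_of T I = (\<Sum>e | e \<in> edges (shape T) \<and> crosses I (side (shape T) e). weight T e)"
  using minimal_subtree_eq[OF assms] by (simp add: D_of_def)

section \<open>Leaves and cuts\<close>

definition edges_at :: "'v graph \<Rightarrow> 'v \<Rightarrow> 'v set set" where
  "edges_at G u = {e \<in> edges G. u \<in> e}"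

lemma degree_eq: "degree G u = card (edges_at G u)"
  by (simp add: degree_def edges_at_def)

lemma edges_atE:
  assumes "simple_graph G" "g \<in> edges_at G u"
  obtains w where "g = {u, w}" "w \<noteq> u" "{u, w} \<in> edges G" "w \<in> verts G"
proof -
  have g: "g \<in> edges G" "u \<in> g"
    using assms by (auto simp: edges_at_def)
  then obtain p q where pq: "g = {p, q}" "p \<noteq> q" "p \<in> verts G" "q \<in> verts G"
    using simple_edgeE[OF assms(1)] by metis
  show ?thesis
  proof (cases "u = p")
    case True
    then show ?thesis
      using pq g by (intro that[of q]) auto
  next
    case False
    then show ?thesis
      using pq g by (intro that[of p]) (auto simp: insert_commute)
  qed
qed

lemma leaf_edge_cut:
  assumes t: "tree G" and x: "x \<in> leaves G"
  obtains y where "edges_at G x = {{x, y}}" "y \<noteq> x" "y \<in> verts G" "is_cut G {x, y} {x}"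
proof -
  have "card (edges_at G x) = 1"
    using x by (simp add: leaves_def degree_eq)
  then obtain e where e: "edges_at G x = {e}"
    by (meson card_1_singletonE)
  then have "e \<in> edges_at G x"
    by simp
  then obtain y where y: "e = {x, y}" "y \<noteq> x" "{x, y} \<in> edges G" "y \<in> verts G"
    by (rule edges_atE[OF tree_simple[OF t]])
  have "crosses f {x} \<longleftrightarrow> f = e" if f: "f \<in> edges G" for f
  proof -
    obtain p q where pq: "f = {p, q}" "p \<noteq> q"
      using simple_edgeE[OF tree_simple[OF t] f] by metis
    have "f \<in> edges_at G x \<longleftrightarrow> f = e"
      using e by simp
    then have "x \<in> f \<longleftrightarrow> f = e"
      using f by (simp add: edges_at_def)
    moreover have "crosses f {x} \<longleftrightarrow> x \<in> f"
      using pq by auto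
    ultimately show ?thesis
      by simp
  qed
  then have "is_cut G {x, y} {x}"
    using y(1,3) unfolding is_cut_def by simp
  with e y show ?thesis
    by (intro that[of y]) simp_all
qed

section \<open>Branches of a tree at a vertex\<close>

lemma finite_edges_at: "tree G \<Longrightarrow> finite (edges_at G u)"
  by (simp add: edges_at_def tree_finite(2))

text \<open>\<open>C\<close> is the branch at \<open>u\<close> behind \<open>g\<close>. Since
  \<open>g\<close> contains \<open>u\<close>, which is not in \<open>B\<close>, it does not meet
  \<open>B\<close>; so \<open>B\<close> lies inside \<open>C\<close> or is disjoint from it.\<close>

lemma cut_nested_at:
  assumes t: "tree G" and g: "g \<in> edges_at G u" "is_cut G g C" "u \<notin> C"
    and f: "is_cut G f B" "u \<notin> B" "f \<noteq> g"
  shows "verts G \<inter> B \<inter> C = {} \<or> verts G \<inter> B \<subseteq> C"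
proof -
  have gB: "g \<inter> B = {}"
    using cut_edge_cases[OF f(1), of g] g(1) f by (auto simp: edges_at_def)
  have C': "is_cut G g (- C)"
    using g by simp
  consider "f \<subseteq> C" | "f \<inter> C = {}"
    using cut_edge_cases[OF g(2) cut_edge[OF f(1)] f(3)] by blast
  then show ?thesis
    using cut_corner[OF t g(2) f(1) gB] cut_corner[OF t C' f(1) gB] by cases auto
qed

lemma branches_disjoint:
  assumes t: "tree G" and g: "g \<in> edges_at G u" "is_cut G g C" "u \<notin> C"
    and h: "h \<in> edges_at G u" "is_cut G h B" "u \<notin> B" and ne: "g \<noteq> h"
  shows "verts G \<inter> B \<inter> C = {}"
proof -
  have gB: "g \<inter> B = {}"
    using cut_edge_cases[OF h(2), of g] g h ne by (auto simp: edges_at_def)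
  have hC: "h \<subseteq> - C"
    using cut_edge_cases[OF g(2), of h] g h ne by (auto simp: edges_at_def)
  have C': "is_cut G g (- C)"
    using g by simp
  show ?thesis
    using cut_corner[OF t C' h(2) gB hC] by auto
qed

lemma cut_nonempty: "tree G \<Longrightarrow> is_cut G e A \<Longrightarrow> \<exists>u\<in>e. u \<in> A \<and> u \<in> verts G"
  using cut_crosses[of G e A e] cut_edge[of G e A] tree_simple[of G]
  by (auto simp: crosses_def simple_graph_def)

text \<open>Descent: if the end of \<open>e\<close> in \<open>A\<close> is not a leaf, it has
  another edge, and the branch behind that edge lies in \<open>A\<close> and misses this end, hence
  is smaller.\<close>

lemma cut_has_leaf:
  assumes t: "tree G" and "is_cut G e A"
  shows "\<exists>x\<in>leaves G. x \<in> A"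
  using assms(2)
proof (induction "card (A \<inter> verts G)" arbitrary: e A rule: less_induct)
  case less
  obtain u where u: "u \<in> e" "u \<in> A" "u \<in> verts G"
    using cut_nonempty[OF t less.prems] by blast
  have eu: "e \<in> edges_at G u"
    using u cut_edge[OF less.prems] by (simp add: edges_at_def)
  show ?case
  proof (cases "edges_at G u = {e}")
    case True
    then have "u \<in> leaves G"
      using u by (simp add: leaves_def degree_eq)
    then show ?thesis using u by blast
  next
    case False
    then obtain f where f: "f \<in> edges_at G u" "f \<noteq> e"
      using eu by blast
    define B where "B = (if u \<in> side G f then - side G f else side G f)"
    have B: "is_cut G f B" "u \<notin> B"
      using cut_side[OF t, of f] f by (auto simp: B_def edges_at_def)
    have A': "is_cut G e (- A)" "u \<notin> - A"
      using less.prems u by auto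
    have "verts G \<inter> B \<subseteq> A"
      using branches_disjoint[OF t eu A' f(1) B] f(2) by blast
    then have "B \<inter> verts G \<subset> A \<inter> verts G"
      using u B by blast
    then have "card (B \<inter> verts G) < card (A \<inter> verts G)"
      using tree_finite(1)[OF t] by (intro psubset_card_mono) auto
    then obtain x where "x \<in> leaves G" "x \<in> B"
      using less.hyps B(1) by blast
    then show ?thesis
      using \<open>verts G \<inter> B \<subseteq> A\<close> by (auto simp: leaves_def)
  qed
qed

text \<open>A cut that avoids \<open>u\<close> fits into a single branch at \<open>u\<close>, so two
  of them occupy at most two branches; a third branch exists and contains a leaf.\<close>

lemma leaf_outside_two_cuts:
  assumes t: "tree G" and u: "u \<in> verts G" "3 \<le> degree G u"
    and B: "is_cut G e B" "u \<notin> B" "is_cut G e' B'" "u \<notin> B'"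
  shows "\<exists>x\<in>leaves G. x \<notin> B \<and> x \<notin> B'"
proof -
  define C where "C g = (if u \<in> side G g then - side G g else side G g)" for g
  have C: "is_cut G g (C g)" "u \<notin> C g" if "g \<in> edges_at G u" for g
    using cut_side[OF t, of g] that by (auto simp: C_def edges_at_def)
  define M where "M A = {g \<in> edges_at G u. verts G \<inter> A \<inter> C g \<noteq> {}}" for A
  have M: "card (M A) \<le> 1" if A: "is_cut G f A" "u \<notin> A" for f A
  proof -
    have "g = h" if g: "g \<in> M A" and h: "h \<in> M A" for g h
    proof (rule ccontr)
      assume ne: "g \<noteq> h"
      have in_C: "verts G \<inter> A \<subseteq> C k" if k: "k \<in> M A" for k
      proof (cases "f = k")
        case True
        have k': "k \<in> edges_at G u"
          using k by (simp add: M_def)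
        then show ?thesis
          using cut_eq_or_Compl[OF t A(1), of "C k"] C[OF k'] True u(1) A(2) by blast
      next
        case False
        have k': "k \<in> edges_at G u" "verts G \<inter> A \<inter> C k \<noteq> {}"
          using k by (simp_all add: M_def)
        then show ?thesis
          using cut_nested_at[OF t k'(1) C[OF k'(1)] A False] by blast
      qed
      have gh: "g \<in> edges_at G u" "h \<in> edges_at G u"
        using g h by (auto simp: M_def)
      show False
        using in_C[OF g] in_C[OF h] cut_nonempty[OF t A(1)]
          branches_disjoint[OF t gh(1) C[OF gh(1)] gh(2) C[OF gh(2)] ne] by blast
    qed
    then show ?thesis
      by (metis One_nat_def card_le_Suc0_iff_eq card.infinite le0)
  qed
  have "card (M B \<union> M B') \<le> 2"
    using M[OF B(1,2)] M[OF B(3,4)] card_Un_le[of "M B" "M B'"] by linarith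
  then have "\<not> edges_at G u \<subseteq> M B \<union> M B'"
    using u(2) card_mono[of "M B \<union> M B'" "edges_at G u"] finite_edges_at[OF t, of u]
    by (auto simp: degree_eq M_def)
  then obtain g where g: "g \<in> edges_at G u" "g \<notin> M B" "g \<notin> M B'"
    by blast
  obtain x where x: "x \<in> leaves G" "x \<in> C g"
    using cut_has_leaf[OF t C(1)[OF g(1)]] by blast
  then have "x \<in> verts G" by (simp add: leaves_def)
  with x g show ?thesis
    by (auto simp: M_def)
qed

lemma edges_at_nonempty:
  assumes t: "tree G" and u: "u \<in> verts G" and e: "e \<in> edges G"
  shows "edges_at G u \<noteq> {}"
proof -
  obtain p q where pq: "p \<noteq> q" "p \<in> verts G" "q \<in> verts G"
    using simple_edgeE[OF tree_simple[OF t] e] by metis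
  then obtain z where "z \<in> verts G" "u \<noteq> z"
    by metis
  then obtain w where "{u, w} \<in> edges G"
    using edge_towards[OF t u] by metis
  then show ?thesis
    by (auto simp: edges_at_def)
qed

lemma essential_leaf_outside:
  assumes t: "tree G" and ess: "essential G" and u: "u \<in> verts G"
    and B: "is_cut G e B" "u \<notin> B" "is_cut G e' B'" "u \<notin> B'"
  shows "\<exists>x\<in>leaves G. x \<notin> B \<and> x \<notin> B'"
proof (cases "degree G u = 1")
  case True
  then show ?thesis
    using u B by (auto simp: leaves_def)
next
  case False
  have "degree G u \<noteq> 0"
    using edges_at_nonempty[OF t u cut_edge[OF B(1)]] finite_edges_at[OF t, of u]
    by (simp add: degree_eq)
  moreover have "degree G u \<noteq> 2"
    using ess u by (auto simp: essential_def)
  ultimately have "3 \<le> degree G u"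
    using False by linarith
  then show ?thesis
    using leaf_outside_two_cuts[OF t u _ B] by blast
qed

text \<open>After passing to complements, \<open>e\<close> lies outside \<open>B\<close>. Its end in
  \<open>A\<close> then yields, by essentiality, a leaf that is in \<open>A\<close> but not in
  \<open>B\<close>.\<close>

lemma essential_cut_inj:
  assumes t: "tree G" and ess: "essential G" and A: "is_cut G e A" and B: "is_cut G f B"
    and eq: "A \<inter> leaves G = B \<inter> leaves G"
  shows "e = f"
proof (rule ccontr)
  assume ne: "e \<noteq> f"
  have leaf: "leaves G \<subseteq> verts G"
    by (auto simp: leaves_def)
  have sub: False if A: "is_cut G e A" and B: "is_cut G f B" and eq: "A \<inter> leaves G = B \<inter> leaves G"
    and eB: "e \<inter> B = {}" for e f A B
  proof -
    obtain u where u: "u \<in> e" "u \<in> A" "u \<in> verts G"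
      using cut_nonempty[OF t A] by blast
    have "\<exists>x\<in>leaves G. x \<notin> - A \<and> x \<notin> B"
      by (rule essential_leaf_outside[OF t ess u(3), of e _ f]) (use A B u eB in auto)
    then show False
      using eq by blast
  qed
  have Bc: "is_cut G f (- B)" and Ac: "is_cut G e (- A)"
    using A B by simp_all
  consider "e \<inter> B = {}" | "e \<inter> - B = {}"
    using cut_edge_cases[OF B cut_edge[OF A] ne] by blast
  then show False
  proof cases
    case 1
    then show ?thesis using sub[OF A B eq] by simp
  next
    case 2
    then show ?thesis using sub[OF Ac Bc] eq by blast
  qed
qed

lemma leaf_side_eq:
  assumes t: "tree G" and A: "is_cut G e A" and u: "u \<in> e" "u \<in> A"
  shows "leaf_side G e u = A \<inter> leaves G"
proof -
  have uV: "u \<in> verts G"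
    using u(1) cut_edge[OF A] tree_simple[OF t] by (auto simp: simple_graph_def)
  have adj: "adj (delete_edge G e) = (\<lambda>p q. {p, q} \<in> edges G - {e})"
    by (auto simp: fun_eq_iff adj_def delete_edge_def)
  have "(adj (delete_edge G e))\<^sup>*\<^sup>* u x \<longleftrightarrow> x \<in> A" if x: "x \<in> verts G" for x
  proof
    assume r: "(adj (delete_edge G e))\<^sup>*\<^sup>* u x"
    have "(u \<in> A) = (x \<in> A)"
      by (rule rtranclp_invariant[OF r, where P = "\<lambda>z. z \<in> A"])
        (use cut_same_side[OF A] in \<open>auto simp: adj\<close>)
    then show "x \<in> A" using u by simp
  next
    assume "x \<in> A"
    moreover have "(\<lambda>p q. {p, q} \<in> edges G)\<^sup>*\<^sup>* u x"
      using tree_connected[OF t] uV x by (auto simp: connected_graph_def adj_def[abs_def])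
    ultimately show "(adj (delete_edge G e))\<^sup>*\<^sup>* u x"
      unfolding adj using cut_retract[OF A, of "edges G" u x] u by simp
  qed
  then show ?thesis
    by (auto simp: leaf_side_def leaves_def)
qed

section \<open>Weights of leaf splits\<close>

text \<open>A set of edges, because in a tree with vertices of degree 2 a whole chain of edges can
  induce the same split; \<open>split_weight\<close> adds up the chain.\<close>

definition cluster_edges :: "'v graph \<Rightarrow> 'v set \<Rightarrow> 'v set set" where
  "cluster_edges G A = {e. \<exists>B. is_cut G e B \<and> B \<inter> leaves G = A}"

definition split_weight :: "'v wtree \<Rightarrow> 'v set \<Rightarrow> real" where
  "split_weight T A = (\<Sum>e\<in>cluster_edges (shape T) A. weight T e)"

lemma leaves_subset: "leaves G \<subseteq> verts G"
  by (auto simp: leaves_def)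

lemma cluster_edges_subset: "cluster_edges G A \<subseteq> edges G"
  by (auto simp: cluster_edges_def dest: cut_edge)

lemma finite_leaves: "tree G \<Longrightarrow> finite (leaves G)"
  by (rule finite_subset[OF leaves_subset tree_finite(1)])

lemma cluster_edges_iff:
  assumes t: "tree G" and e: "e \<in> edges G"
  shows "e \<in> cluster_edges G A \<longleftrightarrow> A = side G e \<inter> leaves G \<or> A = leaves G - side G e"
proof -
  have c: "is_cut G e (side G e)" and c': "is_cut G e (- side G e)"
    using cut_side[OF t e] by simp_all
  have "B \<inter> leaves G = side G e \<inter> leaves G \<or> B \<inter> leaves G = leaves G - side G e" if "is_cut G e B" for B
    using cut_eq_or_Compl[OF t that c] leaves_subset[of G] by blast
  moreover have "- side G e \<inter> leaves G = leaves G - side G e"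
    by blast
  ultimately show ?thesis
    unfolding cluster_edges_def using c c' by blast
qed

lemma cluster_edges_Compl:
  assumes t: "tree G" and A: "A \<subseteq> leaves G"
  shows "cluster_edges G (leaves G - A) = cluster_edges G A"
proof -
  have "e \<in> cluster_edges G (leaves G - A) \<longleftrightarrow> e \<in> cluster_edges G A" if e: "e \<in> edges G" for e
    unfolding cluster_edges_iff[OF t e] using A by blast
  then show ?thesis
    using cluster_edges_subset[of G] by blast
qed

lemma D_of_eq_sum_of_bool:
  assumes "tree (shape T)" "I \<subseteq> verts (shape T)" "I \<noteq> {}"
  shows "D_of T I = (\<Sum>e\<in>edges (shape T). weight T e * of_bool (crosses I (side (shape T) e)))"
  unfolding D_of_eq_sum[OF assms]
  by (rule sum.mono_neutral_cong_left) (use tree_finite(2)[OF assms(1)] in auto)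

text \<open>The multiplicity with which the weight of an edge with side \<open>S\<close> enters
  \<open>D_ilR + D_jmR - D_ijR - D_lmR\<close>. For nonempty \<open>R\<close> it is 0 or 1 if the
  edge splits the four leaves as \<open>ij | lm\<close>, 0 or -1 for \<open>il | jm\<close>, and 0
  otherwise.\<close>

definition quartet_coeff :: "'v \<Rightarrow> 'v \<Rightarrow> 'v \<Rightarrow> 'v \<Rightarrow> 'v set \<Rightarrow> 'v set \<Rightarrow> real" where
  "quartet_coeff i j l m R S =
     of_bool (crosses ({i, l} \<union> R) S) + of_bool (crosses ({j, m} \<union> R) S)
     - of_bool (crosses ({i, j} \<union> R) S) - of_bool (crosses ({l, m} \<union> R) S)"

definition separates_pairs :: "'v \<Rightarrow> 'v \<Rightarrow> 'v \<Rightarrow> 'v \<Rightarrow> 'v set \<Rightarrow> bool" where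
  "separates_pairs i j l m S \<longleftrightarrow> (i \<in> S) = (j \<in> S) \<and> (l \<in> S) = (m \<in> S) \<and> (i \<in> S) \<noteq> (l \<in> S)"

lemma crosses_pair_Un:
  assumes "r \<in> R"
  shows "crosses ({a, b} \<union> R) S \<longleftrightarrow> crosses R S \<or> (a \<in> S) \<noteq> (r \<in> S) \<or> (b \<in> S) \<noteq> (r \<in> S)"
  using assms unfolding crosses_def by blast

text \<open>An element \<open>r\<close> of \<open>R\<close> tells on which side an uncrossed
  \<open>R\<close> lies, which reduces this and the next two facts to a truth table.\<close>

lemma quartet_coeff_le:
  assumes "R \<noteq> {}"
  shows "quartet_coeff i j l m R S \<le> of_bool (separates_pairs i j l m S)"
proof -
  obtain r where r: "r \<in> R" using assms by blast
  show ?thesis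
    unfolding quartet_coeff_def separates_pairs_def crosses_pair_Un[OF r]
    by (cases "crosses R S"; cases "i \<in> S"; cases "j \<in> S"; cases "l \<in> S"; cases "m \<in> S"; cases "r \<in> S") simp_all
qed

lemma quartet_coeff_nonneg:
  assumes "R \<noteq> {}" "\<not> separates_pairs i l j m S"
  shows "0 \<le> quartet_coeff i j l m R S"
proof -
  obtain r where r: "r \<in> R" using assms by blast
  show ?thesis
    using assms(2) unfolding quartet_coeff_def separates_pairs_def crosses_pair_Un[OF r]
    by (cases "crosses R S"; cases "i \<in> S"; cases "j \<in> S"; cases "l \<in> S"; cases "m \<in> S"; cases "r \<in> S") simp_all
qed

lemma quartet_coeff_eq_1:
  assumes "R \<noteq> {}" "separates_pairs i j l m S" "\<not> crosses (insert i R) S"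
  shows "quartet_coeff i j l m R S = 1"
proof -
  obtain r where r: "r \<in> R" using assms by blast
  have "\<not> crosses R S" "(i \<in> S) = (r \<in> S)"
    using assms(3) r unfolding crosses_def by blast+
  then show ?thesis
    using assms(2) unfolding quartet_coeff_def separates_pairs_def crosses_pair_Un[OF r]
    by (cases "i \<in> S"; cases "j \<in> S"; cases "l \<in> S"; cases "m \<in> S"; cases "r \<in> S") simp_all
qed

lemma D_of_quartet:
  assumes t: "tree (shape T)" and "{i, j, l, m} \<union> R \<subseteq> verts (shape T)"
  shows "D_of T ({i, l} \<union> R) + D_of T ({j, m} \<union> R) - D_of T ({i, j} \<union> R) - D_of T ({l, m} \<union> R) =
    (\<Sum>e\<in>edges (shape T). weight T e * quartet_coeff i j l m R (side (shape T) e))"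
proof -
  have eq: "D_of T ({a, b} \<union> R) =
      (\<Sum>e\<in>edges (shape T). weight T e * of_bool (crosses ({a, b} \<union> R) (side (shape T) e)))"
    if "a \<in> {i, j, l, m}" "b \<in> {i, j, l, m}" for a b
    by (rule D_of_eq_sum_of_bool[OF t]) (use assms(2) that in auto)
  have eqs: "D_of T ({i, l} \<union> R) = (\<Sum>e\<in>edges (shape T). weight T e * of_bool (crosses ({i, l} \<union> R) (side (shape T) e)))"
    "D_of T ({j, m} \<union> R) = (\<Sum>e\<in>edges (shape T). weight T e * of_bool (crosses ({j, m} \<union> R) (side (shape T) e)))"
    "D_of T ({i, j} \<union> R) = (\<Sum>e\<in>edges (shape T). weight T e * of_bool (crosses ({i, j} \<union> R) (side (shape T) e)))"
    "D_of T ({l, m} \<union> R) = (\<Sum>e\<in>edges (shape T). weight T e * of_bool (crosses ({l, m} \<union> R) (side (shape T) e)))"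
    by (rule eq; blast)+
  show ?thesis
    unfolding eqs quartet_coeff_def
    by (simp only: sum.distrib[symmetric] sum_subtractf[symmetric] distrib_left right_diff_distrib)
qed

lemma positive_weightD:
  "positive_weighted_tree T \<Longrightarrow> tree (shape T)"
  "positive_weighted_tree T \<Longrightarrow> e \<in> edges (shape T) \<Longrightarrow> weight T e > 0"
  by (auto simp: positive_weighted_tree_def)

lemma split_weight_eq_sum_of_bool:
  assumes "tree (shape T)"
  shows "split_weight T A = (\<Sum>e\<in>edges (shape T). weight T e * of_bool (e \<in> cluster_edges (shape T) A))"
  unfolding split_weight_def
  by (rule sum.mono_neutral_cong_left)
    (use tree_finite(2)[OF assms] cluster_edges_subset[of "shape T" A] in auto)

lemma split_weight_nonneg: "positive_weighted_tree T \<Longrightarrow> 0 \<le> split_weight T A"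
  unfolding split_weight_def
  by (intro sum_nonneg) (metis cluster_edges_subset less_imp_le positive_weightD(2) subsetD)

lemma split_weight_pos:
  assumes "positive_weighted_tree T" "cluster_edges (shape T) A \<noteq> {}"
  shows "0 < split_weight T A"
  unfolding split_weight_def
proof (rule sum_pos)
  show "finite (cluster_edges (shape T) A)"
    using cluster_edges_subset tree_finite(2)[OF positive_weightD(1)[OF assms(1)]] finite_subset by metis
  show "0 < weight T e" if "e \<in> cluster_edges (shape T) A" for e
    using positive_weightD(2)[OF assms(1)] cluster_edges_subset that by (metis subsetD)
qed (use assms in auto)

text \<open>Some cut of the tree has \<open>i\<close>, \<open>j\<close> on one side and
  \<open>l\<close>, \<open>m\<close> on the other, so by compatibility no edge splits them as
  \<open>il | jm\<close> and no coefficient is negative. An edge that induces the split has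
  coefficient 1, because \<open>insert i R\<close> stays inside \<open>A\<close>.\<close>

lemma split_weight_le_quartet:
  assumes T: "positive_weighted_tree T" and X: "leaves (shape T) = X"
    and A: "cluster_edges (shape T) A \<noteq> {}" and i: "i \<in> A" "j \<in> A" and l: "l \<in> X - A" "m \<in> X - A"
    and R: "R \<subseteq> A" "R \<noteq> {}"
  shows "split_weight T A \<le>
    D_of T ({i, l} \<union> R) + D_of T ({j, m} \<union> R) - D_of T ({i, j} \<union> R) - D_of T ({l, m} \<union> R)"
proof -
  let ?G = "shape T"
  have t: "tree ?G"
    using T by (rule positive_weightD)
  have XV: "X \<subseteq> verts ?G"
    using leaves_subset[of ?G] X by simp
  obtain e0 B where B: "is_cut ?G e0 B" "B \<inter> X = A"
    using A X by (auto simp: cluster_edges_def)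
  have iB: "i \<in> B" "j \<in> B" "l \<notin> B" "m \<notin> B" "i \<in> verts ?G" "j \<in> verts ?G" "l \<in> verts ?G" "m \<in> verts ?G"
    using i l B XV by blast+
  have "of_bool (e \<in> cluster_edges ?G A) \<le> quartet_coeff i j l m R (side ?G e)" if e: "e \<in> edges ?G" for e
  proof (cases "e \<in> cluster_edges ?G A")
    case True
    then have "A = side ?G e \<inter> X \<or> A = X - side ?G e"
      using cluster_edges_iff[OF t e] X by simp
    then have "separates_pairs i j l m (side ?G e)" "\<not> crosses (insert i R) (side ?G e)"
      using i l R unfolding separates_pairs_def crosses_def by blast+
    then show ?thesis
      using quartet_coeff_eq_1[OF R(2)] by simp
  next
    case False
    have "\<not> separates_pairs i l j m (side ?G e)"
      using cut_compatible[OF t B(1) cut_side[OF t e]] iB unfolding separates_pairs_def by blast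
    then show ?thesis
      using quartet_coeff_nonneg[OF R(2)] False by simp
  qed
  then have "split_weight T A \<le> (\<Sum>e\<in>edges ?G. weight T e * quartet_coeff i j l m R (side ?G e))"
    unfolding split_weight_eq_sum_of_bool[OF t]
    by (intro sum_mono mult_left_mono) (use positive_weightD(2)[OF T] less_imp_le in auto)
  also have "\<dots> = D_of T ({i, l} \<union> R) + D_of T ({j, m} \<union> R) - D_of T ({i, j} \<union> R) - D_of T ({l, m} \<union> R)"
    by (rule D_of_quartet[OF t, symmetric]) (use iB R B XV in blast)
  finally show ?thesis .
qed

text \<open>Among the quartets with \<open>i, j\<close> in \<open>A\<close> and \<open>l, m\<close> outside, one separated by as few
  edges as possible is separated only by edges that split the leaves into \<open>A\<close> and its complement:
  a leaf on the wrong side of any other separating edge could replace one of the four leaves.\<close>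

lemma quartet_isolating_split:
  assumes t: "tree G" and A: "A \<subseteq> leaves G" "2 \<le> card A" "2 \<le> card (leaves G - A)"
  obtains i j l m where "i \<in> A" "j \<in> A" "i \<noteq> j" "l \<in> leaves G - A" "m \<in> leaves G - A" "l \<noteq> m"
    "\<And>e. e \<in> edges G \<Longrightarrow> separates_pairs i j l m (side G e) \<Longrightarrow> e \<in> cluster_edges G A"
proof -
  let ?X = "leaves G"
  define N where "N i j l m = {e \<in> edges G. separates_pairs i j l m (side G e)}" for i j l m
  define Q where "Q = (\<lambda>(i, j, l, m). i \<in> A \<and> j \<in> A \<and> i \<noteq> j \<and> l \<in> ?X - A \<and> m \<in> ?X - A \<and> l \<noteq> m)"
  obtain i0 j0 l0 m0 where "i0 \<in> A" "j0 \<in> A" "i0 \<noteq> j0" "l0 \<in> ?X - A" "m0 \<in> ?X - A" "l0 \<noteq> m0"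
    using A(2,3) by (metis card_2_iff' card_le_Suc0_iff_eq numeral_2_eq_2 not_less_eq_eq card.infinite zero_le)
  then have "Q (i0, j0, l0, m0)"
    by (simp add: Q_def)
  then obtain p where p: "Q p"
    and min: "\<And>p'. Q p' \<Longrightarrow> (\<lambda>(i, j, l, m). card (N i j l m)) p \<le> (\<lambda>(i, j, l, m). card (N i j l m)) p'"
    using arg_min_natI[of Q] arg_min_nat_le[of Q] by blast
  obtain i j l m where p_eq: "p = (i, j, l, m)"
    by (cases p) auto
  have q: "i \<in> A" "j \<in> A" "i \<noteq> j" "l \<in> ?X - A" "m \<in> ?X - A" "l \<noteq> m"
    using p by (auto simp: p_eq Q_def)
  have min': "card (N i j l m) \<le> card (N i' j' l' m')"
    if "i' \<in> A" "j' \<in> A" "i' \<noteq> j'" "l' \<in> ?X - A" "m' \<in> ?X - A" "l' \<noteq> m'" for i' j' l' m'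
    using min[of "(i', j', l', m')"] that by (simp add: p_eq Q_def)
  have finN: "finite (N a b c d)" for a b c d
    using tree_finite(2)[OF t] by (simp add: N_def)
  have XV: "?X \<subseteq> verts G"
    by (rule leaves_subset)
  have V: "i \<in> verts G" "j \<in> verts G" "l \<in> verts G" "m \<in> verts G"
    using q A(1) XV by blast+
  have "e \<in> cluster_edges G A" if e: "e \<in> edges G" "separates_pairs i j l m (side G e)" for e
  proof (rule ccontr)
    assume not: "e \<notin> cluster_edges G A"
    define C where "C = (if i \<in> side G e then side G e else - side G e)"
    have C: "is_cut G e C"
      using cut_side[OF t e(1)] by (simp add: C_def)
    have inC: "i \<in> C" "j \<in> C" "l \<notin> C" "m \<notin> C"
      using e(2) by (auto simp: C_def separates_pairs_def)
    have eN: "e \<in> N i j l m"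
      using e by (simp add: N_def)
    have "C \<inter> ?X \<noteq> A"
      using not C by (auto simp: cluster_edges_def)
    then consider x where "x \<in> A" "x \<notin> C" | x where "x \<in> ?X - A" "x \<in> C"
      using A(1) by blast
    then show False
    proof cases
      case 1
      have xV: "x \<in> verts G" using 1 A XV by blast
      \<comment> \<open>An edge with \<open>ix | lm\<close> and \<open>j\<close> on the side of
        \<open>l\<close> would be incompatible with the cut \<open>C\<close>: \<open>i\<close>,
        \<open>x\<close>, \<open>j\<close>, \<open>l\<close> would occupy all four corners.\<close>
      have "N i x l m \<subseteq> N i j l m"
      proof
        fix f assume "f \<in> N i x l m"
        then have f: "f \<in> edges G" "separates_pairs i x l m (side G f)"
          by (auto simp: N_def)
        have "separates_pairs i j l m (side G f)"
          using cut_compatible[OF t C cut_side[OF t f(1)]] inC V xV 1 f(2)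
          unfolding separates_pairs_def by blast
        then show "f \<in> N i j l m"
          using f by (simp add: N_def)
      qed
      moreover have "e \<notin> N i x l m"
        using 1 inC e by (auto simp: N_def separates_pairs_def C_def split: if_splits)
      ultimately have "card (N i x l m) < card (N i j l m)"
        using eN finN by (intro psubset_card_mono) auto
      then show False
        using min'[of i x l m] q 1 inC by fastforce
    next
      case 2
      have xV: "x \<in> verts G" using 2 XV by blast
      have "N i j l x \<subseteq> N i j l m"
      proof
        fix f assume "f \<in> N i j l x"
        then have f: "f \<in> edges G" "separates_pairs i j l x (side G f)"
          by (auto simp: N_def)
        have "separates_pairs i j l m (side G f)"
          using cut_compatible[OF t C cut_side[OF t f(1)]] inC V xV 2 f(2)
          unfolding separates_pairs_def by blast
        then show "f \<in> N i j l m"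
          using f by (simp add: N_def)
      qed
      moreover have "e \<notin> N i j l x"
        using 2 inC e by (auto simp: N_def separates_pairs_def C_def split: if_splits)
      ultimately have "card (N i j l x) < card (N i j l m)"
        using eN finN by (intro psubset_card_mono) auto
      then show False
        using min'[of i j l x] q 2 inC by fastforce
    qed
  qed
  with q that show ?thesis by metis
qed

text \<open>The quartet depends on the tree and on \<open>A\<close>, not on \<open>R\<close>. The
  order matters, since \<open>R\<close> is chosen afterwards so as to avoid \<open>i\<close> and
  \<open>j\<close>.\<close>

lemma quartet_le_split_weight:
  assumes T: "positive_weighted_tree T" and X: "leaves (shape T) = X"
    and A: "A \<subseteq> X" "2 \<le> card A" "2 \<le> card (X - A)"
  obtains i j l m where "i \<in> A" "j \<in> A" "i \<noteq> j" "l \<in> X - A" "m \<in> X - A" "l \<noteq> m"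
    "\<And>R. R \<subseteq> A \<Longrightarrow> R \<noteq> {} \<Longrightarrow>
       D_of T ({i, l} \<union> R) + D_of T ({j, m} \<union> R) - D_of T ({i, j} \<union> R) - D_of T ({l, m} \<union> R)
       \<le> split_weight T A"
proof -
  let ?G = "shape T"
  have t: "tree ?G"
    using T by (rule positive_weightD)
  obtain i j l m where q: "i \<in> A" "j \<in> A" "i \<noteq> j" "l \<in> X - A" "m \<in> X - A" "l \<noteq> m"
    and iso: "\<And>e. e \<in> edges ?G \<Longrightarrow> separates_pairs i j l m (side ?G e) \<Longrightarrow> e \<in> cluster_edges ?G A"
    using quartet_isolating_split[OF t, of A] A unfolding X by metis
  have "D_of T ({i, l} \<union> R) + D_of T ({j, m} \<union> R) - D_of T ({i, j} \<union> R) - D_of T ({l, m} \<union> R)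
       \<le> split_weight T A" if R: "R \<subseteq> A" "R \<noteq> {}" for R
  proof -
    have sub: "{i, j, l, m} \<union> R \<subseteq> verts ?G"
      using q R A leaves_subset[of ?G] unfolding X by blast
    have "quartet_coeff i j l m R (side ?G e) \<le> of_bool (e \<in> cluster_edges ?G A)" if "e \<in> edges ?G" for e
      using quartet_coeff_le[OF R(2), of i j l m "side ?G e"] iso[OF that]
      by (cases "separates_pairs i j l m (side ?G e)") (auto intro: order_trans)
    then show ?thesis
      unfolding split_weight_eq_sum_of_bool[OF t] D_of_quartet[OF t sub]
      by (intro sum_mono mult_left_mono) (use positive_weightD(2)[OF T] less_imp_le in auto)
  qed
  with q that show ?thesis by metis
qed

text \<open>The quartet is adapted to \<open>T'\<close>, where the four-term number is at most the
  split weight; in \<open>T\<close> it is at least the split weight for any quartet. The number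
  itself is the same for both trees.\<close>

lemma split_weight_le_if_same_D:
  assumes T: "positive_weighted_tree T" "leaves (shape T) = X"
    and T': "positive_weighted_tree T'" "leaves (shape T') = X"
    and D: "\<And>I. I \<subseteq> X \<Longrightarrow> card I = k \<Longrightarrow> D_of T I = D_of T' I"
    and k: "3 \<le> k" and A: "A \<subseteq> X" "k \<le> card A" "2 \<le> card (X - A)"
  shows "split_weight T A \<le> split_weight T' A"
proof (cases "cluster_edges (shape T) A = {}")
  case True
  then have "split_weight T A = 0"
    by (simp add: split_weight_def)
  then show ?thesis
    using split_weight_nonneg[OF T'(1)] by simp
next
  case False
  have A2: "2 \<le> card A"
    using A k by linarith
  obtain i j l m where q: "i \<in> A" "j \<in> A" "i \<noteq> j" "l \<in> X - A" "m \<in> X - A" "l \<noteq> m"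
    and le: "\<And>R. R \<subseteq> A \<Longrightarrow> R \<noteq> {} \<Longrightarrow>
       D_of T' ({i, l} \<union> R) + D_of T' ({j, m} \<union> R) - D_of T' ({i, j} \<union> R) - D_of T' ({l, m} \<union> R)
       \<le> split_weight T' A"
    using quartet_le_split_weight[OF T' A(1) A2 A(3)] by metis
  have finA: "finite A"
    using A k card.infinite by fastforce
  \<comment> \<open>\<open>k \<le> card A\<close> leaves room for \<open>k - 2\<close> leaves beside
    \<open>i\<close> and \<open>j\<close>; \<open>k \<ge> 3\<close> keeps \<open>R\<close>
    nonempty.\<close>
  have "k - 2 \<le> card (A - {i, j})"
    using q A finA by (simp add: card_Diff_subset)
  then obtain R where R: "R \<subseteq> A - {i, j}" "card R = k - 2" "finite R"
    using obtain_subset_with_card_n by metis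
  have R0: "R \<noteq> {}"
    using R k by auto
  have "D_of T ({a, b} \<union> R) = D_of T' ({a, b} \<union> R)"
    if "a \<noteq> b" "a \<in> {i, j} \<union> (X - A)" "b \<in> {i, j} \<union> (X - A)" for a b
  proof (rule D)
    show "{a, b} \<union> R \<subseteq> X"
      using that q R A by blast
    have "{a, b} \<inter> R = {}"
      using that R by blast
    then have "card ({a, b} \<union> R) = 2 + (k - 2)"
      using that R by (subst card_Un_disjoint) auto
    then show "card ({a, b} \<union> R) = k"
      using k by simp
  qed
  note eq = this
  have ne: "i \<noteq> l" "j \<noteq> m"
    using q by auto
  have eqs: "D_of T ({i, l} \<union> R) = D_of T' ({i, l} \<union> R)" "D_of T ({j, m} \<union> R) = D_of T' ({j, m} \<union> R)"
    "D_of T ({i, j} \<union> R) = D_of T' ({i, j} \<union> R)" "D_of T ({l, m} \<union> R) = D_of T' ({l, m} \<union> R)"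
    by (rule eq; use q ne in blast)+
  have RA: "R \<subseteq> A"
    using R by blast
  show ?thesis
    using split_weight_le_quartet[OF T False q(1,2,4,5) RA R0] le[OF RA R0] unfolding eqs by linarith
qed

lemma split_weight_determined:
  assumes "positive_weighted_tree T" "leaves (shape T) = X"
    and "positive_weighted_tree T'" "leaves (shape T') = X"
    and "\<And>I. I \<subseteq> X \<Longrightarrow> card I = k \<Longrightarrow> D_of T I = D_of T' I"
    and "3 \<le> k" "A \<subseteq> X" "k \<le> card A" "2 \<le> card (X - A)"
  shows "split_weight T A = split_weight T' A"
  using split_weight_le_if_same_D[OF assms(1-4), of k A] split_weight_le_if_same_D[OF assms(3,4,1,2), of k A]
    assms(5-) by (metis order_antisym)

section \<open>Contraction and suppression\<close>

definition merge :: "'v \<Rightarrow> 'v \<Rightarrow> 'v \<Rightarrow> 'v" where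
  "merge a v x = (if x = v then a else x)"

text \<open>Contracts the edge \<open>{a, v}\<close> to \<open>a\<close>. This one operation serves
  for suppressing a vertex of degree 2, removing a leaf and removing a bad edge; only the new
  weights differ.\<close>

definition contract :: "'v graph \<Rightarrow> 'v \<Rightarrow> 'v \<Rightarrow> 'v graph" where
  "contract G a v = \<lparr>verts = verts G - {v}, edges = (\<lambda>e. merge a v ` e) ` (edges G - {{a, v}})\<rparr>"

lemma contract_simps [simp]:
  "verts (contract G a v) = verts G - {v}"
  "edges (contract G a v) = (\<lambda>e. merge a v ` e) ` (edges G - {{a, v}})"
  by (simp_all add: contract_def)

lemma contract_edgeE:
  assumes "e \<in> edges (contract G a v)"
  obtains f where "f \<in> edges G" "f \<noteq> {a, v}" "e = merge a v ` f"
  using assms unfolding contract_simps by blast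

lemma merge_crosses:
  assumes "a \<in> A \<longleftrightarrow> v \<in> A"
  shows "crosses (merge a v ` f) A \<longleftrightarrow> crosses f A"
proof -
  have "merge a v x \<in> A \<longleftrightarrow> x \<in> A" for x
    using assms by (simp add: merge_def)
  then show ?thesis
    unfolding crosses_def by blast
qed

text \<open>The cut of an edge other than \<open>{a, v}\<close> does not separate \<open>a\<close>
  from \<open>v\<close>, so the image of an edge crosses it iff the edge does. Two edges with the
  same image would therefore cross the same cut.\<close>

lemma merge_edge_inj:
  assumes t: "tree G" and av: "{a, v} \<in> edges G"
  shows "inj_on (\<lambda>e. merge a v ` e) (edges G - {{a, v}})"
proof (rule inj_onI)
  fix e f assume e: "e \<in> edges G - {{a, v}}" and f: "f \<in> edges G - {{a, v}}"
    and eq: "merge a v ` e = merge a v ` f"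
  have c: "is_cut G e (side G e)"
    using e by (intro cut_side[OF t]) simp
  have "a \<in> side G e \<longleftrightarrow> v \<in> side G e"
    using cut_same_side[OF c av] e by auto
  then have "crosses e (side G e) = crosses f (side G e)"
    using merge_crosses eq by metis
  then show "e = f"
    using cut_crosses[OF c] e f by auto
qed

lemma contract_cut:
  assumes t: "tree G" and av: "{a, v} \<in> edges G" and A: "is_cut G e A" "e \<noteq> {a, v}"
  shows "is_cut (contract G a v) (merge a v ` e) A"
proof -
  have side: "a \<in> A \<longleftrightarrow> v \<in> A"
    using cut_same_side[OF A(1) av] A(2) by auto
  have "crosses (merge a v ` f) A \<longleftrightarrow> merge a v ` f = merge a v ` e"
    if f: "f \<in> edges G - {{a, v}}" for f
  proof -
    have "crosses (merge a v ` f) A \<longleftrightarrow> f = e"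
      using cut_crosses[OF A(1)] f merge_crosses[OF side] by auto
    moreover have "merge a v ` f = merge a v ` e \<longleftrightarrow> f = e"
      using inj_on_eq_iff[OF merge_edge_inj[OF t av]] f A cut_edge[OF A(1)] by auto
    ultimately show ?thesis by simp
  qed
  moreover have "merge a v ` e \<in> edges (contract G a v)"
    using A cut_edge[OF A(1)] by simp
  ultimately show ?thesis
    unfolding is_cut_def by (metis DiffI contract_edgeE singletonD)
qed

lemma contract_tree:
  assumes t: "tree G" and av: "{a, v} \<in> edges G"
  shows "tree (contract G a v)"
proof -
  let ?H = "contract G a v"
  have av': "a \<noteq> v" "a \<in> verts G" "v \<in> verts G"
    using simple_adjD[OF tree_simple[OF t]] av by (auto simp: adj_def)
  have cuts: "\<exists>A. is_cut ?H e A" if e: "e \<in> edges ?H" for e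
  proof -
    obtain f where f: "f \<in> edges G" "f \<noteq> {a, v}" "e = merge a v ` f"
      using e by (rule contract_edgeE)
    then show ?thesis
      using contract_cut[OF t av cut_side[OF t f(1)] f(2)] by blast
  qed
  have "e \<subseteq> verts ?H \<and> card e = 2" if e: "e \<in> edges ?H" for e
  proof -
    obtain f where f: "f \<in> edges G" "f \<noteq> {a, v}" "e = merge a v ` f"
      using e by (rule contract_edgeE)
    obtain p q where pq: "f = {p, q}" "p \<in> verts G" "q \<in> verts G"
      using simple_edgeE[OF tree_simple[OF t] f(1)] by metis
    have e': "e = {merge a v p, merge a v q}"
      using f pq by auto
    obtain A where "is_cut ?H e A"
      using cuts[OF e] by blast
    then have "merge a v p \<noteq> merge a v q"
      using cut_other_side unfolding e' by metis
    then show ?thesis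
      using e' pq av' by (auto simp: merge_def)
  qed
  then have "simple_graph ?H"
    using tree_finite(1)[OF t] unfolding simple_graph_def by simp
  moreover have "connected_graph ?H"
    unfolding connected_graph_def
  proof (intro ballI)
    fix x y assume xy: "x \<in> verts ?H" "y \<in> verts ?H"
    then have "(adj G)\<^sup>*\<^sup>* x y"
      using tree_connected[OF t] by (simp add: connected_graph_def)
    then have "(adj ?H)\<^sup>*\<^sup>* (merge a v x) (merge a v y)"
    proof (induction rule: rtranclp_induct)
      case (step p q)
      have "adj ?H (merge a v p) (merge a v q) \<or> merge a v p = merge a v q"
      proof (cases "{p, q} = {a, v}")
        case True
        then show ?thesis
          by (auto simp: merge_def doubleton_eq_iff)
      next
        case False
        then have "merge a v ` {p, q} \<in> edges ?H"
          using step(2) unfolding adj_def contract_simps by blast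
        then show ?thesis
          by (simp add: adj_def)
      qed
      then show ?case
        using step(3) by (metis rtranclp.rtrancl_into_rtrancl)
    qed simp
    then show "(adj ?H)\<^sup>*\<^sup>* x y"
      using xy by (simp add: merge_def)
  qed
  moreover have "verts ?H \<noteq> {}"
    using av' by auto
  ultimately show ?thesis
    using cuts unfolding tree_iff_cuts by blast
qed

lemma contract_side_crosses:
  assumes t: "tree G" and av: "{a, v} \<in> edges G" and e: "e \<in> edges G" "e \<noteq> {a, v}"
    and I: "I \<subseteq> verts G - {v}"
  shows "crosses I (side (contract G a v) (merge a v ` e)) \<longleftrightarrow> crosses I (side G e)"
proof (rule cut_unique_crosses[OF contract_tree[OF t av]])
  show "is_cut (contract G a v) (merge a v ` e) (side (contract G a v) (merge a v ` e))"
    using e by (intro cut_side[OF contract_tree[OF t av]]) auto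
  show "is_cut (contract G a v) (merge a v ` e) (side G e)"
    using contract_cut[OF t av cut_side[OF t e(1)] e(2)] .
qed (use I in auto)

definition contract_wtree :: "'v wtree \<Rightarrow> 'v \<Rightarrow> 'v \<Rightarrow> ('v set \<Rightarrow> real) \<Rightarrow> 'v wtree" where
  "contract_wtree T a v \<omega> = \<lparr>shape = contract (shape T) a v,
     weight = (\<lambda>f. \<omega> (the_inv_into (edges (shape T) - {{a, v}}) (\<lambda>e. merge a v ` e) f))\<rparr>"

lemma contract_wtree_shape [simp]: "shape (contract_wtree T a v \<omega>) = contract (shape T) a v"
  by (simp add: contract_wtree_def)

lemma contract_wtree_weight:
  assumes "tree (shape T)" "{a, v} \<in> edges (shape T)" "e \<in> edges (shape T)" "e \<noteq> {a, v}"
  shows "weight (contract_wtree T a v \<omega>) (merge a v ` e) = \<omega> e"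
  using the_inv_into_f_f[OF merge_edge_inj[OF assms(1,2)], of e] assms(3,4)
  by (simp add: contract_wtree_def)

text \<open>All other cuts survive the contraction, so the value in the new tree is computed on the
  old edges and their old sides.\<close>

lemma D_of_contract:
  assumes t: "tree (shape T)" and av: "{a, v} \<in> edges (shape T)"
    and I: "I \<subseteq> verts (shape T) - {v}" "I \<noteq> {}"
    and T': "shape T' = contract (shape T) a v"
    and w: "\<And>e. e \<in> edges (shape T) \<Longrightarrow> e \<noteq> {a, v} \<Longrightarrow> weight T' (merge a v ` e) = \<omega> e"
  shows "D_of T' I = (\<Sum>e | e \<in> edges (shape T) - {{a, v}} \<and> crosses I (side (shape T) e). \<omega> e)"
proof -
  let ?E = "edges (shape T) - {{a, v}}"
  have "D_of T' I = (\<Sum>e\<in>(\<lambda>e. merge a v ` e) ` ?E. weight T' e * of_bool (crosses I (side (shape T') e)))"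
    using D_of_eq_sum_of_bool[of T' I] contract_tree[OF t av] I by (simp add: T')
  also have "\<dots> = (\<Sum>e\<in>?E. weight T' (merge a v ` e) * of_bool (crosses I (side (shape T') (merge a v ` e))))"
    using sum.reindex[OF merge_edge_inj[OF t av]] by simp
  also have "\<dots> = (\<Sum>e\<in>?E. \<omega> e * of_bool (crosses I (side (shape T) e)))"
    using contract_side_crosses[OF t av _ _ I(1)] w by (intro sum.cong) (auto simp: T')
  also have "\<dots> = (\<Sum>e | e \<in> ?E \<and> crosses I (side (shape T) e). \<omega> e)"
    using tree_finite(2)[OF t] by (intro sum.mono_neutral_cong_right) auto
  finally show ?thesis .
qed

lemma edge_through_two:
  assumes "tree G" "e \<in> edges_at G a" "e \<in> edges_at G v" "a \<noteq> v"
  shows "e = {a, v}"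
proof -
  have "card e = 2" "finite e"
    using tree_simple[OF assms(1)] assms(2) unfolding simple_graph_def edges_at_def
    by (auto intro: card_ge_0_finite)
  moreover have "{a, v} \<subseteq> e"
    using assms by (simp add: edges_at_def)
  ultimately show ?thesis
    using assms(4) by (metis card_2_iff card_subset_eq)
qed

lemma contract_degree_other:
  assumes t: "tree G" and av: "{a, v} \<in> edges G" and x: "x \<noteq> a" "x \<noteq> v"
  shows "degree (contract G a v) x = degree G x"
proof -
  have *: "x \<in> merge a v ` e \<longleftrightarrow> x \<in> e" for e
    using x by (auto simp: merge_def image_iff)
  have "edges_at (contract G a v) x = (\<lambda>e. merge a v ` e) ` edges_at G x"
  proof
    show "edges_at (contract G a v) x \<subseteq> (\<lambda>e. merge a v ` e) ` edges_at G x"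
      using * unfolding edges_at_def contract_simps by blast
    have "e \<noteq> {a, v}" if "x \<in> e" for e
      using x that by blast
    then show "(\<lambda>e. merge a v ` e) ` edges_at G x \<subseteq> edges_at (contract G a v) x"
      using * unfolding edges_at_def contract_simps by blast
  qed
  moreover have "inj_on (\<lambda>e. merge a v ` e) (edges_at G x)"
    by (intro inj_on_subset[OF merge_edge_inj[OF t av]]) (use x in \<open>auto simp: edges_at_def\<close>)
  ultimately show ?thesis
    by (simp add: degree_eq card_image)
qed

text \<open>The edge \<open>{a, v}\<close> is counted at both of its ends and then disappears; the 2
  on the left avoids truncated subtraction.\<close>

lemma contract_degree_merged:
  assumes t: "tree G" and av: "{a, v} \<in> edges G"
  shows "degree (contract G a v) a + 2 = degree G a + degree G v"
proof -
  have ne: "a \<noteq> v"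
    using simple_adjD[OF tree_simple[OF t]] av by (auto simp: adj_def)
  let ?S = "edges_at G a \<union> edges_at G v - {{a, v}}"
  have *: "a \<in> merge a v ` e \<longleftrightarrow> a \<in> e \<or> v \<in> e" for e
    using ne by (auto simp: merge_def image_iff)
  have "edges_at (contract G a v) a = (\<lambda>e. merge a v ` e) ` ?S"
    using * unfolding edges_at_def contract_simps by blast
  moreover have "inj_on (\<lambda>e. merge a v ` e) ?S"
    by (intro inj_on_subset[OF merge_edge_inj[OF t av]]) (auto simp: edges_at_def)
  ultimately have d: "degree (contract G a v) a = card ?S"
    by (simp add: degree_eq card_image)
  have int: "edges_at G a \<inter> edges_at G v = {{a, v}}"
    using edge_through_two[OF t _ _ ne] av by (auto simp: edges_at_def)
  have fin: "finite (edges_at G a)" "finite (edges_at G v)"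
    using finite_edges_at[OF t] by auto
  have "{a, v} \<in> edges_at G a \<union> edges_at G v"
    using av by (simp add: edges_at_def)
  then have "card ?S + 1 = card (edges_at G a \<union> edges_at G v)"
    using fin by (metis Suc_eq_plus1 card.remove finite_Un)
  moreover have "card (edges_at G a) + card (edges_at G v) = card (edges_at G a \<union> edges_at G v) + 1"
    using card_Un_Int[OF fin] int by simp
  ultimately show ?thesis
    using d by (simp add: degree_eq)
qed

lemma contract_keeps_leaf:
  assumes "tree G" "{a, v} \<in> edges G" "x \<in> leaves G" "x \<noteq> a" "x \<noteq> v"
  shows "x \<in> leaves (contract G a v)"
  using contract_degree_other[OF assms(1,2,4,5)] assms by (simp add: leaves_def)

lemma contract_positive:
  assumes t: "tree (shape T)" and av: "{a, v} \<in> edges (shape T)"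
    and T': "shape T' = contract (shape T) a v"
    and w: "\<And>e. e \<in> edges (shape T) \<Longrightarrow> e \<noteq> {a, v} \<Longrightarrow> weight T' (merge a v ` e) = \<omega> e"
    and pos: "\<And>e. e \<in> edges (shape T) \<Longrightarrow> e \<noteq> {a, v} \<Longrightarrow> \<omega> e > 0"
  shows "positive_weighted_tree T'"
  using contract_tree[OF t av] w pos by (auto simp: positive_weighted_tree_def T')

section \<open>Suppression of vertices of degree 2\<close>

lemma suppress_stepE:
  assumes t: "tree (shape T)" and s: "suppress_step T T'"
  obtains v a b where "a \<noteq> b" "a \<noteq> v" "b \<noteq> v" "edges_at (shape T) v = {{a, v}, {v, b}}"
    "{a, v} \<in> edges (shape T)" "{v, b} \<in> edges (shape T)" "{v, b} \<noteq> {a, v}" "v \<in> verts (shape T)"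
    "shape T' = contract (shape T) a v"
    "\<And>e. e \<in> edges (shape T) \<Longrightarrow> e \<noteq> {a, v} \<Longrightarrow> weight T' (merge a v ` e) =
       (if e = {v, b} then weight T {a, v} + weight T {v, b} else weight T e)"
proof -
  obtain v a b where v: "v \<in> verts (shape T)" and ab: "a \<noteq> b"
    and at: "edges_at (shape T) v = {{a, v}, {v, b}}"
    and T': "T' = \<lparr>shape = \<lparr>verts = verts (shape T) - {v},
                    edges = (edges (shape T) - {{a, v}, {v, b}}) \<union> {{a, b}}\<rparr>,
           weight = (weight T)({a, b} := weight T {a, v} + weight T {v, b})\<rparr>"
    using s unfolding suppress_step_def edges_at_def by blast
  let ?G = "shape T"
  have "{a, v} \<in> edges_at ?G v" "{v, b} \<in> edges_at ?G v"
    using at by auto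
  then have E: "{a, v} \<in> edges ?G" "{v, b} \<in> edges ?G"
    by (auto simp: edges_at_def)
  have ne: "a \<noteq> v" "b \<noteq> v"
    using simple_adjD[OF tree_simple[OF t], of a v] simple_adjD[OF tree_simple[OF t], of v b] E
    by (auto simp: adj_def)
  have ne2: "{v, b} \<noteq> {a, v}"
    using ab ne by (auto simp: doubleton_eq_iff)
  have fix_edge: "merge a v ` e = e" if "e \<in> edges ?G" "e \<noteq> {a, v}" "e \<noteq> {v, b}" for e
  proof -
    have "e \<notin> edges_at ?G v"
      using at that by simp
    then have "v \<notin> e"
      using that by (simp add: edges_at_def)
    then show ?thesis
      by (auto simp: merge_def image_iff)
  qed
  have vb: "merge a v ` {v, b} = {a, b}"
    using ne by (auto simp: merge_def)
  have split: "edges ?G - {{a, v}} = insert {v, b} (edges ?G - {{a, v}, {v, b}})"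
    using E ne2 by blast
  have "(\<lambda>e. merge a v ` e) ` (edges ?G - {{a, v}, {v, b}}) = (\<lambda>e. e) ` (edges ?G - {{a, v}, {v, b}})"
    by (intro image_cong) (use fix_edge in auto)
  then have "edges (contract ?G a v) = insert {a, b} (edges ?G - {{a, v}, {v, b}})"
    unfolding contract_simps split using vb by (simp del: image_insert add: image_insert[of "\<lambda>e. merge a v ` e"])
  then have shape: "shape T' = contract ?G a v"
    unfolding T' by (intro graph.equality) auto
  have weight: "weight T' (merge a v ` e) =
       (if e = {v, b} then weight T {a, v} + weight T {v, b} else weight T e)"
    if e: "e \<in> edges ?G" "e \<noteq> {a, v}" for e
  proof (cases "e = {v, b}")
    case True
    then show ?thesis using vb by (simp add: T' del: image_insert)
  next
    case False
    have "merge a v ` e \<noteq> merge a v ` {v, b}"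
      using inj_on_eq_iff[OF merge_edge_inj[OF t E(1)], of e "{v, b}"] e E ne2 False by blast
    then show ?thesis
      using fix_edge[OF e False] vb False by (simp add: T' del: image_insert)
  qed
  show ?thesis
    by (rule that[OF ab ne at E ne2 v shape weight])
qed

text \<open>The two edges at \<open>v\<close> separate the same sets of leaves, so one edge with the
  sum of their weights changes no \<open>D_of\<close>. The merged vertex keeps the degree of
  \<open>a\<close> because \<open>v\<close> has degree 2.\<close>

lemma suppress_step_preserves:
  assumes T: "positive_weighted_tree T" and s: "suppress_step T T'"
  shows "positive_weighted_tree T'" "leaves (shape T') = leaves (shape T)" "D_tot T' = D_tot T"
    "\<And>I. I \<subseteq> leaves (shape T) \<Longrightarrow> I \<noteq> {} \<Longrightarrow> D_of T' I = D_of T I"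
    "card (verts (shape T')) < card (verts (shape T))"
proof -
  let ?G = "shape T"
  have t: "tree ?G"
    using T by (rule positive_weightD)
  obtain v a b where ne: "a \<noteq> b" "a \<noteq> v" "b \<noteq> v" and at: "edges_at ?G v = {{a, v}, {v, b}}"
    and E: "{a, v} \<in> edges ?G" "{v, b} \<in> edges ?G" "{v, b} \<noteq> {a, v}" and v: "v \<in> verts ?G"
    and T': "shape T' = contract ?G a v"
    and w: "\<And>e. e \<in> edges ?G \<Longrightarrow> e \<noteq> {a, v} \<Longrightarrow> weight T' (merge a v ` e) =
       (if e = {v, b} then weight T {a, v} + weight T {v, b} else weight T e)"
    using suppress_stepE[OF t s] by metis
  define \<omega> where "\<omega> e = (if e = {v, b} then weight T {a, v} + weight T {v, b} else weight T e)" for e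
  have w': "weight T' (merge a v ` e) = \<omega> e" if "e \<in> edges ?G" "e \<noteq> {a, v}" for e
    using w[OF that] by (simp add: \<omega>_def)
  show "positive_weighted_tree T'"
    by (rule contract_positive[OF t E(1) T' w'])
      (use positive_weightD(2)[OF T] E in \<open>auto simp: \<omega>_def intro: add_pos_pos\<close>)
  have dv: "degree ?G v = 2"
    using E(3) at by (simp add: degree_eq)
  have "degree (contract ?G a v) x = degree ?G x" if "x \<noteq> v" for x
    using contract_degree_other[OF t E(1)] contract_degree_merged[OF t E(1)] dv that
    by (cases "x = a") auto
  then show "leaves (shape T') = leaves ?G"
    using dv unfolding T' leaves_def by (auto; metis numeral_2_eq_2 n_not_Suc_n)
  show "card (verts (shape T')) < card (verts ?G)"
    using v tree_finite(1)[OF t] unfolding T' contract_simps by (metis card_Diff1_less)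
  have sum: "(\<Sum>e | e \<in> edges ?G - {{a, v}} \<and> P e. \<omega> e) = (\<Sum>e | e \<in> edges ?G \<and> P e. weight T e)"
    if "P {a, v} \<longleftrightarrow> P {v, b}" for P
  proof (cases "P {a, v}")
    case True
    let ?R = "{e \<in> edges ?G. e \<noteq> {a, v} \<and> e \<noteq> {v, b} \<and> P e}"
    have fin: "finite ?R"
      using tree_finite(2)[OF t] by simp
    have l: "{e. e \<in> edges ?G - {{a, v}} \<and> P e} = insert {v, b} ?R"
      and r: "{e. e \<in> edges ?G \<and> P e} = insert {a, v} (insert {v, b} ?R)"
      using E True that by blast+
    have "sum \<omega> ?R = sum (weight T) ?R"
      by (rule sum.cong) (auto simp: \<omega>_def)
    moreover have "\<omega> {v, b} = weight T {a, v} + weight T {v, b}"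
      by (simp add: \<omega>_def)
    ultimately show ?thesis
      unfolding l r using fin E(3) by (simp add: eq_commute)
  next
    case False
    then show ?thesis
      by (intro sum.cong) (use that in \<open>auto simp: \<omega>_def\<close>)
  qed
  have "D_tot T' = (\<Sum>e\<in>edges ?G - {{a, v}}. weight T' (merge a v ` e))"
    unfolding D_tot_def T' contract_simps using sum.reindex[OF merge_edge_inj[OF t E(1)]] by simp
  also have "\<dots> = (\<Sum>e\<in>edges ?G - {{a, v}}. \<omega> e)"
    by (intro sum.cong) (use w' in auto)
  also have "\<dots> = D_tot T"
    using sum[of "\<lambda>_. True"] unfolding D_tot_def by (simp only: simp_thms Collect_mem_eq)
  finally show "D_tot T' = D_tot T" .
  fix I assume I: "I \<subseteq> leaves ?G" "I \<noteq> {}"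
  have vI: "v \<notin> I"
    using I dv by (auto simp: leaves_def)
  have IV: "I \<subseteq> verts ?G - {v}"
    using I leaves_subset[of ?G] vI by blast
  have "D_of T' I = (\<Sum>e | e \<in> edges ?G - {{a, v}} \<and> crosses I (side ?G e). \<omega> e)"
    by (rule D_of_contract[OF t E(1) IV I(2) T' w'])
  also have "\<dots> = (\<Sum>e | e \<in> edges ?G \<and> crosses I (side ?G e). weight T e)"
  proof (rule sum)
    define C where "C = (if v \<in> side ?G {a, v} then - side ?G {a, v} else side ?G {a, v})"
    have C: "is_cut ?G {a, v} C" "v \<notin> C"
      using cut_side[OF t E(1)] by (simp_all add: C_def)
    have "a \<in> C" "b \<notin> C"
      using cut_other_side[OF C(1)] cut_same_side[OF C(1) E(2,3)] C(2) by auto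
    \<comment> \<open>\<open>C\<close> is the side of \<open>{a, v}\<close> that contains
      \<open>a\<close>. Moving \<open>v\<close> across turns it into a cut of \<open>{v, b}\<close>,
      and a set avoiding \<open>v\<close> does not notice the difference.\<close>
    have "crosses f (insert v C) \<longleftrightarrow> f = {v, b}" if f: "f \<in> edges ?G" for f
    proof (cases "v \<in> f")
      case True
      then have "f \<in> edges_at ?G v" using f by (simp add: edges_at_def)
      then have "f = {a, v} \<or> f = {v, b}" using at by simp
      then show ?thesis
        using \<open>a \<in> C\<close> \<open>b \<notin> C\<close> E(3) ne by auto
    next
      case False
      then have "crosses f (insert v C) \<longleftrightarrow> crosses f C"
        unfolding crosses_def by blast
      also have "\<dots> \<longleftrightarrow> f = {a, v}"
        using cut_crosses[OF C(1) f] .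
      finally show ?thesis
        using False by auto
    qed
    then have "is_cut ?G {v, b} (insert v C)"
      using E(2) unfolding is_cut_def by blast
    then have "crosses I (side ?G {v, b}) = crosses I (insert v C)"
      using cut_unique_crosses[OF t cut_side[OF t E(2)]] IV by blast
    also have "\<dots> = crosses I C"
      using vI unfolding crosses_def by blast
    also have "\<dots> = crosses I (side ?G {a, v})"
      by (simp add: C_def)
    finally show "crosses I (side ?G {a, v}) \<longleftrightarrow> crosses I (side ?G {v, b})" ..
  qed
  also have "\<dots> = D_of T I"
    by (rule D_of_eq_sum[OF t, symmetric]) (use IV I(2) in auto)
  finally show "D_of T' I = D_of T I" .
qed

lemma suppress_steps_preserve:
  assumes "suppress_step\<^sup>*\<^sup>* T Q" "positive_weighted_tree T"
  shows "positive_weighted_tree Q \<and> leaves (shape Q) = leaves (shape T) \<and> D_tot Q = D_tot T \<and>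
    (\<forall>I\<subseteq>leaves (shape T). I \<noteq> {} \<longrightarrow> D_of Q I = D_of T I)"
  using assms
proof (induction rule: rtranclp_induct)
  case (step Q R)
  then have Q: "positive_weighted_tree Q"
    by blast
  show ?case
    using step suppress_step_preserves(1-4)[OF Q step(2)] by auto
qed auto

lemma exists_suppress_step:
  assumes t: "tree (shape T)" and "\<not> essential (shape T)"
  shows "\<exists>T'. suppress_step T T'"
proof -
  let ?G = "shape T"
  obtain v where v: "v \<in> verts ?G" "card (edges_at ?G v) = 2"
    using assms(2) by (auto simp: essential_def degree_eq)
  then obtain e f where ef: "edges_at ?G v = {e, f}" "e \<noteq> f"
    by (auto simp: card_2_iff)
  have "e \<in> edges_at ?G v" "f \<in> edges_at ?G v"
    using ef by auto
  then obtain a b where ab: "e = {v, a}" "f = {v, b}"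
    using edges_atE[OF tree_simple[OF t]] by metis
  have "a \<noteq> b" "{e \<in> edges ?G. v \<in> e} = {{a, v}, {v, b}}"
    using ef ab by (auto simp: edges_at_def insert_commute)
  then show ?thesis
    using v(1) unfolding suppress_step_def by blast
qed

lemma essential_form_exists:
  assumes "positive_weighted_tree T"
  shows "\<exists>Q. suppress_step\<^sup>*\<^sup>* T Q \<and> essential (shape Q)"
  using assms
proof (induction "card (verts (shape T))" arbitrary: T rule: less_induct)
  case less
  show ?case
  proof (cases "essential (shape T)")
    case True
    then show ?thesis by blast
  next
    case False
    then obtain T' where T': "suppress_step T T'"
      using exists_suppress_step positive_weightD(1)[OF less.prems] by blast
    then obtain Q where "suppress_step\<^sup>*\<^sup>* T' Q" "essential (shape Q)"
      using less.hyps suppress_step_preserves(1,5)[OF less.prems T'] by blast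
    then show ?thesis
      using T' by (meson converse_rtranclp_into_rtranclp)
  qed
qed

section \<open>Existence of an essential pseudostar\<close>

definition leaf_edge :: "'v graph \<Rightarrow> 'v \<Rightarrow> 'v set" where
  "leaf_edge G x = (THE e. e \<in> edges_at G x)"

lemma leaf_edge:
  assumes t: "tree G" and x: "x \<in> leaves G"
  shows "edges_at G x = {leaf_edge G x}" "leaf_edge G x \<in> edges G" "x \<in> leaf_edge G x"
    "is_cut G (leaf_edge G x) {x}"
proof -
  obtain y where y: "edges_at G x = {{x, y}}" "is_cut G {x, y} {x}"
    using leaf_edge_cut[OF t x] by metis
  then have eq: "leaf_edge G x = {x, y}"
    by (simp add: leaf_edge_def)
  show "edges_at G x = {leaf_edge G x}" "leaf_edge G x \<in> edges G" "x \<in> leaf_edge G x"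
    "is_cut G (leaf_edge G x) {x}"
    unfolding eq using y cut_edge[OF y(2)] by simp_all
qed

lemma crosses_singleton: "crosses I {x} \<longleftrightarrow> x \<in> I \<and> I \<noteq> {x}"
  unfolding crosses_def by auto

text \<open>If \<open>x\<close> and \<open>y\<close> shared their edge, \<open>{x}\<close> and
  \<open>{y}\<close> would both be cuts of it, hence complementary on the vertices, which leaves no
  room for a third leaf.\<close>

lemma leaf_edge_inj:
  assumes t: "tree G" and X: "3 \<le> card (leaves G)"
  shows "inj_on (leaf_edge G) (leaves G)"
proof (rule inj_onI, rule ccontr)
  fix x y assume x: "x \<in> leaves G" and y: "y \<in> leaves G" and eq: "leaf_edge G x = leaf_edge G y"
    and ne: "x \<noteq> y"
  have "\<not> leaves G \<subseteq> {x, y}"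
    using X ne card_mono[of "{x, y}" "leaves G"] by auto
  then obtain z where z: "z \<in> leaves G" "z \<noteq> x" "z \<noteq> y"
    by blast
  have "is_cut G (leaf_edge G x) {x}" "is_cut G (leaf_edge G x) {y}"
    using leaf_edge(4)[OF t x] leaf_edge(4)[OF t y] eq by simp_all
  then have "((x \<in> {x}) = (x \<in> {y})) = ((z \<in> {x}) = (z \<in> {y}))"
    by (rule cut_unique[OF t]) (use x z leaves_subset[of G] in auto)
  then show False
    using z ne by simp
qed

lemma leaf_edge_iff:
  assumes t: "tree G" and e: "e \<in> edges G" and x: "x \<in> leaves G"
  shows "x \<in> e \<longleftrightarrow> e = leaf_edge G x"
proof -
  have "e \<in> edges_at G x \<longleftrightarrow> e = leaf_edge G x"
    using leaf_edge(1)[OF t x] by simp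
  then show ?thesis
    using e by (simp add: edges_at_def)
qed

lemma leaf_neighbour:
  assumes t: "tree G" and X: "3 \<le> card (leaves G)" and x: "x \<in> leaves G"
  obtains y where "leaf_edge G x = {x, y}" "y \<noteq> x" "{x, y} \<in> edges G" "y \<in> verts G" "y \<notin> leaves G"
proof -
  have "leaf_edge G x \<in> edges_at G x"
    using leaf_edge(1)[OF t x] by simp
  then obtain y where y: "leaf_edge G x = {x, y}" "y \<noteq> x" "{x, y} \<in> edges G" "y \<in> verts G"
    by (rule edges_atE[OF tree_simple[OF t]])
  have "y \<notin> leaves G"
  proof
    assume "y \<in> leaves G"
    then have "leaf_edge G x = leaf_edge G y"
      using leaf_edge_iff[OF t y(3)] y(1) by auto
    then show False
      using inj_onD[OF leaf_edge_inj[OF t X]] \<open>y \<in> leaves G\<close> x y(2) by metis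
  qed
  with y show ?thesis
    by (rule that)
qed

lemma leaf_edge_crosses:
  assumes t: "tree G" and x: "x \<in> leaves G" and I: "I \<subseteq> leaves G" "2 \<le> card I"
  shows "crosses I (side G (leaf_edge G x)) \<longleftrightarrow> x \<in> I"
proof -
  have "crosses I (side G (leaf_edge G x)) \<longleftrightarrow> crosses I {x}"
    using cut_unique_crosses[OF t cut_side[OF t leaf_edge(2)[OF t x]] leaf_edge(4)[OF t x]]
      I leaves_subset[of G] by blast
  then show ?thesis
    using I by (auto simp: crosses_singleton)
qed

lemma sum_leaf_edges:
  fixes c :: "'v set \<Rightarrow> real"
  assumes t: "tree G" and X: "3 \<le> card (leaves G)" and I: "I \<subseteq> leaves G" "2 \<le> card I"
  shows "(\<Sum>e | e \<in> edges G \<and> e \<inter> leaves G \<noteq> {} \<and> crosses I (side G e). c e) = (\<Sum>x\<in>I. c (leaf_edge G x))"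
proof -
  have "{e. e \<in> edges G \<and> e \<inter> leaves G \<noteq> {} \<and> crosses I (side G e)} = leaf_edge G ` I" (is "?L = ?R")
  proof
    show "?L \<subseteq> ?R"
    proof
      fix e assume "e \<in> ?L"
      then obtain x where x: "e \<in> edges G" "x \<in> e" "x \<in> leaves G" "crosses I (side G e)"
        by blast
      then have "e = leaf_edge G x"
        using leaf_edge_iff[OF t] by blast
      then show "e \<in> ?R"
        using x leaf_edge_crosses[OF t x(3) I] by blast
    qed
    show "?R \<subseteq> ?L"
    proof
      fix e assume "e \<in> ?R"
      then obtain x where x: "x \<in> I" "e = leaf_edge G x" "x \<in> leaves G"
        using I by blast
      then show "e \<in> ?L"
        using leaf_edge(2,3)[OF t x(3)] leaf_edge_crosses[OF t x(3) I] by blast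
    qed
  qed
  then show ?thesis
    using sum.reindex[OF inj_on_subset[OF leaf_edge_inj[OF t X] I(1)], of c] by simp
qed

lemma pseudostar_iff:
  assumes t: "tree G"
  shows "pseudostar n k G \<longleftrightarrow> card (leaves G) = n \<and>
    (\<forall>e\<in>edges G. k \<le> card (side G e \<inter> leaves G) \<or> k \<le> card (leaves G - side G e))"
proof -
  have iff: "k \<le> card (leaf_side G {u, v} u) \<or> k \<le> card (leaf_side G {u, v} v) \<longleftrightarrow>
    k \<le> card (side G {u, v} \<inter> leaves G) \<or> k \<le> card (leaves G - side G {u, v})"
    if e: "{u, v} \<in> edges G" for u v
  proof -
    let ?A = "side G {u, v}"
    have A: "is_cut G {u, v} ?A" and A': "is_cut G {u, v} (- ?A)"
      using cut_side[OF t e] by simp_all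
    have c: "- ?A \<inter> leaves G = leaves G - ?A"
      by blast
    show ?thesis
    proof (cases "u \<in> ?A")
      case True
      then have "leaf_side G {u, v} u = ?A \<inter> leaves G" "leaf_side G {u, v} v = leaves G - ?A"
        using leaf_side_eq[OF t A, of u] leaf_side_eq[OF t A', of v] cut_other_side[OF A] c by auto
      then show ?thesis by simp
    next
      case False
      then have "leaf_side G {u, v} v = ?A \<inter> leaves G" "leaf_side G {u, v} u = leaves G - ?A"
        using leaf_side_eq[OF t A, of v] leaf_side_eq[OF t A', of u] cut_other_side[OF A] c by auto
      then show ?thesis by auto
    qed
  qed
  have "(\<forall>u v. {u, v} \<in> edges G \<longrightarrow> k \<le> card (leaf_side G {u, v} u) \<or> k \<le> card (leaf_side G {u, v} v)) \<longleftrightarrow>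
    (\<forall>e\<in>edges G. k \<le> card (side G e \<inter> leaves G) \<or> k \<le> card (leaves G - side G e))"
    using iff simple_edgeE[OF tree_simple[OF t]] by metis
  then show ?thesis
    using t by (simp add: pseudostar_def)
qed

text \<open>\<open>v\<close> is contracted into its neighbour. The neighbour may become a new leaf,
  so only an inclusion of \<open>X\<close> in the leaves is asserted; such new leaves can be removed
  in turn.\<close>

lemma delete_extra_leaf:
  assumes T: "positive_weighted_tree T" and X: "X \<subseteq> leaves (shape T)" "3 \<le> card X"
    and v: "v \<in> leaves (shape T)" "v \<notin> X"
  obtains T' where "positive_weighted_tree T'" "X \<subseteq> leaves (shape T')"
    "card (verts (shape T')) < card (verts (shape T))"
    "\<And>I. I \<subseteq> X \<Longrightarrow> I \<noteq> {} \<Longrightarrow> D_of T' I = D_of T I"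
proof -
  let ?G = "shape T"
  have t: "tree ?G"
    using T by (rule positive_weightD)
  have card: "3 \<le> card (leaves ?G)"
    using X card_mono[OF finite_leaves[OF t] X(1)] by linarith
  obtain a where a: "leaf_edge ?G v = {v, a}" "a \<noteq> v" "{v, a} \<in> edges ?G" "a \<in> verts ?G" "a \<notin> leaves ?G"
    by (rule leaf_neighbour[OF t card v(1)])
  have av: "{a, v} \<in> edges ?G" "{a, v} = leaf_edge ?G v"
    using a by (simp_all add: insert_commute)
  define T' where "T' = contract_wtree T a v (weight T)"
  have w: "weight T' (merge a v ` e) = weight T e" if "e \<in> edges ?G" "e \<noteq> {a, v}" for e
    using contract_wtree_weight[OF t av(1) that] by (simp add: T'_def)
  have shape: "shape T' = contract ?G a v"
    by (simp add: T'_def)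
  show ?thesis
  proof (rule that)
    show "positive_weighted_tree T'"
      by (rule contract_positive[OF t av(1) shape w]) (use positive_weightD(2)[OF T] in auto)
    show "X \<subseteq> leaves (shape T')"
      unfolding shape using contract_keeps_leaf[OF t av(1)] X(1) v a(5) by blast
    show "card (verts (shape T')) < card (verts ?G)"
      unfolding shape contract_simps
      using v leaves_subset[of ?G] tree_finite(1)[OF t] by (intro card_Diff1_less) auto
    fix I assume I: "I \<subseteq> X" "I \<noteq> {}"
    have IV: "I \<subseteq> verts ?G - {v}"
      using I X v leaves_subset[of ?G] by blast
    have "crosses I (side ?G {a, v}) \<longleftrightarrow> crosses I {v}"
      unfolding av(2)
      using cut_unique_crosses[OF t cut_side[OF t leaf_edge(2)[OF t v(1)]] leaf_edge(4)[OF t v(1)]] IV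
      by blast
    then have "\<not> crosses I (side ?G {a, v})"
      using IV by (auto simp: crosses_singleton)
    then have "{e. e \<in> edges ?G - {{a, v}} \<and> crosses I (side ?G e)} = {e. e \<in> edges ?G \<and> crosses I (side ?G e)}"
      by blast
    then show "D_of T' I = D_of T I"
      using D_of_contract[OF t av(1) IV I(2) shape w] D_of_eq_sum[OF t subset_trans[OF IV Diff_subset] I(2)] by simp
  qed
qed

definition bad_edges :: "nat \<Rightarrow> 'v graph \<Rightarrow> 'v set set" where
  "bad_edges k G = {e \<in> edges G. card (side G e \<inter> leaves G) < k \<and> card (leaves G - side G e) < k}"

lemma pseudostar_iff_no_bad_edges:
  "tree G \<Longrightarrow> pseudostar n k G \<longleftrightarrow> card (leaves G) = n \<and> bad_edges k G = {}"
  by (auto simp: pseudostar_iff bad_edges_def not_le[symmetric])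

text \<open>One side of a leaf edge has all leaves but one, which is at least \<open>k\<close> of
  them.\<close>

lemma bad_edge_disjoint_leaves:
  assumes t: "tree G" and k: "k < card (leaves G)" and e: "e \<in> bad_edges k G"
  shows "e \<inter> leaves G = {}"
proof (rule ccontr)
  have e': "e \<in> edges G" "card (side G e \<inter> leaves G) < k" "card (leaves G - side G e) < k"
    using e by (auto simp: bad_edges_def)
  assume "e \<inter> leaves G \<noteq> {}"
  then obtain x where x: "x \<in> leaves G" "x \<in> e"
    by blast
  then have "is_cut G e {x}"
    using leaf_edge_iff[OF t e'(1)] leaf_edge(4)[OF t] by auto
  then have "verts G \<inter> side G e = verts G \<inter> {x} \<or> verts G \<inter> side G e = verts G - {x}"
    using cut_eq_or_Compl[OF t cut_side[OF t e'(1)]] by blast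
  then have "leaves G - side G e = leaves G - {x} \<or> side G e \<inter> leaves G = leaves G - {x}"
    using leaves_subset[of G] by blast
  then have "card (leaves G - {x}) < k"
    using e'(2,3) by metis
  then show False
    using x(1) finite_leaves[OF t] k by simp
qed

lemma bad_edge_crosses:
  assumes t: "tree G" and I: "I \<subseteq> leaves G" "k \<le> card I" and e: "e \<in> bad_edges k G"
  shows "crosses I (side G e)"
proof (rule ccontr)
  have e': "card (side G e \<inter> leaves G) < k" "card (leaves G - side G e) < k"
    using e by (auto simp: bad_edges_def)
  assume "\<not> crosses I (side G e)"
  then have "I \<subseteq> side G e \<inter> leaves G \<or> I \<subseteq> leaves G - side G e"
    using I by (auto simp: crosses_def)
  then have "card I < k"
    using e' finite_leaves[OF t] by (meson card_mono finite_Diff finite_Int le_less_trans)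
  then show False
    using I by simp
qed

text \<open>An edge both of whose sides have fewer than \<open>k\<close> leaves contributes its weight to every
  \<open>D_I\<close>; after contraction that weight is spread evenly over the leaf edges.\<close>

lemma contract_bad_edge:
  assumes T: "positive_weighted_tree T" and X: "leaves (shape T) = X" and k: "3 \<le> k" "k < card X"
    and bad: "e0 \<in> bad_edges k (shape T)"
  obtains T' where "positive_weighted_tree T'" "X \<subseteq> leaves (shape T')"
    "card (verts (shape T')) < card (verts (shape T))"
    "\<And>I. I \<subseteq> X \<Longrightarrow> card I = k \<Longrightarrow> D_of T' I = D_of T I"
proof -
  let ?G = "shape T"
  have t: "tree ?G"
    using T by (rule positive_weightD)
  have finX: "finite X"
    using finite_leaves[OF t] X by simp
  have card: "3 \<le> card (leaves ?G)"
    using X k by simp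
  have e0: "e0 \<in> edges ?G"
    using bad by (simp add: bad_edges_def)
  obtain a v where av: "e0 = {a, v}" "a \<noteq> v" "a \<in> verts ?G" "v \<in> verts ?G"
    using simple_edgeE[OF tree_simple[OF t] e0] by metis
  have disj: "e0 \<inter> X = {}"
    using bad_edge_disjoint_leaves[OF t _ bad] X k by simp
  have avE: "{a, v} \<in> edges ?G"
    using e0 av by simp
  have avX: "a \<notin> X" "v \<notin> X"
    using disj av by auto
  \<comment> \<open>Among the leaf edges exactly those of the \<open>k\<close> elements of
    \<open>I\<close> separate \<open>I\<close>, so a surplus of \<open>\<delta>\<close> on each leaf
    edge restores the lost weight in \<open>D_I\<close>.\<close>
  define \<delta> where "\<delta> = weight T e0 / k"
  have \<delta>: "\<delta> > 0"
    using positive_weightD(2)[OF T e0] k by (simp add: \<delta>_def)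
  define \<omega> where "\<omega> e = weight T e + \<delta> * of_bool (e \<inter> X \<noteq> {})" for e
  define T' where "T' = contract_wtree T a v \<omega>"
  have w: "weight T' (merge a v ` e) = \<omega> e" if "e \<in> edges ?G" "e \<noteq> {a, v}" for e
    using contract_wtree_weight[OF t avE that] by (simp add: T'_def)
  have shape: "shape T' = contract ?G a v"
    by (simp add: T'_def)
  show ?thesis
  proof (rule that)
    show "positive_weighted_tree T'"
      by (rule contract_positive[OF t avE shape w])
        (use positive_weightD(2)[OF T] \<delta> in \<open>auto simp: \<omega>_def intro: add_pos_nonneg\<close>)
    show "X \<subseteq> leaves (shape T')"
      unfolding shape using contract_keeps_leaf[OF t avE] X avX by blast
    show "card (verts (shape T')) < card (verts ?G)"
      unfolding shape contract_simps using av(4) tree_finite(1)[OF t] by (intro card_Diff1_less) auto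
    fix I assume I: "I \<subseteq> X" "card I = k"
    have I0: "I \<noteq> {}" "finite I" "2 \<le> card I"
      using I k finite_subset[OF _ finX] by auto
    have IV: "I \<subseteq> verts ?G - {v}" "I \<subseteq> verts ?G"
      using I X avX leaves_subset[of ?G] by blast+
    let ?E = "{e. e \<in> edges ?G - {{a, v}} \<and> crosses I (side ?G e)}"
    have finE: "finite ?E"
      using tree_finite(2)[OF t] by simp
    have c0: "crosses I (side ?G e0)"
      using bad_edge_crosses[OF t _ _ bad] I X by simp
    have "(\<Sum>e\<in>?E. \<delta> * of_bool (e \<inter> X \<noteq> {})) = (\<Sum>e | e \<in> edges ?G \<and> e \<inter> leaves ?G \<noteq> {} \<and> crosses I (side ?G e). \<delta>)"
      by (rule sum.mono_neutral_cong_right) (use finE X av disj in auto)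
    also have "\<dots> = weight T e0"
      using sum_leaf_edges[OF t card, of I "\<lambda>_. \<delta>"] I I0 X k by (simp add: \<delta>_def)
    finally have \<delta>_sum: "(\<Sum>e\<in>?E. \<delta> * of_bool (e \<inter> X \<noteq> {})) = weight T e0" .
    have ins: "{e. e \<in> edges ?G \<and> crosses I (side ?G e)} = insert e0 ?E"
      using e0 av c0 by blast
    have "D_of T' I = (\<Sum>e\<in>?E. \<omega> e)"
      by (rule D_of_contract[OF t avE IV(1) I0(1) shape w])
    also have "\<dots> = (\<Sum>e\<in>?E. weight T e) + weight T e0"
      unfolding \<omega>_def sum.distrib \<delta>_sum ..
    also have "\<dots> = D_of T I"
      unfolding D_of_eq_sum[OF t IV(2) I0(1)] ins using finE av by simp
    finally show "D_of T' I = D_of T I" .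
  qed
qed

text \<open>While the tree is not of the desired form, one of three reductions applies: removing a
  leaf outside \<open>X\<close>, suppression, contracting a bad edge. Each keeps the values on
  \<open>k\<close>-subsets of \<open>X\<close> and lowers the number of vertices.\<close>

lemma exists_essential_pseudostar:
  assumes "positive_weighted_tree T" "X \<subseteq> leaves (shape T)" "3 \<le> k" "k < card X"
  shows "\<exists>P. positive_weighted_tree P \<and> leaves (shape P) = X \<and> essential (shape P) \<and>
    pseudostar (card X) k (shape P) \<and> (\<forall>I\<subseteq>X. card I = k \<longrightarrow> D_of P I = D_of T I)"
  using assms(1,2)
proof (induction "card (verts (shape T))" arbitrary: T rule: less_induct)
  case less
  note T = less.prems
  have t: "tree (shape T)"
    using T(1) by (rule positive_weightD)
  have step: ?case if T': "positive_weighted_tree T'" "X \<subseteq> leaves (shape T')"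
    "card (verts (shape T')) < card (verts (shape T))"
    "\<And>I. I \<subseteq> X \<Longrightarrow> card I = k \<Longrightarrow> D_of T' I = D_of T I" for T'
    using less.hyps[OF T'(3,1,2)] T'(4) by auto
  have ne: "I \<noteq> {}" if "card I = k" for I :: "'a set"
    using that assms(3) by auto
  have X3: "3 \<le> card X"
    using assms(3,4) by linarith
  consider v where "v \<in> leaves (shape T)" "v \<notin> X" | "leaves (shape T) = X" "\<not> essential (shape T)"
    | "leaves (shape T) = X" "\<not> pseudostar (card X) k (shape T)"
    | "leaves (shape T) = X" "essential (shape T)" "pseudostar (card X) k (shape T)"
    using T(2) by blast
  then show ?case
  proof cases
    case 1
    then show ?thesis
      using delete_extra_leaf[OF T(1,2) X3 1] step ne by metis
  next
    case 2
    then obtain T' where T': "suppress_step T T'"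
      using exists_suppress_step[OF t] by blast
    show ?thesis
      by (rule step[of T']) (use suppress_step_preserves[OF T(1) T'] 2 ne in auto)
  next
    case 3
    then obtain e where e: "e \<in> bad_edges k (shape T)"
      using pseudostar_iff_no_bad_edges[OF t, of "card X" k] by auto
    show ?thesis
      using contract_bad_edge[OF T(1) 3(1) assms(3,4) e] step by metis
  next
    case 4
    then show ?thesis
      using T by blast
  qed
qed

section \<open>Renaming of vertices\<close>

definition rename :: "('v \<Rightarrow> 'u) \<Rightarrow> 'v wtree \<Rightarrow> 'u wtree" where
  "rename \<psi> T = \<lparr>shape = \<lparr>verts = \<psi> ` verts (shape T), edges = (\<lambda>e. \<psi> ` e) ` edges (shape T)\<rparr>,
     weight = (\<lambda>f. weight T (\<psi> -` f))\<rparr>"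

lemma rename_simps [simp]:
  "verts (shape (rename \<psi> T)) = \<psi> ` verts (shape T)"
  "edges (shape (rename \<psi> T)) = (\<lambda>e. \<psi> ` e) ` edges (shape T)"
  "weight (rename \<psi> T) f = weight T (\<psi> -` f)"
  by (simp_all add: rename_def)

lemma rename_cut:
  assumes "inj \<psi>" "is_cut (shape T) e A"
  shows "is_cut (shape (rename \<psi> T)) (\<psi> ` e) (\<psi> ` A)"
proof -
  have c: "crosses (\<psi> ` f) (\<psi> ` A) \<longleftrightarrow> crosses f A" for f
    using assms(1) unfolding crosses_def
    by (simp add: inj_image_subset_iff image_Int[symmetric])
  have eq: "\<psi> ` f = \<psi> ` e \<longleftrightarrow> f = e" for f
    using assms(1) by (simp add: inj_image_eq_iff)
  show ?thesis
    using assms(2) unfolding is_cut_def by (auto simp: c eq)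
qed

lemma rename_tree:
  assumes inj: "inj \<psi>" and t: "tree (shape T)"
  shows "tree (shape (rename \<psi> T))"
proof -
  have "simple_graph (shape (rename \<psi> T))"
    using tree_simple[OF t] inj
    by (auto simp: simple_graph_def card_image inj_on_subset)
  moreover have "connected_graph (shape (rename \<psi> T))"
    unfolding connected_graph_def
  proof (intro ballI)
    fix x y assume "x \<in> verts (shape (rename \<psi> T))" "y \<in> verts (shape (rename \<psi> T))"
    then obtain p q where pq: "x = \<psi> p" "y = \<psi> q" "p \<in> verts (shape T)" "q \<in> verts (shape T)"
      by auto
    then have "(adj (shape T))\<^sup>*\<^sup>* p q"
      using tree_connected[OF t] by (simp add: connected_graph_def)
    then have "(adj (shape (rename \<psi> T)))\<^sup>*\<^sup>* (\<psi> p) (\<psi> q)"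
    proof (induction rule: rtranclp_induct)
      case (step r s)
      then have "\<psi> ` {r, s} \<in> edges (shape (rename \<psi> T))"
        unfolding adj_def rename_simps by blast
      then have "adj (shape (rename \<psi> T)) (\<psi> r) (\<psi> s)"
        by (simp add: adj_def)
      then show ?case
        using step(3) by (rule rtranclp.rtrancl_into_rtrancl[rotated])
    qed simp
    then show "(adj (shape (rename \<psi> T)))\<^sup>*\<^sup>* x y"
      using pq by simp
  qed
  moreover have "\<exists>A. is_cut (shape (rename \<psi> T)) e A" if e: "e \<in> edges (shape (rename \<psi> T))" for e
  proof -
    obtain f where "f \<in> edges (shape T)" "e = \<psi> ` f"
      using e by auto
    then show ?thesis
      using rename_cut[OF inj cut_side[OF t]] by blast
  qed
  ultimately show ?thesis
    using t unfolding tree_iff_cuts by simp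
qed

lemma rename_degree:
  assumes inj: "inj \<psi>"
  shows "degree (shape (rename \<psi> T)) (\<psi> x) = degree (shape T) x"
proof -
  have "edges_at (shape (rename \<psi> T)) (\<psi> x) = (\<lambda>e. \<psi> ` e) ` edges_at (shape T) x"
    using inj_image_mem_iff[OF inj, of x] unfolding edges_at_def rename_simps by blast
  then show ?thesis
    using card_image[of "\<lambda>e. \<psi> ` e" "edges_at (shape T) x"] inj
    by (simp add: degree_eq inj_on_def inj_image_eq_iff)
qed

lemma rename_D_of:
  assumes inj: "inj \<psi>" and t: "tree (shape T)" and I: "I \<subseteq> verts (shape T)" "I \<noteq> {}"
  shows "D_of (rename \<psi> T) (\<psi> ` I) = D_of T I"
proof -
  let ?T = "rename \<psi> T"
  have tr: "tree (shape ?T)"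
    using rename_tree[OF inj t] .
  have cr: "crosses (\<psi> ` I) (side (shape ?T) (\<psi> ` e)) = crosses I (side (shape T) e)"
    if e: "e \<in> edges (shape T)" for e
  proof -
    have "is_cut (shape ?T) (\<psi> ` e) (side (shape ?T) (\<psi> ` e))"
      by (rule cut_side[OF tr]) (use e in auto)
    then have "crosses (\<psi> ` I) (side (shape ?T) (\<psi> ` e)) = crosses (\<psi> ` I) (\<psi> ` side (shape T) e)"
      using rename_cut[OF inj cut_side[OF t e]]
      by (rule cut_unique_crosses[OF tr]) (use I in auto)
    then show ?thesis
      using inj unfolding crosses_def by (simp add: inj_image_subset_iff image_Int[symmetric])
  qed
  have inj': "inj_on (\<lambda>e. \<psi> ` e) (edges (shape T))"
    using inj by (simp add: inj_on_def inj_image_eq_iff)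
  have "D_of ?T (\<psi> ` I) = (\<Sum>e\<in>(\<lambda>e. \<psi> ` e) ` edges (shape T).
      weight ?T e * of_bool (crosses (\<psi> ` I) (side (shape ?T) e)))"
    using D_of_eq_sum_of_bool[OF tr, of "\<psi> ` I"] I by (simp add: image_mono)
  also have "\<dots> = (\<Sum>e\<in>edges (shape T).
      weight ?T (\<psi> ` e) * of_bool (crosses (\<psi> ` I) (side (shape ?T) (\<psi> ` e))))"
    using sum.reindex[OF inj'] by simp
  also have "\<dots> = (\<Sum>e\<in>edges (shape T). weight T e * of_bool (crosses I (side (shape T) e)))"
    by (intro sum.cong) (use cr inj in \<open>auto simp: inj_vimage_image_eq\<close>)
  also have "\<dots> = D_of T I"
    using D_of_eq_sum_of_bool[OF t I] by simp
  finally show ?thesis .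
qed

lemma pl_treelike_essential_pseudostar:
  assumes pl: "pl_treelike n k D" and k: "3 \<le> k" "k \<le> n - 1"
  shows "essential_pseudostars n k D \<noteq> {}"
proof -
  obtain T :: "nat wtree" and S \<phi> where T: "positive_weighted_tree T" and S: "S \<subseteq> leaves (shape T)"
    and \<phi>: "bij_betw \<phi> {1..n} S" and D: "\<And>I. I \<in> subsets_of_card n k \<Longrightarrow> D_of T (\<phi> ` I) = D I"
    using pl unfolding pl_treelike_def by blast
  have t: "tree (shape T)"
    using T by (rule positive_weightD)
  \<comment> \<open>The selected leaves receive their labels; all other vertices are moved above
    \<open>n\<close>, where they cannot clash with a label.\<close>
  define \<psi> where "\<psi> v = (if v \<in> S then the_inv_into {1..n} \<phi> v else v + n + 1)" for v
  have inv_in: "the_inv_into {1..n} \<phi> v \<in> {1..n}" if "v \<in> S" for v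
    using \<phi> that by (metis bij_betw_def order_refl the_inv_into_into)
  have inv_inj: "inj_on (the_inv_into {1..n} \<phi>) S"
    using \<phi> by (metis bij_betw_def inj_on_the_inv_into)
  have inj: "inj \<psi>"
  proof (rule injI)
    fix x y assume eq: "\<psi> x = \<psi> y"
    show "x = y"
      using eq inv_in[of x] inv_in[of y] inj_onD[OF inv_inj, of x y]
      by (auto simp: \<psi>_def split: if_splits)
  qed
  have \<psi>\<phi>: "\<psi> (\<phi> i) = i" if "i \<in> {1..n}" for i
    using \<phi> that by (auto simp: \<psi>_def bij_betw_def the_inv_into_f_f)
  let ?T = "rename \<psi> T"
  have pos: "positive_weighted_tree ?T"
    using rename_tree[OF inj t] positive_weightD(2)[OF T] inj
    by (auto simp: positive_weighted_tree_def inj_vimage_image_eq)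
  have sub: "{1..n} \<subseteq> leaves (shape ?T)"
  proof
    fix i assume i: "i \<in> {1..n}"
    then have "\<phi> i \<in> leaves (shape T)"
      using \<phi> S by (auto simp: bij_betw_def)
    then have "\<psi> (\<phi> i) \<in> leaves (shape ?T)"
      using rename_degree[OF inj, of T "\<phi> i"] by (simp add: leaves_def)
    then show "i \<in> leaves (shape ?T)"
      using \<psi>\<phi>[OF i] by simp
  qed
  have D': "D_of ?T I = D I" if I: "I \<in> subsets_of_card n k" for I
  proof -
    have I': "I \<subseteq> {1..n}" "I \<noteq> {}"
      using I k by (auto simp: subsets_of_card_def)
    have "\<psi> ` \<phi> ` I = I"
      using \<psi>\<phi> I'(1) by (force simp: image_iff)
    moreover have "\<phi> ` I \<subseteq> verts (shape T)"
      using \<phi> S I'(1) leaves_subset[of "shape T"] by (auto simp: bij_betw_def)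
    ultimately show ?thesis
      using rename_D_of[OF inj t, of "\<phi> ` I"] I' D[OF I] by simp
  qed
  have "k < card {1..n}"
    using k by simp
  then obtain P where P: "positive_weighted_tree P" "leaves (shape P) = {1..n}" "essential (shape P)"
    "pseudostar (card {1..n}) k (shape P)" "\<forall>I\<subseteq>{1..n}. card I = k \<longrightarrow> D_of P I = D_of ?T I"
    using exists_essential_pseudostar[OF pos sub k(1)] by blast
  have "P \<in> essential_pseudostars n k D"
    using P D' by (auto simp: essential_pseudostars_def realizing_trees_def subsets_of_card_def)
  then show ?thesis
    by blast
qed

section \<open>Isomorphism of trees with the same splits\<close>

text \<open>A vertex selects one side of each edge. Two vertices correspond if they select the same
  side of every split common to both trees; for essential trees with the same splits this relation
  is the isomorphism.\<close>

definition corresponding :: "'v graph \<Rightarrow> 'v graph \<Rightarrow> 'v \<Rightarrow> 'v \<Rightarrow> bool" where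
  "corresponding G G' u u' \<longleftrightarrow> (\<forall>e A e' A'. is_cut G e A \<longrightarrow> is_cut G' e' A' \<longrightarrow>
     A \<inter> leaves G = A' \<inter> leaves G' \<longrightarrow> (u \<in> A \<longleftrightarrow> u' \<in> A'))"

definition clusters :: "'v graph \<Rightarrow> 'v set set" where
  "clusters G = {A \<inter> leaves G | e A. is_cut G e A}"

lemma cluster_transfer:
  assumes "clusters G' \<subseteq> clusters G" "is_cut G' e' A'"
  obtains e A where "is_cut G e A" "A \<inter> leaves G = A' \<inter> leaves G'"
proof -
  have "A' \<inter> leaves G' \<in> clusters G'"
    using assms(2) unfolding clusters_def by blast
  then have "A' \<inter> leaves G' \<in> clusters G"
    using assms(1) by (rule rev_subsetD)
  then show ?thesis
    using that unfolding clusters_def by force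
qed

lemma corresponding_sym: "corresponding G G' u u' \<Longrightarrow> corresponding G' G u' u"
  unfolding corresponding_def by metis

text \<open>Two different vertices of \<open>G'\<close> are separated by an edge whose split also
  occurs in \<open>G\<close>, so they cannot both agree with \<open>u\<close> on it.\<close>

lemma corresponding_unique:
  assumes t': "tree G'" and cl: "clusters G' \<subseteq> clusters G"
    and c: "corresponding G G' u u'" "corresponding G G' u u''" and V: "u' \<in> verts G'" "u'' \<in> verts G'"
  shows "u' = u''"
proof (rule ccontr)
  assume "u' \<noteq> u''"
  then obtain w C where C: "is_cut G' {u', w} C" "u' \<notin> C" "u'' \<in> C"
    using edge_towards[OF t' V] by metis
  obtain e A where "is_cut G e A" "A \<inter> leaves G = C \<inter> leaves G'"
    using cluster_transfer[OF cl C(1)] .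
  then show False
    using c C unfolding corresponding_def by metis
qed

text \<open>Orient every edge of \<open>G'\<close> towards the side whose leaves lie on the side of \<open>u\<close> in \<open>G\<close>. Any
  two of these sides share a leaf, so walking along edges oriented away from the current vertex
  ends in a vertex that lies on all of them.\<close>

lemma corresponding_exists:
  assumes t: "tree G" and ess: "essential G" and t': "tree G'" and X: "leaves G' = leaves G"
    and cl: "clusters G' \<subseteq> clusters G" and u: "u \<in> verts G"
  shows "\<exists>u'\<in>verts G'. corresponding G G' u u'"
proof -
  let ?X = "leaves G"
  define Or where "Or A' \<longleftrightarrow> (\<exists>e A. is_cut G e A \<and> A \<inter> ?X = A' \<inter> ?X \<and> u \<in> A)" for A'
  have meet: "\<exists>x\<in>?X. x \<in> A' \<and> x \<in> B'" if o: "Or A'" "Or B'" for A' B'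
  proof -
    obtain e A where A: "is_cut G e A" "A \<inter> ?X = A' \<inter> ?X" "u \<in> A"
      using o(1) unfolding Or_def by (elim exE conjE)
    obtain f B where B: "is_cut G f B" "B \<inter> ?X = B' \<inter> ?X" "u \<in> B"
      using o(2) unfolding Or_def by (elim exE conjE)
    have "\<exists>x\<in>?X. x \<notin> - A \<and> x \<notin> - B"
      by (rule essential_leaf_outside[OF t ess u, of e _ f]) (use A B in auto)
    then show ?thesis
      using A(2) B(2) by blast
  qed
  have total: "Or A' \<or> Or (- A')" if A': "is_cut G' e' A'" for e' A'
  proof -
    obtain e A where A: "is_cut G e A" "A \<inter> ?X = A' \<inter> ?X"
      using cluster_transfer[OF cl A'] unfolding X .
    then have "is_cut G e (- A)" "- A \<inter> ?X = - A' \<inter> ?X"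
      by auto
    then show ?thesis
      using A unfolding Or_def by (cases "u \<in> A") blast+
  qed
  \<comment> \<open>The edges whose chosen side misses \<open>u'\<close>. Taking \<open>u'\<close>
    with as few of them as possible replaces an argument that the walk terminates.\<close>
  define bad where "bad u' = {e' \<in> edges G'. \<exists>A'. is_cut G' e' A' \<and> Or A' \<and> u' \<notin> A'}" for u'
  have fin: "finite (bad u')" for u'
    using tree_finite(2)[OF t'] by (simp add: bad_def)
  obtain v where "v \<in> verts G'"
    using t' by (auto simp: tree_def)
  then obtain u' where u': "u' \<in> verts G'" and min: "\<And>w. w \<in> verts G' \<Longrightarrow> card (bad u') \<le> card (bad w)"
    using arg_min_natI[of "\<lambda>w. w \<in> verts G'" v "\<lambda>w. card (bad w)"]
      arg_min_nat_le[of "\<lambda>w. w \<in> verts G'" _ "\<lambda>w. card (bad w)"] by metis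
  have "u' \<in> A'" if A': "is_cut G' e' A'" "Or A'" for e' A'
  proof (rule ccontr)
    assume nu: "u' \<notin> A'"
    obtain z where z: "z \<in> A'" "z \<in> verts G'"
      using cut_nonempty[OF t' A'(1)] by blast
    have "u' \<noteq> z"
      using nu z by blast
    then obtain w C where w: "{u', w} \<in> edges G'" and C: "is_cut G' {u', w} C" "u' \<notin> C" "w \<in> C" "z \<in> C"
      by (rule edge_towards[OF t' u' z(2)])
    have wV: "w \<in> verts G'"
      using simple_adjD[OF tree_simple[OF t'], of u' w] w by (simp add: adj_def)
    have XV: "?X \<subseteq> verts G'"
      using leaves_subset[of G'] X by simp
    have at: "{u', w} \<in> edges_at G' u'"
      using w by (simp add: edges_at_def)
    \<comment> \<open>\<open>A'\<close> misses \<open>u'\<close> and contains \<open>z\<close>, so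
      it lies in the branch \<open>C\<close> towards \<open>z\<close>. As chosen sides share a leaf,
      \<open>- C\<close> is not chosen; hence \<open>C\<close> is, and stepping to \<open>w\<close>
      mends the edge \<open>{u', w}\<close> and spoils no other.\<close>
    have A'C: "verts G' \<inter> A' \<subseteq> C"
    proof (cases "e' = {u', w}")
      case True
      then show ?thesis
        using cut_eq_or_Compl[OF t' A'(1), of C] C(1,2) nu u' by blast
    next
      case False
      then show ?thesis
        using cut_nested_at[OF t' at C(1,2) A'(1) nu] z C(4) by blast
    qed
    have OC: "Or C"
      using total[OF C(1)] meet[OF A'(2), of "- C"] A'C XV by blast
    have not_w: "{u', w} \<notin> bad w"
    proof
      assume "{u', w} \<in> bad w"
      then obtain B where B: "is_cut G' {u', w} B" "Or B" "w \<notin> B"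
        unfolding bad_def by blast
      have "B \<inter> verts G' = verts G' - C"
        using cut_eq_or_Compl[OF t' B(1) C(1)] B(3) C(3) wV by blast
      then show False
        using meet[OF B(2) OC] XV by blast
    qed
    have "bad w \<subseteq> bad u'"
    proof
      fix f assume f: "f \<in> bad w"
      then obtain B where B: "is_cut G' f B" "Or B" "w \<notin> B" "f \<in> edges G'"
        unfolding bad_def by blast
      have "{u', w} \<noteq> f"
        using f not_w by blast
      then have "u' \<notin> B"
        using cut_same_side[OF B(1) w] B(3) by blast
      then show "f \<in> bad u'"
        using B unfolding bad_def by blast
    qed
    moreover have "{u', w} \<in> bad u'"
      using w C OC unfolding bad_def by blast
    ultimately have "card (bad w) < card (bad u')"
      using not_w fin by (intro psubset_card_mono) auto
    then show False
      using min[OF wV] by simp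
  qed
  note u'_in = this
  have "u \<in> A \<longleftrightarrow> u' \<in> A'"
    if A: "is_cut G e A" and A': "is_cut G' e' A'" and eq: "A \<inter> ?X = A' \<inter> ?X" for e A e' A'
  proof (cases "u \<in> A")
    case True
    then have "Or A'"
      using A eq unfolding Or_def by blast
    then show ?thesis
      using u'_in[OF A'] True by simp
  next
    case False
    have "is_cut G e (- A)" "- A \<inter> ?X = - A' \<inter> ?X" "u \<in> - A"
      using A eq False by auto
    then have "Or (- A')"
      unfolding Or_def by blast
    moreover have "is_cut G' e' (- A')"
      using A' by simp
    ultimately show ?thesis
      using u'_in False by blast
  qed
  then show ?thesis
    using u' X unfolding corresponding_def by auto
qed

text \<open>The map sends each vertex to its corresponding one. The hypotheses name just one pair of
  matching cuts for each edge; complements supply the matching of the other sides.\<close>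

lemma same_weighted_clusters_iso:
  assumes t: "tree (shape T)" and ess: "essential (shape T)"
    and t': "tree (shape T')" and ess': "essential (shape T')"
    and X: "leaves (shape T) = leaves (shape T')"
    and fwd: "\<And>e. e \<in> edges (shape T) \<Longrightarrow> \<exists>e' A A'. is_cut (shape T) e A \<and> is_cut (shape T') e' A' \<and>
      A \<inter> leaves (shape T) = A' \<inter> leaves (shape T') \<and> weight T' e' = weight T e"
    and bwd: "\<And>e'. e' \<in> edges (shape T') \<Longrightarrow> \<exists>e A A'. is_cut (shape T) e A \<and> is_cut (shape T') e' A' \<and>
      A \<inter> leaves (shape T) = A' \<inter> leaves (shape T')"
  shows "wtree_iso T T'"
proof -
  let ?G = "shape T" and ?G' = "shape T'"
  have sub: "clusters G \<subseteq> clusters G'"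
    if tG: "tree G" and XG: "leaves G = leaves G'" and
      ex: "\<And>e. e \<in> edges G \<Longrightarrow> \<exists>e' A A'. is_cut G e A \<and> is_cut G' e' A' \<and> A \<inter> leaves G = A' \<inter> leaves G'"
    for G G' :: "'a graph"
  proof
    fix Y assume "Y \<in> clusters G"
    then obtain e B where B: "is_cut G e B" "Y = B \<inter> leaves G"
      unfolding clusters_def by blast
    obtain e' A A' where A: "is_cut G e A" "is_cut G' e' A'" "A \<inter> leaves G = A' \<inter> leaves G'"
      using ex[OF cut_edge[OF B(1)]] by blast
    have "B \<inter> leaves G = A \<inter> leaves G \<or> B \<inter> leaves G = - A \<inter> leaves G"
      using cut_eq_or_Compl[OF tG B(1) A(1)] leaves_subset[of G] by blast
    then have "Y = A' \<inter> leaves G' \<or> Y = - A' \<inter> leaves G'"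
      using A(3) B(2) XG by blast
    moreover have "is_cut G' e' (- A')"
      using A by simp
    ultimately show "Y \<in> clusters G'"
      using A(2) unfolding clusters_def by blast
  qed
  have cl: "clusters ?G \<subseteq> clusters ?G'"
    using sub[OF t X] fwd by blast
  have cl': "clusters ?G' \<subseteq> clusters ?G"
    using sub[OF t' X[symmetric]] bwd by metis
  define f where "f u = (SOME u'. u' \<in> verts ?G' \<and> corresponding ?G ?G' u u')" for u
  have f: "f u \<in> verts ?G'" "corresponding ?G ?G' u (f u)" if "u \<in> verts ?G" for u
  proof -
    have "\<exists>u'. u' \<in> verts ?G' \<and> corresponding ?G ?G' u u'"
      using corresponding_exists[OF t ess t' X[symmetric] cl' that] by blast
    from someI_ex[OF this] show "f u \<in> verts ?G'" "corresponding ?G ?G' u (f u)"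
      unfolding f_def by blast+
  qed
  have bij: "bij_betw f (verts ?G) (verts ?G')"
    unfolding bij_betw_def
  proof
    show "inj_on f (verts ?G)"
    proof (rule inj_onI)
      fix u v assume uv: "u \<in> verts ?G" "v \<in> verts ?G" "f u = f v"
      show "u = v"
        using corresponding_unique[OF t cl, of "f u" u v] f[OF uv(1)] f[OF uv(2)] uv
        by (metis corresponding_sym)
    qed
    show "f ` verts ?G = verts ?G'"
    proof
      show "f ` verts ?G \<subseteq> verts ?G'"
        using f by blast
      show "verts ?G' \<subseteq> f ` verts ?G"
      proof
        fix u' assume u': "u' \<in> verts ?G'"
        then obtain u where u: "u \<in> verts ?G" "corresponding ?G' ?G u' u"
          using corresponding_exists[OF t' ess' t X cl] by blast
        then have "f u = u'"
          using corresponding_unique[OF t' cl'] f[OF u(1)] u' by (metis corresponding_sym)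
        then show "u' \<in> f ` verts ?G"
          using u by blast
      qed
    qed
  qed
  \<comment> \<open>The first edge from \<open>f u\<close> towards \<open>f v\<close> has a split
    that also occurs in the first tree and there separates \<open>u\<close> from \<open>v\<close>,
    so it is the split of \<open>{u, v}\<close>. In an essential tree only \<open>e'\<close> induces
    it.\<close>
  have f_in: "f u \<in> e'"
    if e: "{u, v} \<in> edges ?G" and A: "is_cut ?G {u, v} A" and A': "is_cut ?G' e' A'"
      and eq: "A \<inter> leaves ?G = A' \<inter> leaves ?G'" for u v e' A A'
  proof -
    have V: "u \<in> verts ?G" "v \<in> verts ?G"
      using simple_adjD[OF tree_simple[OF t], of u v] e by (simp_all add: adj_def)
    have "f u \<in> A' \<longleftrightarrow> u \<in> A" "f v \<in> A' \<longleftrightarrow> v \<in> A"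
      using f(2)[OF V(1)] f(2)[OF V(2)] A A' eq unfolding corresponding_def by blast+
    then have "f u \<noteq> f v"
      using cut_other_side[OF A] by auto
    then obtain w C' where C': "is_cut ?G' {f u, w} C'" "f u \<notin> C'" "f v \<in> C'"
      using edge_towards[OF t' f(1)[OF V(1)] f(1)[OF V(2)]] by metis
    obtain g C where C: "is_cut ?G g C" "C \<inter> leaves ?G = C' \<inter> leaves ?G'"
      using cluster_transfer[OF cl' C'(1)] .
    have "u \<notin> C" "v \<in> C"
      using f(2)[OF V(1)] f(2)[OF V(2)] C C' unfolding corresponding_def by blast+
    then have "g = {u, v}"
      using cut_same_side[OF C(1) e] by blast
    then have "C \<inter> leaves ?G = A \<inter> leaves ?G \<or> C \<inter> leaves ?G = - A \<inter> leaves ?G"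
      using cut_eq_or_Compl[OF t C(1), of A] A leaves_subset[of ?G] by blast
    then have "C' \<inter> leaves ?G' = A' \<inter> leaves ?G' \<or> C' \<inter> leaves ?G' = - A' \<inter> leaves ?G'"
      using C(2) eq X by blast
    moreover have "is_cut ?G' e' (- A')"
      using A' by simp
    ultimately have "{f u, w} = e'"
      using essential_cut_inj[OF t' ess' C'(1)] A' by blast
    then show ?thesis
      by blast
  qed
  have f_edge: "f ` e = e'"
    if A: "is_cut ?G e A" and A': "is_cut ?G' e' A'"
      and eq: "A \<inter> leaves ?G = A' \<inter> leaves ?G'" for e e' A A'
  proof -
    obtain u v where uv: "e = {u, v}" "u \<noteq> v" "u \<in> verts ?G" "v \<in> verts ?G"
      using simple_edgeE[OF tree_simple[OF t] cut_edge[OF A]] by metis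
    have "{u, v} \<in> edges ?G" "{v, u} \<in> edges ?G" "is_cut ?G {v, u} A"
      using cut_edge[OF A] A uv by (simp_all add: insert_commute)
    then have "f u \<in> e'" "f v \<in> e'"
      using f_in[OF _ _ A' eq] A uv(1) by blast+
    moreover have "f u \<noteq> f v"
      using bij uv by (auto simp: bij_betw_def dest: inj_onD)
    ultimately have "e' = {f u, f v}"
      using edge_through_two[OF t', of e' "f u" "f v"] cut_edge[OF A'] by (simp add: edges_at_def)
    then show ?thesis
      using uv by simp
  qed
  have "edges ?G' = (\<lambda>e. f ` e) ` edges ?G"
  proof
    show "edges ?G' \<subseteq> (\<lambda>e. f ` e) ` edges ?G"
    proof
      fix e' assume "e' \<in> edges ?G'"
      then obtain e A A' where A: "is_cut ?G e A" "is_cut ?G' e' A'" "A \<inter> leaves ?G = A' \<inter> leaves ?G'"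
        using bwd by blast
      show "e' \<in> (\<lambda>e. f ` e) ` edges ?G"
        using f_edge[OF A] cut_edge[OF A(1)] by blast
    qed
    show "(\<lambda>e. f ` e) ` edges ?G \<subseteq> edges ?G'"
    proof
      fix e' assume "e' \<in> (\<lambda>e. f ` e) ` edges ?G"
      then obtain e where e: "e \<in> edges ?G" "e' = f ` e"
        by blast
      obtain e'' A A' where A: "is_cut ?G e A" "is_cut ?G' e'' A'" "A \<inter> leaves ?G = A' \<inter> leaves ?G'"
        using fwd[OF e(1)] by blast
      show "e' \<in> edges ?G'"
        using f_edge[OF A] cut_edge[OF A(2)] e by simp
    qed
  qed
  moreover have "weight T' (f ` e) = weight T e" if e: "e \<in> edges ?G" for e
  proof -
    obtain e' A A' where A: "is_cut ?G e A" "is_cut ?G' e' A'" "A \<inter> leaves ?G = A' \<inter> leaves ?G'"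
      and w: "weight T' e' = weight T e"
      using fwd[OF e] by blast
    show ?thesis
      using f_edge[OF A] w by simp
  qed
  \<comment> \<open>For a leaf, membership in a cut is read off from the trace on the leaves, so a
    leaf corresponds to itself.\<close>
  moreover have "f x = x" if x: "x \<in> leaves ?G" for x
  proof -
    have "corresponding ?G ?G' x x"
      using x X unfolding corresponding_def by blast
    moreover have "x \<in> verts ?G" "x \<in> verts ?G'"
      using x X leaves_subset[of ?G] leaves_subset[of ?G'] by auto
    ultimately show ?thesis
      using corresponding_unique[OF t' cl' f(2)] f(1) by blast
  qed
  ultimately show ?thesis
    unfolding wtree_iso_def using bij by blast
qed

lemma wtree_iso_D_tot:
  assumes s: "simple_graph (shape T)" and iso: "wtree_iso T T'"
  shows "D_tot T' = D_tot T"
proof -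
  obtain f where f: "bij_betw f (verts (shape T)) (verts (shape T'))"
    "edges (shape T') = (\<lambda>e. f ` e) ` edges (shape T)"
    "\<And>e. e \<in> edges (shape T) \<Longrightarrow> weight T' (f ` e) = weight T e"
    using iso unfolding wtree_iso_def by blast
  have "edges (shape T) \<subseteq> Pow (verts (shape T))"
    using s by (auto simp: simple_graph_def)
  then have "inj_on (\<lambda>e. f ` e) (edges (shape T))"
    using f(1) inj_on_subset[OF inj_on_image_Pow] by (metis bij_betw_def)
  then show ?thesis
    unfolding D_tot_def f(2) using sum.reindex f(3) by (simp add: sum.reindex)
qed

lemma same_wtree_D_tot:
  assumes T: "positive_weighted_tree T" "positive_weighted_tree T'" and s: "same_wtree T T'"
  shows "D_tot T = D_tot T'"
proof -
  obtain Q Q' where Q: "suppress_step\<^sup>*\<^sup>* T Q" "suppress_step\<^sup>*\<^sup>* T' Q'" "wtree_iso Q Q'"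
    using s unfolding same_wtree_def by blast
  have "positive_weighted_tree Q" "D_tot Q = D_tot T" "D_tot Q' = D_tot T'"
    using suppress_steps_preserve[OF Q(1) T(1)] suppress_steps_preserve[OF Q(2) T(2)] by auto
  then show ?thesis
    using wtree_iso_D_tot[OF tree_simple[OF positive_weightD(1)] Q(3)] by simp
qed

section \<open>Comparison of realizing trees\<close>

text \<open>Each split is represented by its part containing the fixed leaf \<open>x0\<close>. The
  symmetry of \<open>\<phi>\<close> makes the arbitrary choice of \<open>side\<close>
  harmless.\<close>

lemma sum_by_cluster:
  fixes \<phi> :: "'v set \<Rightarrow> real"
  assumes t: "tree (shape T)" and X: "leaves (shape T) = X" and x0: "x0 \<in> X"
    and sym: "\<And>A. A \<subseteq> X \<Longrightarrow> \<phi> (X - A) = \<phi> A"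
  shows "(\<Sum>e\<in>edges (shape T). weight T e * \<phi> (side (shape T) e \<inter> X)) =
    (\<Sum>A | A \<subseteq> X \<and> x0 \<in> A. split_weight T A * \<phi> A)"
proof -
  let ?G = "shape T"
  define N where "N e = (if x0 \<in> side ?G e then side ?G e \<inter> X else X - side ?G e)" for e
  have finX: "finite X"
    using finite_leaves[OF t] X by simp
  have \<phi>N: "\<phi> (side ?G e \<inter> X) = \<phi> (N e)" for e
  proof -
    have "X - (side ?G e \<inter> X) = X - side ?G e"
      by blast
    then show ?thesis
      using sym[of "side ?G e \<inter> X"] by (simp add: N_def)
  qed
  have N_cluster: "{e \<in> edges ?G. N e = A} = cluster_edges ?G A" if A: "A \<subseteq> X" "x0 \<in> A" for A
  proof -
    have "N e = A \<longleftrightarrow> e \<in> cluster_edges ?G A" if e: "e \<in> edges ?G" for e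
      unfolding cluster_edges_iff[OF t e] X N_def using A x0 by auto
    then show ?thesis
      using cluster_edges_subset[of ?G A] by blast
  qed
  have "(\<Sum>e\<in>edges ?G. weight T e * \<phi> (side ?G e \<inter> X)) = (\<Sum>e\<in>edges ?G. weight T e * \<phi> (N e))"
    by (simp add: \<phi>N)
  also have "\<dots> = (\<Sum>A | A \<subseteq> X \<and> x0 \<in> A. \<Sum>e | e \<in> edges ?G \<and> N e = A. weight T e * \<phi> (N e))"
    by (rule sum.group[symmetric]) (use tree_finite(2)[OF t] finX x0 in \<open>auto simp: N_def\<close>)
  also have "\<dots> = (\<Sum>A | A \<subseteq> X \<and> x0 \<in> A. split_weight T A * \<phi> A)"
  proof (rule sum.cong)
    fix A assume "A \<in> {A. A \<subseteq> X \<and> x0 \<in> A}"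
    then have "{e \<in> edges ?G. N e = A} = cluster_edges ?G A"
      using N_cluster by blast
    moreover have "(\<Sum>e | e \<in> edges ?G \<and> N e = A. weight T e * \<phi> (N e)) =
        (\<Sum>e | e \<in> edges ?G \<and> N e = A. weight T e) * \<phi> A"
      unfolding sum_distrib_right by (rule sum.cong) auto
    ultimately show "(\<Sum>e | e \<in> edges ?G \<and> N e = A. weight T e * \<phi> (N e)) = split_weight T A * \<phi> A"
      by (simp add: split_weight_def)
  qed simp
  finally show ?thesis .
qed

definition small_splits :: "nat \<Rightarrow> 'v set \<Rightarrow> 'v \<Rightarrow> 'v set set" where
  "small_splits k X x0 = {A. A \<subseteq> X \<and> x0 \<in> A \<and> card A < k \<and> card (X - A) < k}"

text \<open>The splits whose weight the values \<open>D_I\<close> determine. Splits off a single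
  leaf are left out because their weight varies; for \<open>k < card X\<close> they are not among
  the \<open>small_splits\<close> either.\<close>

definition large_splits :: "nat \<Rightarrow> 'v set \<Rightarrow> 'v \<Rightarrow> 'v set set" where
  "large_splits k X x0 = {A. A \<subseteq> X \<and> x0 \<in> A \<and> 2 \<le> card A \<and> 2 \<le> card (X - A) \<and> (k \<le> card A \<or> k \<le> card (X - A))}"

lemma split_weight_Compl:
  assumes "tree (shape T)" "leaves (shape T) = X" "A \<subseteq> X"
  shows "split_weight T (X - A) = split_weight T A"
  using cluster_edges_Compl[of "shape T" A] assms by (simp add: split_weight_def)

lemma split_weight_all_leaves:
  assumes t: "tree (shape T)"
  shows "split_weight T (leaves (shape T)) = 0"
proof -
  have "cluster_edges (shape T) (leaves (shape T)) = {}"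
  proof (rule ccontr)
    assume "cluster_edges (shape T) (leaves (shape T)) \<noteq> {}"
    then obtain e B where B: "is_cut (shape T) e B" "B \<inter> leaves (shape T) = leaves (shape T)"
      unfolding cluster_edges_def by blast
    then have "is_cut (shape T) e (- B)"
      by simp
    then show False
      using cut_has_leaf[OF t] B(2) by blast
  qed
  then show ?thesis
    by (simp add: split_weight_def)
qed

lemma sum_split_types:
  fixes \<phi> :: "'v set \<Rightarrow> real"
  assumes t: "tree (shape T)" and X: "leaves (shape T) = X" and x0: "x0 \<in> X"
    and k: "3 \<le> k" "k < card X"
    and sym: "\<And>A. A \<subseteq> X \<Longrightarrow> \<phi> (X - A) = \<phi> A"
  shows "(\<Sum>e\<in>edges (shape T). weight T e * \<phi> (side (shape T) e \<inter> X)) =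
    (\<Sum>x\<in>X. split_weight T {x} * \<phi> {x}) + (\<Sum>A\<in>small_splits k X x0. split_weight T A * \<phi> A)
      + (\<Sum>A\<in>large_splits k X x0. split_weight T A * \<phi> A)"
proof -
  let ?h = "\<lambda>A. split_weight T A * \<phi> A"
  define N where "N x = (if x = x0 then {x0} else X - {x})" for x
  have finX: "finite X"
    using finite_leaves[OF t] X by simp
  have card_N: "card (N x) = 1 \<or> card (X - N x) = 1" "card (N x) + card (X - N x) = card X"
    "N x \<subseteq> X" "x0 \<in> N x" if "x \<in> X" for x
  proof -
    show "N x \<subseteq> X" "x0 \<in> N x"
      using that x0 by (auto simp: N_def)
    have "X - (X - {x}) = {x}"
      using that by blast
    then show "card (N x) = 1 \<or> card (X - N x) = 1"
      by (simp add: N_def)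
    show "card (N x) + card (X - N x) = card X"
      using card_Un_disjoint[of "N x" "X - N x"] finX \<open>N x \<subseteq> X\<close>
      by (metis Diff_disjoint Un_Diff_cancel Un_absorb1 finite_Diff rev_finite_subset)
  qed
  have injN: "inj_on N X"
  proof (rule inj_onI)
    fix x y assume xy: "x \<in> X" "y \<in> X" "N x = N y"
    have big: "X - {z} \<noteq> {x0}" for z
    proof
      assume "X - {z} = {x0}"
      then have "X \<subseteq> {z, x0}" by blast
      then have "card X \<le> 2"
        using card_mono[of "{z, x0}" X] by (auto simp: card_insert_if split: if_splits)
      then show False using k by simp
    qed
    show "x = y"
      using xy big[of x] big[of y] by (auto simp: N_def split: if_splits)
  qed
  have fin: "finite (N ` X)" "finite (small_splits k X x0)" "finite (large_splits k X x0)"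
    using finX by (auto simp: small_splits_def large_splits_def)
  \<comment> \<open>\<open>X\<close> stands for the trivial split, which has weight 0 since no edge
    has all leaves on one side.\<close>
  have split: "{A. A \<subseteq> X \<and> x0 \<in> A} =
    insert X (N ` X \<union> small_splits k X x0 \<union> large_splits k X x0)" (is "?L = ?R")
  proof
    show "?R \<subseteq> ?L"
      using card_N x0 by (auto simp: small_splits_def large_splits_def)
    show "?L \<subseteq> ?R"
    proof
      fix A assume "A \<in> ?L"
      then have A: "A \<subseteq> X" "x0 \<in> A" by auto
      have A0: "card A \<noteq> 0"
        using A(2) finite_subset[OF A(1) finX] by auto
      consider "card A = 1" | "card (X - A) = 0" | "card (X - A) = 1" | "2 \<le> card A" "2 \<le> card (X - A)"
        using A0 by linarith
      then show "A \<in> ?R"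
      proof cases
        case 1
        then have "A = N x0"
          using A by (auto simp: N_def card_1_singleton_iff)
        then show ?thesis using x0 by blast
      next
        case 2
        then have "A = X"
          using A finX by auto
        then show ?thesis by blast
      next
        case 3
        then obtain x where x: "X - A = {x}"
          by (auto simp: card_1_singleton_iff)
        then have "A = N x" "x \<in> X"
          using A by (auto simp: N_def)
        then show ?thesis by blast
      next
        case 4
        then show ?thesis
          using A by (auto simp: small_splits_def large_splits_def)
      qed
    qed
  qed
  have XnotN: "X \<notin> N ` X \<union> small_splits k X x0 \<union> large_splits k X x0"
  proof -
    have "X \<noteq> N x" if "x \<in> X" for x
      using card_N[OF that] k by auto
    then show ?thesis
      using k by (auto simp: small_splits_def large_splits_def)
  qed
  have disj: "N ` X \<inter> small_splits k X x0 = {}" "(N ` X \<union> small_splits k X x0) \<inter> large_splits k X x0 = {}"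
  proof -
    have "N x \<notin> small_splits k X x0" "N x \<notin> large_splits k X x0" if "x \<in> X" for x
      using card_N[OF that] k by (auto simp: small_splits_def large_splits_def)
    then show "N ` X \<inter> small_splits k X x0 = {}" "(N ` X \<union> small_splits k X x0) \<inter> large_splits k X x0 = {}"
      by (auto simp: small_splits_def large_splits_def)
  qed
  have hN: "?h (N x) = ?h {x}" if "x \<in> X" for x
    using that sym[of "{x}"] split_weight_Compl[OF t X, of "{x}"] by (auto simp: N_def)
  have "(\<Sum>e\<in>edges (shape T). weight T e * \<phi> (side (shape T) e \<inter> X)) = (\<Sum>A | A \<subseteq> X \<and> x0 \<in> A. ?h A)"
    by (rule sum_by_cluster[OF t X x0, where \<phi> = \<phi>]) (rule sym)
  also have "\<dots> = sum ?h (N ` X \<union> small_splits k X x0 \<union> large_splits k X x0)"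
    unfolding split using fin XnotN split_weight_all_leaves[OF t] X by (subst sum.insert) auto
  also have "\<dots> = sum ?h (N ` X) + sum ?h (small_splits k X x0) + sum ?h (large_splits k X x0)"
    using fin disj by (simp add: sum.union_disjoint)
  also have "sum ?h (N ` X) = (\<Sum>x\<in>X. ?h {x})"
    using sum.reindex[OF injN, of ?h] hN by simp
  finally show ?thesis .
qed

definition bad_weight :: "nat \<Rightarrow> 'v wtree \<Rightarrow> real" where
  "bad_weight k T = (\<Sum>e\<in>bad_edges k (shape T). weight T e)"

lemma finite_bad_edges: "tree G \<Longrightarrow> finite (bad_edges k G)"
  by (simp add: bad_edges_def tree_finite(2))

lemma bad_weight_nonneg: "positive_weighted_tree T \<Longrightarrow> 0 \<le> bad_weight k T"
  unfolding bad_weight_def bad_edges_def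
  by (rule sum_nonneg) (auto dest: positive_weightD(2) intro: less_imp_le)

lemma bad_weight_eq_0_iff:
  assumes "positive_weighted_tree T"
  shows "bad_weight k T = 0 \<longleftrightarrow> bad_edges k (shape T) = {}"
proof
  assume "bad_weight k T = 0"
  moreover have "0 < bad_weight k T" if "bad_edges k (shape T) \<noteq> {}"
    unfolding bad_weight_def
    by (rule sum_pos[OF finite_bad_edges[OF positive_weightD(1)[OF assms]] that])
      (use positive_weightD(2)[OF assms] in \<open>auto simp: bad_edges_def\<close>)
  ultimately show "bad_edges k (shape T) = {}"
    by force
qed (simp add: bad_weight_def)

lemma bad_weight_eq_small_splits:
  assumes t: "tree (shape T)" and X: "leaves (shape T) = X" and x0: "x0 \<in> X" and k: "3 \<le> k" "k < card X"
  shows "bad_weight k T = (\<Sum>A\<in>small_splits k X x0. split_weight T A)"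
proof -
  have finX: "finite X"
    using finite_leaves[OF t] X by simp
  define \<phi> :: "'a set \<Rightarrow> real" where "\<phi> A = of_bool (card A < k \<and> card (X - A) < k)" for A
  have sym: "\<phi> (X - A) = \<phi> A" if "A \<subseteq> X" for A
    using that double_diff[OF that, of X] by (auto simp: \<phi>_def)
  have "X - (S \<inter> X) = X - S" for S
    by blast
  then have "bad_weight k T = (\<Sum>e\<in>edges (shape T). weight T e * \<phi> (side (shape T) e \<inter> X))"
    unfolding bad_weight_def bad_edges_def \<phi>_def X
    by (intro sum.mono_neutral_cong_left) (use tree_finite(2)[OF t] in auto)
  also have "\<dots> = (\<Sum>x\<in>X. split_weight T {x} * \<phi> {x}) + (\<Sum>A\<in>small_splits k X x0. split_weight T A * \<phi> A)
      + (\<Sum>A\<in>large_splits k X x0. split_weight T A * \<phi> A)"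
    by (rule sum_split_types[OF t X x0 k, where \<phi> = \<phi>]) (rule sym)
  also have "(\<Sum>x\<in>X. split_weight T {x} * \<phi> {x}) = 0"
    by (rule sum.neutral) (use finX k in \<open>auto simp: \<phi>_def\<close>)
  also have "(\<Sum>A\<in>large_splits k X x0. split_weight T A * \<phi> A) = 0"
    by (rule sum.neutral) (auto simp: \<phi>_def large_splits_def)
  also have "(\<Sum>A\<in>small_splits k X x0. split_weight T A * \<phi> A) = (\<Sum>A\<in>small_splits k X x0. split_weight T A)"
    by (rule sum.cong) (auto simp: \<phi>_def small_splits_def)
  finally show ?thesis by simp
qed

lemma D_tot_split_types:
  assumes t: "tree (shape T)" and X: "leaves (shape T) = X" and x0: "x0 \<in> X" and k: "3 \<le> k" "k < card X"
  shows "D_tot T = (\<Sum>x\<in>X. split_weight T {x}) + bad_weight k T + (\<Sum>A\<in>large_splits k X x0. split_weight T A)"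
  using sum_split_types[OF t X x0 k, of "\<lambda>_. 1"] bad_weight_eq_small_splits[OF t X x0 k]
  by (simp add: D_tot_def)

text \<open>No part of a small split can contain \<open>I\<close>, so the bad edges enter as a
  constant. As the large splits have determined weights, the leaf terms are the only ones that
  depend on both the tree and \<open>I\<close>.\<close>

lemma D_of_split_types:
  assumes t: "tree (shape T)" and X: "leaves (shape T) = X" and x0: "x0 \<in> X" and k: "3 \<le> k" "k < card X"
    and I: "I \<subseteq> X" "card I = k"
  shows "D_of T I = (\<Sum>x\<in>I. split_weight T {x}) + bad_weight k T
    + (\<Sum>A\<in>large_splits k X x0. split_weight T A * of_bool (crosses I A))"
proof -
  have finX: "finite X"
    using finite_leaves[OF t] X by simp
  have IV: "I \<subseteq> verts (shape T)" "I \<noteq> {}"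
    using I X leaves_subset[of "shape T"] k by auto
  define \<phi> :: "'a set \<Rightarrow> real" where "\<phi> A = of_bool (crosses I A)" for A
  have sym: "\<phi> (X - A) = \<phi> A" if "A \<subseteq> X" for A
    using I unfolding \<phi>_def crosses_def by (intro arg_cong[where f = of_bool]) blast
  have inter: "crosses I S = crosses I (S \<inter> X)" for S
    using I unfolding crosses_def by blast
  have "D_of T I = (\<Sum>e\<in>edges (shape T). weight T e * \<phi> (side (shape T) e \<inter> X))"
    unfolding D_of_eq_sum_of_bool[OF t IV] \<phi>_def by (subst inter) simp
  also have "\<dots> = (\<Sum>x\<in>X. split_weight T {x} * \<phi> {x}) + (\<Sum>A\<in>small_splits k X x0. split_weight T A * \<phi> A)
      + (\<Sum>A\<in>large_splits k X x0. split_weight T A * \<phi> A)"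
    by (rule sum_split_types[OF t X x0 k, where \<phi> = \<phi>]) (rule sym)
  also have "(\<Sum>x\<in>X. split_weight T {x} * \<phi> {x}) = (\<Sum>x\<in>I. split_weight T {x})"
    by (rule sum.mono_neutral_cong_right) (use finX I k in \<open>auto simp: \<phi>_def crosses_singleton\<close>)
  also have "(\<Sum>A\<in>small_splits k X x0. split_weight T A * \<phi> A) = (\<Sum>A\<in>small_splits k X x0. split_weight T A)"
  proof (rule sum.cong)
    fix A assume "A \<in> small_splits k X x0"
    then have A: "A \<subseteq> X" "card A < k" "card (X - A) < k"
      by (auto simp: small_splits_def)
    have "crosses I A"
    proof (rule ccontr)
      assume "\<not> crosses I A"
      then have "I \<subseteq> A \<or> I \<subseteq> X - A"
        using I unfolding crosses_def by blast
      then have "card I \<le> card A \<or> card I \<le> card (X - A)"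
        using A finX by (meson card_mono finite_Diff finite_subset)
      then show False
        using A I by linarith
    qed
    then show "split_weight T A * \<phi> A = split_weight T A"
      by (simp add: \<phi>_def)
  qed simp
  finally show ?thesis
    using bad_weight_eq_small_splits[OF t X x0 k] by (simp add: \<phi>_def)
qed

text \<open>Comparing \<open>insert x J\<close> with \<open>insert y J\<close> for
  \<open>k - 1\<close> further elements \<open>J\<close> gives \<open>d x = d y\<close>. Such a
  \<open>J\<close> exists because \<open>k < card X\<close>.\<close>

lemma equal_sums_on_subsets:
  fixes d :: "'v \<Rightarrow> real"
  assumes fin: "finite X" and k: "1 \<le> k" "k < card X" and d: "\<And>I. I \<subseteq> X \<Longrightarrow> card I = k \<Longrightarrow> sum d I = c"
    and x: "x \<in> X"
  shows "d x = c / k"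
proof -
  have eq: "d y = d x" if y: "y \<in> X" for y
  proof (cases "y = x")
    case False
    have "k - 1 \<le> card (X - {x, y})"
      using fin x y False k by (simp add: card_Diff_subset)
    then obtain J where J: "J \<subseteq> X - {x, y}" "card J = k - 1" "finite J"
      using obtain_subset_with_card_n by metis
    have ins: "sum d (insert z J) = c" "z \<notin> J" if "z \<in> {x, y}" for z
    proof -
      show "z \<notin> J" using J that by blast
      then have "card (insert z J) = k"
        using J k by simp
      moreover have "insert z J \<subseteq> X"
        using J that x y by blast
      ultimately show "sum d (insert z J) = c"
        using d by blast
    qed
    show ?thesis
      using ins[of x] ins[of y] J(3) by simp
  qed simp
  obtain I where I: "I \<subseteq> X" "card I = k"
    using k obtain_subset_with_card_n[of k X] by (metis less_imp_le)
  have "c = sum d I"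
    using d[OF I] by simp
  also have "\<dots> = (\<Sum>y\<in>I. d x)"
    by (rule sum.cong) (use eq I in auto)
  finally show ?thesis
    using I k by simp
qed

text \<open>The hypotheses are symmetric in the two trees, so every result can be used in both
  directions. In most applications \<open>T'\<close> is the pseudostar, whose bad weight is
  0.\<close>

locale same_multiweights =
  fixes T T' :: "'v wtree" and X :: "'v set" and k :: nat
  assumes pos: "positive_weighted_tree T" and pos': "positive_weighted_tree T'"
    and leaves: "leaves (shape T) = X" and leaves': "leaves (shape T') = X"
    and same: "\<And>I. I \<subseteq> X \<Longrightarrow> card I = k \<Longrightarrow> D_of T I = D_of T' I"
    and k: "3 \<le> k" "k < card X"
begin

lemma trees: "tree (shape T)" "tree (shape T')"
  using pos pos' by (simp_all add: positive_weightD(1))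

lemma finX: "finite X"
  using finite_leaves[OF trees(1)] leaves by simp

lemma large_split_weight_eq:
  assumes A: "A \<subseteq> X" "2 \<le> card A" "2 \<le> card (X - A)" "k \<le> card A \<or> k \<le> card (X - A)"
  shows "split_weight T A = split_weight T' A"
proof (cases "k \<le> card A")
  case True
  then show ?thesis
    using split_weight_determined[OF pos leaves pos' leaves' same k(1)] A by blast
next
  case False
  have "X - (X - A) = A"
    using A(1) by blast
  then have "split_weight T (X - A) = split_weight T' (X - A)"
    using split_weight_determined[OF pos leaves pos' leaves' same k(1), of "X - A"] A False by simp
  then show ?thesis
    using split_weight_Compl[OF trees(1) leaves A(1)] split_weight_Compl[OF trees(2) leaves' A(1)] by simp
qed

text \<open>The large splits cancel between the two trees. Over every \<open>k\<close>-subset the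
  changes of the leaf weights thus sum to the difference of the bad weights, so they are all
  equal.\<close>

lemma leaf_split_weight_diff:
  assumes x: "x \<in> X"
  shows "split_weight T' {x} = split_weight T {x} + (bad_weight k T - bad_weight k T') / k"
proof -
  have "(\<lambda>y. split_weight T' {y} - split_weight T {y}) x = (bad_weight k T - bad_weight k T') / k"
  proof (rule equal_sums_on_subsets[OF finX _ k(2) _ x])
    fix I assume I: "I \<subseteq> X" "card I = k"
    have "(\<Sum>A\<in>large_splits k X x. split_weight T A * of_bool (crosses I A)) =
      (\<Sum>A\<in>large_splits k X x. split_weight T' A * of_bool (crosses I A))"
      by (rule sum.cong) (auto simp: large_splits_def large_split_weight_eq)
    then have "(\<Sum>y\<in>I. split_weight T {y}) + bad_weight k T = (\<Sum>y\<in>I. split_weight T' {y}) + bad_weight k T'"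
      using D_of_split_types[OF trees(1) leaves x k I] D_of_split_types[OF trees(2) leaves' x k I]
        same[OF I] by linarith
    then show "(\<Sum>y\<in>I. split_weight T' {y} - split_weight T {y}) = bad_weight k T - bad_weight k T'"
      by (simp add: sum_subtractf)
  qed (use k in simp)
  then show ?thesis by simp
qed

text \<open>With \<open>\<delta>\<close> the common change of the leaf weights, the leaves gain
  \<open>card X * \<delta>\<close> while the bad edges lose \<open>k * \<delta>\<close>.\<close>

lemma D_tot_diff:
  "D_tot T' = D_tot T + (card X - k) * ((bad_weight k T - bad_weight k T') / k)"
proof -
  obtain x where x: "x \<in> X"
    using k by fastforce
  define \<delta> where "\<delta> = (bad_weight k T - bad_weight k T') / k"
  have "(\<Sum>y\<in>X. split_weight T' {y}) = (\<Sum>y\<in>X. split_weight T {y} + \<delta>)"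
    by (rule sum.cong) (use leaf_split_weight_diff in \<open>auto simp: \<delta>_def\<close>)
  then have leaf: "(\<Sum>y\<in>X. split_weight T' {y}) = (\<Sum>y\<in>X. split_weight T {y}) + card X * \<delta>"
    by (simp add: sum.distrib)
  have large: "(\<Sum>A\<in>large_splits k X x. split_weight T A) = (\<Sum>A\<in>large_splits k X x. split_weight T' A)"
    by (rule sum.cong) (auto simp: large_splits_def large_split_weight_eq)
  have "bad_weight k T - bad_weight k T' = k * \<delta>"
    using k by (simp add: \<delta>_def)
  moreover have "real (card X - k) = real (card X) - real k"
    using k by simp
  ultimately show ?thesis
    using D_tot_split_types[OF trees(1) leaves x k] D_tot_split_types[OF trees(2) leaves' x k] leaf large
    unfolding \<delta>_def[symmetric] by (simp add: left_diff_distrib)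
qed

end

section \<open>Leaf edges and twigs of essential trees\<close>

lemma essential_split_weight:
  assumes t: "tree (shape T)" and ess: "essential (shape T)" and B: "is_cut (shape T) e B"
  shows "split_weight T (B \<inter> leaves (shape T)) = weight T e"
proof -
  have "cluster_edges (shape T) (B \<inter> leaves (shape T)) = {e}"
    using essential_cut_inj[OF t ess _ B] B unfolding cluster_edges_def by blast
  then show ?thesis
    by (simp add: split_weight_def)
qed

lemma leaf_split_weight_pos:
  assumes T: "positive_weighted_tree T" and x: "x \<in> leaves (shape T)"
  shows "0 < split_weight T {x}"
proof -
  have "is_cut (shape T) (leaf_edge (shape T) x) {x}" "{x} \<inter> leaves (shape T) = {x}"
    using leaf_edge(4)[OF positive_weightD(1)[OF T] x] x by auto
  then have "cluster_edges (shape T) {x} \<noteq> {}"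
    unfolding cluster_edges_def by blast
  then show ?thesis
    by (rule split_weight_pos[OF T])
qed

lemma essential_leaf_split_weight:
  assumes t: "tree (shape T)" and ess: "essential (shape T)" and x: "x \<in> leaves (shape T)"
  shows "split_weight T {x} = weight T (leaf_edge (shape T) x)"
  using essential_split_weight[OF t ess leaf_edge(4)[OF t x]] x by simp

text \<open>With at least three leaves the neighbour of a leaf is not a leaf, and by essentiality it
  does not have degree 2. It is therefore a node, and the twig is the leaf edge alone.\<close>

lemma essential_twig_weights:
  assumes t: "tree (shape T)" and ess: "essential (shape T)" and X: "3 \<le> card (leaves (shape T))"
  shows "twig_weights T = (\<lambda>x. split_weight T {x}) ` leaves (shape T)"
proof -
  let ?G = "shape T"
  have twig: "is_twig ?G x xs \<longleftrightarrow> xs = [x, y]"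
    if x: "x \<in> leaves ?G" and y: "leaf_edge ?G x = {x, y}" "y \<noteq> x" "{x, y} \<in> edges ?G" "y \<in> verts ?G" "y \<notin> leaves ?G"
    for x y xs
  proof -
    have "degree ?G y \<noteq> 0"
      using edges_at_nonempty[OF t y(4) y(3)] finite_edges_at[OF t, of y] by (simp add: degree_eq)
    moreover have "degree ?G y \<noteq> 1" "degree ?G y \<noteq> 2"
      using y(4,5) ess by (auto simp: leaves_def essential_def)
    ultimately have yN: "y \<in> nodes ?G"
      using y(4) by (simp add: nodes_def)
    have xN: "x \<notin> nodes ?G" and xV: "x \<in> verts ?G"
      using x by (simp_all add: nodes_def leaves_def)
    show ?thesis
    proof
      assume xs: "is_twig ?G x xs"
      then have p: "is_path ?G xs" "hd xs = x" "last xs \<in> nodes ?G" "set (butlast xs) \<inter> nodes ?G = {}"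
        by (auto simp: is_twig_def)
      then obtain zs where zs: "xs = x # zs"
        by (cases xs) (auto simp: is_path_def)
      with p xN obtain z ws where ws: "zs = z # ws"
        by (cases zs) auto
      have "{x, z} \<in> edges ?G"
        using p(1) zs ws by (simp add: is_path_def adj_def)
      then have "{x, z} = {x, y}"
        using leaf_edge_iff[OF t _ x, of "{x, z}"] y(1) by simp
      then have "z = y"
        by (auto simp: doubleton_eq_iff)
      then have "ws = []"
        using p(4) zs ws yN by (cases ws) auto
      then show "xs = [x, y]"
        using zs ws \<open>z = y\<close> by simp
    next
      assume "xs = [x, y]"
      then show "is_twig ?G x xs"
        using x y xN yN xV by (auto simp: is_twig_def is_path_def adj_def)
    qed
  qed
  have path: "path_edges [x, y] = {{x, y}}" for x y :: 'a
    by (auto simp: path_edges_def)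
  have sum: "(\<Sum>e\<in>path_edges xs. weight T e) = split_weight T {x}" if "is_twig ?G x xs" for x xs
  proof -
    have x: "x \<in> leaves ?G"
      using that by (simp add: is_twig_def)
    obtain y where y: "leaf_edge ?G x = {x, y}" "y \<noteq> x" "{x, y} \<in> edges ?G" "y \<in> verts ?G" "y \<notin> leaves ?G"
      by (rule leaf_neighbour[OF t X x])
    show ?thesis
      using twig[OF x y] that path[of x y] essential_leaf_split_weight[OF t ess x] y(1) by simp
  qed
  have ex: "\<exists>xs. is_twig ?G x xs" if x: "x \<in> leaves ?G" for x
  proof -
    obtain y where y: "leaf_edge ?G x = {x, y}" "y \<noteq> x" "{x, y} \<in> edges ?G" "y \<in> verts ?G" "y \<notin> leaves ?G"
      by (rule leaf_neighbour[OF t X x])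
    show ?thesis
      using twig[OF x y] by blast
  qed
  show ?thesis
  proof
    show "twig_weights T \<subseteq> (\<lambda>x. split_weight T {x}) ` leaves ?G"
    proof
      fix r assume "r \<in> twig_weights T"
      then obtain x xs where xs: "r = (\<Sum>e\<in>path_edges xs. weight T e)" "is_twig ?G x xs"
        unfolding twig_weights_def by blast
      then have "x \<in> leaves ?G"
        by (simp add: is_twig_def)
      then show "r \<in> (\<lambda>x. split_weight T {x}) ` leaves ?G"
        using sum[OF xs(2)] xs(1) by blast
    qed
    show "(\<lambda>x. split_weight T {x}) ` leaves ?G \<subseteq> twig_weights T"
    proof
      fix r assume "r \<in> (\<lambda>x. split_weight T {x}) ` leaves ?G"
      then obtain x where x: "x \<in> leaves ?G" "r = split_weight T {x}"
        by blast
      then obtain xs where "is_twig ?G x xs"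
        using ex by blast
      then show "r \<in> twig_weights T"
        using sum x(2) unfolding twig_weights_def by force
    qed
  qed
qed

context same_multiweights
begin

lemma swap: "same_multiweights T' T X k"
  by unfold_locales (use pos pos' leaves leaves' same k in auto)

text \<open>Without bad edges every edge of \<open>T\<close> induces a large split or cuts off a
  single leaf. The former have determined weights, and the latter agree because the bad weights
  do.\<close>

lemma split_weight_eq_of_no_bad:
  assumes b: "bad_weight k T = 0" "bad_weight k T' = 0" and B: "is_cut (shape T) e B"
  shows "split_weight T (B \<inter> X) = split_weight T' (B \<inter> X)"
proof -
  define A where "A = B \<inter> X"
  have A: "A \<subseteq> X" "X - A = - B \<inter> X"
    by (auto simp: A_def)
  have "\<exists>x\<in>X. x \<in> B" "\<exists>x\<in>X. x \<in> - B"
    using cut_has_leaf[OF trees(1), of e B] cut_has_leaf[OF trees(1), of e "- B"] B leaves by auto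
  then have "A \<noteq> {}" "X - A \<noteq> {}"
    by (auto simp: A_def)
  then have A0: "card A \<noteq> 0" "card (X - A) \<noteq> 0"
    using finX finite_subset[OF A(1) finX] by auto
  have "e \<in> edges (shape T)" "e \<notin> bad_edges k (shape T)"
    using cut_edge[OF B] bad_weight_eq_0_iff[OF pos] b by auto
  then have e: "k \<le> card (side (shape T) e \<inter> X) \<or> k \<le> card (X - side (shape T) e)"
    by (auto simp: bad_edges_def leaves)
  have "A = side (shape T) e \<inter> X \<and> X - A = X - side (shape T) e \<or>
      X - A = side (shape T) e \<inter> X \<and> A = X - side (shape T) e"
    using cut_eq_or_Compl[OF trees(1) B cut_side[OF trees(1) cut_edge[OF B]]] leaves_subset[of "shape T"]
    unfolding leaves A_def by blast
  then have big: "k \<le> card A \<or> k \<le> card (X - A)"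
    using e by auto
  consider "card A = 1" | "card (X - A) = 1" | "2 \<le> card A" "2 \<le> card (X - A)"
    using A0 by linarith
  then have "split_weight T A = split_weight T' A"
  proof cases
    case 1
    then obtain x where "A = {x}"
      by (auto simp: card_1_singleton_iff)
    then show ?thesis
      using leaf_split_weight_diff[of x] b A(1) by simp
  next
    case 2
    then obtain x where x: "X - A = {x}"
      by (auto simp: card_1_singleton_iff)
    then have "x \<in> X"
      by blast
    then have "split_weight T (X - A) = split_weight T' (X - A)"
      using leaf_split_weight_diff[of x] b x by simp
    then show ?thesis
      using split_weight_Compl[OF trees(1) leaves A(1)] split_weight_Compl[OF trees(2) leaves' A(1)] by simp
  next
    case 3
    then show ?thesis
      using large_split_weight_eq[OF A(1)] big by blast
  qed
  then show ?thesis
    by (simp add: A_def)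
qed

text \<open>The split of \<open>e\<close> has positive weight in \<open>T\<close>, hence in
  \<open>T'\<close>, so some edge of \<open>T'\<close> induces it; in an essential tree that edge
  carries the whole weight of the split.\<close>

lemma matching_edge:
  assumes b: "bad_weight k T = 0" "bad_weight k T' = 0"
    and ess: "essential (shape T)" "essential (shape T')" and e: "e \<in> edges (shape T)"
  shows "\<exists>e' A A'. is_cut (shape T) e A \<and> is_cut (shape T') e' A' \<and>
      A \<inter> X = A' \<inter> X \<and> weight T' e' = weight T e"
proof -
  let ?A = "side (shape T) e"
  have A: "is_cut (shape T) e ?A"
    by (rule cut_side[OF trees(1) e])
  have w: "split_weight T (?A \<inter> X) = weight T e"
    using essential_split_weight[OF trees(1) ess(1) A] leaves by simp
  have w': "split_weight T' (?A \<inter> X) = weight T e"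
    using split_weight_eq_of_no_bad[OF b A] w by simp
  have "cluster_edges (shape T') (?A \<inter> X) \<noteq> {}"
  proof
    assume "cluster_edges (shape T') (?A \<inter> X) = {}"
    then have "weight T e = 0"
      using w' by (simp add: split_weight_def)
    then show False
      using positive_weightD(2)[OF pos e] by simp
  qed
  then obtain e' A' where A': "is_cut (shape T') e' A'" "A' \<inter> X = ?A \<inter> X"
    unfolding cluster_edges_def leaves' by blast
  have "weight T' e' = weight T e"
    using essential_split_weight[OF trees(2) ess(2) A'(1)] A'(2) w' leaves' by simp
  then show ?thesis
    using A A' by metis
qed

lemma iso_of_no_bad:
  assumes b: "bad_weight k T = 0" "bad_weight k T' = 0"
    and ess: "essential (shape T)" "essential (shape T')"
  shows "wtree_iso T T'"
proof (rule same_weighted_clusters_iso[OF trees(1) ess(1) trees(2) ess(2)])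
  show "leaves (shape T) = leaves (shape T')"
    using leaves leaves' by simp
  show "\<exists>e' A A'. is_cut (shape T) e A \<and> is_cut (shape T') e' A' \<and>
      A \<inter> leaves (shape T) = A' \<inter> leaves (shape T') \<and> weight T' e' = weight T e"
    if "e \<in> edges (shape T)" for e
    using matching_edge[OF b ess that] unfolding leaves leaves' .
  show "\<exists>e A A'. is_cut (shape T) e A \<and> is_cut (shape T') e' A' \<and>
      A \<inter> leaves (shape T) = A' \<inter> leaves (shape T')"
    if "e' \<in> edges (shape T')" for e'
    using same_multiweights.matching_edge[OF swap b(2,1) ess(2,1) that] unfolding leaves leaves' by metis
qed

text \<open>The bad edges are rescaled to total weight \<open>k s\<close>, which is paid for by the leaf edges, each of
  which is brought down to its weight in \<open>T'\<close> minus \<open>s\<close>.\<close>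

lemma reweighted_tree:
  fixes s :: real
  assumes b: "0 < bad_weight k T" "bad_weight k T' = 0" and ess: "essential (shape T)"
    and s: "0 < s" "\<And>x. x \<in> X \<Longrightarrow> s < split_weight T' {x}"
  shows "\<exists>S. positive_weighted_tree S \<and> leaves (shape S) = X \<and>
    (\<forall>I\<subseteq>X. card I = k \<longrightarrow> D_of S I = D_of T I) \<and> D_tot S = D_tot T' - real (card X - k) * s"
proof -
  let ?G = "shape T"
  let ?E = "edges ?G"
  note t = trees(1)
  define \<beta> where "\<beta> = bad_weight k T"
  \<comment> \<open>A leaf edge of \<open>T\<close> weighs \<open>\<beta> / k\<close> less than in
    \<open>T'\<close>, which explains the first correction; the second multiplies the bad edges by
    \<open>k * s / \<beta>\<close>.\<close>
  define \<omega> where "\<omega> e = weight T e + (\<beta> / k - s) * of_bool (e \<inter> X \<noteq> {})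
    + (k * s / \<beta> - 1) * (weight T e * of_bool (e \<in> bad_edges k ?G))" for e
  have \<beta>: "\<beta> > 0"
    using b by (simp add: \<beta>_def)
  have kpos: "real k > 0"
    using k by simp
  define S where "S = T\<lparr>weight := \<omega>\<rparr>"
  have S: "shape S = ?G" "weight S = \<omega>"
    by (simp_all add: S_def)
  have bad_leaf: "e \<inter> X = {}" if "e \<in> bad_edges k ?G" for e
    using bad_edge_disjoint_leaves[OF t _ that] k leaves by simp
  have pos_\<omega>: "\<omega> e > 0" if e: "e \<in> ?E" for e
  proof -
    have we: "weight T e > 0"
      using positive_weightD(2)[OF pos e] .
    consider "e \<inter> X \<noteq> {}" | "e \<inter> X = {}" "e \<in> bad_edges k ?G" | "e \<inter> X = {}" "e \<notin> bad_edges k ?G"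
      by blast
    then show ?thesis
    proof cases
      case 1
      then obtain x where x: "x \<in> X" "x \<in> e"
        by blast
      have "weight T e = split_weight T {x}"
        using essential_leaf_split_weight[OF t ess, of x] leaf_edge_iff[OF t e, of x] x leaves by simp
      then have "weight T e + (\<beta> / k - s) = split_weight T' {x} - s"
        using leaf_split_weight_diff[OF x(1)] b by (simp add: \<beta>_def)
      moreover have "e \<notin> bad_edges k ?G"
        using bad_leaf 1 by blast
      ultimately show ?thesis
        using 1 s(2)[OF x(1)] by (simp add: \<omega>_def)
    next
      case 2
      then have "\<omega> e = weight T e * (k * s / \<beta>)"
        by (simp add: \<omega>_def algebra_simps)
      then show ?thesis
        using we \<beta> s kpos by simp
    next
      case 3
      then show ?thesis
        using we by (simp add: \<omega>_def)
    qed
  qed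
  \<comment> \<open>Used twice: for \<open>card J = k\<close> the two corrections cancel, which
    preserves \<open>D_I\<close>; for \<open>J = X\<close>, which every edge separates, the sum is
    the total weight.\<close>
  have sum_\<omega>: "(\<Sum>e | e \<in> ?E \<and> crosses J (side ?G e). \<omega> e) =
      (\<Sum>e | e \<in> ?E \<and> crosses J (side ?G e). weight T e) + (\<beta> / k - s) * card J + (k * s - \<beta>)"
    if J: "J \<subseteq> X" "k \<le> card J" for J
  proof -
    let ?F = "{e. e \<in> ?E \<and> crosses J (side ?G e)}"
    have finF: "finite ?F"
      using tree_finite(2)[OF t] by simp
    have "(\<Sum>e\<in>?F. of_bool (e \<inter> X \<noteq> {})) = (\<Sum>e | e \<in> ?E \<and> e \<inter> leaves ?G \<noteq> {} \<and> crosses J (side ?G e). 1 :: real)"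
      by (rule sum.mono_neutral_cong_right) (use finF leaves in auto)
    also have "\<dots> = card J"
      using sum_leaf_edges[OF t, of J "\<lambda>_. 1"] J k leaves by simp
    finally have 1: "(\<Sum>e\<in>?F. of_bool (e \<inter> X \<noteq> {})) = real (card J)" .
    have "bad_edges k ?G \<subseteq> ?F"
      using bad_edge_crosses[OF t _ J(2)] J(1) leaves by (auto simp: bad_edges_def)
    then have "(\<Sum>e\<in>?F. weight T e * of_bool (e \<in> bad_edges k ?G)) = (\<Sum>e\<in>bad_edges k ?G. weight T e)"
      using finF by (intro sum.mono_neutral_cong_right) auto
    then have 2: "(\<Sum>e\<in>?F. weight T e * of_bool (e \<in> bad_edges k ?G)) = \<beta>"
      by (simp add: \<beta>_def bad_weight_def)
    have "(k * s / \<beta> - 1) * \<beta> = k * s - \<beta>"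
      using \<beta> by (simp add: left_diff_distrib)
    then show ?thesis
      unfolding \<omega>_def sum.distrib sum_distrib_left[symmetric] 1 2 by simp
  qed
  have "D_of S I = D_of T I" if I: "I \<subseteq> X" "card I = k" for I
  proof -
    have IV: "I \<subseteq> verts ?G" "I \<noteq> {}"
      using I leaves leaves_subset[of ?G] k by auto
    have "(\<beta> / k - s) * card I + (k * s - \<beta>) = 0"
      using I kpos by (simp add: left_diff_distrib)
    then show ?thesis
      using sum_\<omega>[of I] I D_of_eq_sum[OF t IV] D_of_eq_sum[of S I] t IV by (simp add: S)
  qed
  moreover have "D_tot S = D_tot T' - real (card X - k) * s"
  proof -
    have all: "{e. e \<in> ?E \<and> crosses X (side ?G e)} = ?E"
    proof -
      have "crosses X (side ?G e)" if e: "e \<in> ?E" for e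
        using cut_has_leaf[OF t, of e "side ?G e"] cut_has_leaf[OF t, of e "- side ?G e"]
          cut_side[OF t e] leaves by (auto simp: crosses_def)
      then show ?thesis by blast
    qed
    have "D_tot S = D_tot T + (\<beta> / k - s) * card X + (k * s - \<beta>)"
      using sum_\<omega>[of X] k unfolding all by (simp add: D_tot_def S)
    moreover have "D_tot T' = D_tot T + (card X - k) * (\<beta> / k)"
      using D_tot_diff b by (simp add: \<beta>_def)
    moreover have "real (card X - k) = real (card X) - real k"
      using k by simp
    moreover have "real k * (\<beta> / k) = \<beta>"
      using kpos by simp
    ultimately show ?thesis
      by (simp add: left_diff_distrib right_diff_distrib mult.commute)
  qed
  moreover have "positive_weighted_tree S"
    using t pos_\<omega> by (simp add: positive_weighted_tree_def S)
  ultimately show ?thesis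
    using leaves S by metis
qed

end

section \<open>Supremum and infimum of the total weight\<close>

lemma realizing_treesD:
  assumes "T \<in> realizing_trees n k D"
  shows "positive_weighted_tree T" "leaves (shape T) = {1..n}"
    "\<And>I. I \<subseteq> {1..n} \<Longrightarrow> card I = k \<Longrightarrow> D_of T I = D I"
  using assms by (auto simp: realizing_trees_def subsets_of_card_def)

lemma realizing_trees_same_multiweights:
  assumes "T \<in> realizing_trees n k D" "T' \<in> realizing_trees n k D" "3 \<le> k" "k \<le> n - 1"
  shows "same_multiweights T T' {1..n} k"
  using realizing_treesD[OF assms(1)] realizing_treesD[OF assms(2)] assms(3,4)
  by unfold_locales auto

text \<open>\<open>U\<close> consists of concrete trees, whose inner vertices can be renamed and
  subdivided at will. Uniqueness is therefore stated up to \<open>same_wtree\<close>, and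
  \<open>#U > 1\<close> as the existence of two trees that are not identified.\<close>

theorem theorem4p1:
  fixes k n :: nat and D :: "nat set \<Rightarrow> real" and U :: "nat wtree set"
  assumes "3 \<le> k" and "k \<le> n - 1"
    and "\<forall>I\<in>subsets_of_card n k. D I > 0"
    and "pl_treelike n k D"
    and "U = realizing_trees n k D"
  shows "(\<exists>P. P \<in> essential_pseudostars n k D) \<and>
    (\<forall>P\<in>essential_pseudostars n k D.
       (\<forall>Q\<in>essential_pseudostars n k D. same_wtree Q P) \<and>
       (bdd_above (D_tot ` U) \<and> (SUP T\<in>U. D_tot T) = D_tot P \<and>
        (\<forall>T\<in>U. D_tot T = (SUP T\<in>U. D_tot T) \<longleftrightarrow> same_wtree T P)) \<and>
       ((\<exists>T\<in>U. \<exists>T'\<in>U. \<not> same_wtree T T') \<longrightarrow>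
          bdd_below (D_tot ` U) \<and>
          (INF T\<in>U. D_tot T) = D_tot P - real (n - k) * Min (twig_weights P) \<and>
          (\<forall>T\<in>U. D_tot T \<noteq> (INF T\<in>U. D_tot T))))"
proof (intro conjI ballI)
  note k = assms(1,2)
  show "\<exists>P. P \<in> essential_pseudostars n k D"
    using pl_treelike_essential_pseudostar[OF assms(4) k] by blast
  fix P assume P: "P \<in> essential_pseudostars n k D"
  have PU: "P \<in> U" and Pess: "essential (shape P)" and Pstar: "pseudostar n k (shape P)"
    using P assms(5) by (auto simp: essential_pseudostars_def)
  have U: "positive_weighted_tree T" "leaves (shape T) = {1..n}"
    "\<And>I. I \<subseteq> {1..n} \<Longrightarrow> card I = k \<Longrightarrow> D_of T I = D I" if "T \<in> U" for T
    using realizing_treesD[of T n k D] that assms(5) by auto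
  have same: "same_multiweights T T' {1..n} k" if "T \<in> U" "T' \<in> U" for T T'
    using realizing_trees_same_multiweights that assms(5) k by blast
  have nk: "real (n - k) > 0" and kpos: "real k > 0"
    using k by auto
  have P_bad: "bad_weight k P = 0"
    using pseudostar_iff_no_bad_edges[OF positive_weightD(1)[OF U(1)[OF PU]]] Pstar
    by (simp add: bad_weight_eq_0_iff[OF U(1)[OF PU]])
  \<comment> \<open>Both parts thereby reduce to the possible values of
    \<open>bad_weight k T / k\<close>: 0 yields the supremum, values close to the least twig weight
    the infimum.\<close>
  have D_tot_P: "D_tot P = D_tot T + real (n - k) * (bad_weight k T / k)" if "T \<in> U" for T
    using same_multiweights.D_tot_diff[OF same[OF that PU]] P_bad by simp
  have bad_0: "bad_weight k T = 0" if "T \<in> U" "D_tot T = D_tot P" for T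
    using D_tot_P[OF that(1)] that(2) nk kpos by simp
  have le_P: "D_tot T \<le> D_tot P" if "T \<in> U" for T
    using D_tot_P[OF that] bad_weight_nonneg[OF U(1)[OF that], of k] nk kpos by simp
  \<comment> \<open>Members of \<open>U\<close> may have vertices of degree 2, while the isomorphism
    and the rescaling need essential trees.\<close>
  have essential_form: "\<exists>Q\<in>U. suppress_step\<^sup>*\<^sup>* T Q \<and> essential (shape Q) \<and> D_tot Q = D_tot T"
    if T: "T \<in> U" for T
  proof -
    obtain Q where Q: "suppress_step\<^sup>*\<^sup>* T Q" "essential (shape Q)"
      using essential_form_exists[OF U(1)[OF T]] by blast
    have pres: "positive_weighted_tree Q" "leaves (shape Q) = {1..n}" "D_tot Q = D_tot T"
      "\<And>I. I \<subseteq> {1..n} \<Longrightarrow> I \<noteq> {} \<Longrightarrow> D_of Q I = D_of T I"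
      using suppress_steps_preserve[OF Q(1) U(1)[OF T]] U(2)[OF T] by auto
    have "D_of Q I = D I" if "I \<in> subsets_of_card n k" for I
    proof -
      have "I \<subseteq> {1..n}" "card I = k" "I \<noteq> {}"
        using that k by (auto simp: subsets_of_card_def)
      then show ?thesis
        using pres(4)[of I] U(3)[OF T, of I] by simp
    qed
    then have "Q \<in> U"
      using pres by (simp add: assms(5) realizing_trees_def)
    then show ?thesis
      using Q pres by blast
  qed
  have same_wtree: "same_wtree T T'" if T: "T \<in> U" "T' \<in> U" "D_tot T = D_tot P" "D_tot T' = D_tot P" for T T'
  proof -
    obtain Q Q' where Q: "Q \<in> U" "suppress_step\<^sup>*\<^sup>* T Q" "essential (shape Q)" "D_tot Q = D_tot P"
      and Q': "Q' \<in> U" "suppress_step\<^sup>*\<^sup>* T' Q'" "essential (shape Q')" "D_tot Q' = D_tot P"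
      using essential_form[OF T(1)] essential_form[OF T(2)] T(3,4) by metis
    have "wtree_iso Q Q'"
      using same_multiweights.iso_of_no_bad[OF same[OF Q(1) Q'(1)]] bad_0 Q Q' by blast
    then show ?thesis
      using Q Q' unfolding same_wtree_def by blast
  qed
  show "same_wtree Q P" if Q: "Q \<in> essential_pseudostars n k D" for Q
  proof -
    have QU: "Q \<in> U" "pseudostar n k (shape Q)"
      using Q assms(5) by (auto simp: essential_pseudostars_def)
    have "bad_weight k Q = 0"
      using pseudostar_iff_no_bad_edges[OF positive_weightD(1)[OF U(1)[OF QU(1)]]] QU(2)
      by (simp add: bad_weight_eq_0_iff[OF U(1)[OF QU(1)]])
    then show ?thesis
      using same_wtree[OF QU(1) PU] D_tot_P[OF QU(1)] by simp
  qed
  show "bdd_above (D_tot ` U)"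
    using le_P by (rule bdd_aboveI2)
  show sup: "(SUP T\<in>U. D_tot T) = D_tot P"
    by (rule cSup_eq_maximum) (use PU le_P in auto)
  show "D_tot T = (SUP T\<in>U. D_tot T) \<longleftrightarrow> same_wtree T P" if T: "T \<in> U" for T
    unfolding sup using same_wtree[OF T PU] same_wtree_D_tot[OF U(1)[OF T] U(1)[OF PU]] by blast
  have tP: "tree (shape P)" and card: "3 \<le> card {1..n}" "k < card {1..n}"
    using positive_weightD(1)[OF U(1)[OF PU]] k by auto
  let ?m = "Min (twig_weights P)"
  have twigs: "twig_weights P = (\<lambda>x. split_weight P {x}) ` {1..n}"
    using essential_twig_weights[OF tP Pess] U(2)[OF PU] card by simp
  have twigs_fin: "finite (twig_weights P)" "twig_weights P \<noteq> {}"
    using card by (auto simp: twigs)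
  have m_pos: "0 < ?m"
    using twigs_fin leaf_split_weight_pos[OF U(1)[OF PU]] U(2)[OF PU] by (auto simp: twigs)
  \<comment> \<open>The leaf weights of \<open>T\<close> are positive and fall short of those of
    \<open>P\<close> by \<open>bad_weight k T / k\<close>, so this quotient stays strictly below
    every twig weight of \<open>P\<close>. The strictness prevents the infimum from being
    attained.\<close>
  have gt: "D_tot P - real (n - k) * ?m < D_tot T" if T: "T \<in> U" for T
  proof -
    have "bad_weight k T / k < split_weight P {x}" if "x \<in> {1..n}" for x
      using same_multiweights.leaf_split_weight_diff[OF same[OF T PU] that] P_bad
        leaf_split_weight_pos[OF U(1)[OF T], of x] U(2)[OF T] that by simp
    then have "bad_weight k T / k < ?m"
      using twigs_fin by (auto simp: twigs)
    then have "real (n - k) * (bad_weight k T / k) < real (n - k) * ?m"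
      using nk by (rule mult_strict_left_mono)
    then show ?thesis
      using D_tot_P[OF T] by linarith
  qed
  show "(\<exists>T\<in>U. \<exists>T'\<in>U. \<not> same_wtree T T') \<longrightarrow>
          bdd_below (D_tot ` U) \<and>
          (INF T\<in>U. D_tot T) = D_tot P - real (n - k) * ?m \<and>
          (\<forall>T\<in>U. D_tot T \<noteq> (INF T\<in>U. D_tot T))"
  proof
    assume "\<exists>T\<in>U. \<exists>T'\<in>U. \<not> same_wtree T T'"
    \<comment> \<open>Trees with the total weight of \<open>P\<close> are all identified, so some
      tree has another total and, in essential form, positive bad weight.\<close>
    then obtain T0 where T0: "T0 \<in> U" "D_tot T0 \<noteq> D_tot P"
      using same_wtree by blast
    then obtain T where T: "T \<in> U" "essential (shape T)" "D_tot T \<noteq> D_tot P"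
      using essential_form by metis
    have "bad_weight k T \<noteq> 0"
      using D_tot_P[OF T(1)] T(3) by auto
    then have T_bad: "0 < bad_weight k T"
      using bad_weight_nonneg[OF U(1)[OF T(1)], of k] by simp
    have approach: "D_tot P - real (n - k) * s \<in> D_tot ` U" if s: "0 < s" "s < ?m" for s
    proof -
      have "s < split_weight P {x}" if "x \<in> {1..n}" for x
        using s(2) twigs_fin that by (auto simp: twigs)
      then obtain S where S: "positive_weighted_tree S" "leaves (shape S) = {1..n}"
        "\<forall>I\<subseteq>{1..n}. card I = k \<longrightarrow> D_of S I = D_of T I" "D_tot S = D_tot P - real (n - k) * s"
        using same_multiweights.reweighted_tree[OF same[OF T(1) PU] T_bad P_bad T(2) s(1)] by auto
      have "S \<in> U"
        using S U(3)[OF T(1)] by (simp add: assms(5) realizing_trees_def subsets_of_card_def)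
      then show ?thesis
        using S(4) by (metis imageI)
    qed
    have inf: "(INF T\<in>U. D_tot T) = D_tot P - real (n - k) * ?m"
    proof (rule cInf_eq_non_empty)
      show "D_tot ` U \<noteq> {}"
        using PU by blast
      show "D_tot P - real (n - k) * ?m \<le> r" if "r \<in> D_tot ` U" for r
        using that gt less_imp_le by blast
      fix y assume y: "\<And>r. r \<in> D_tot ` U \<Longrightarrow> y \<le> r"
      show "y \<le> D_tot P - real (n - k) * ?m"
      proof (rule ccontr)
        assume "\<not> y \<le> D_tot P - real (n - k) * ?m"
        \<comment> \<open>A lower bound \<open>y\<close> above the claimed infimum leaves room for
          some \<open>s < ?m\<close> whose tree has total weight below \<open>y\<close>; the maximum
          with 0 keeps \<open>s\<close> positive.\<close>
        then have "(D_tot P - y) / real (n - k) < ?m"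
          using nk by (simp add: divide_less_eq mult.commute)
        then obtain s where s: "max 0 ((D_tot P - y) / real (n - k)) < s" "s < ?m"
          using dense[of "max 0 ((D_tot P - y) / real (n - k))" ?m] m_pos by auto
        then have "D_tot P - real (n - k) * s < y"
          using nk by (simp add: divide_less_eq mult.commute)
        then show False
          using y[OF approach[of s]] s by simp
      qed
    qed
    have "bdd_below (D_tot ` U)"
      using gt by (meson bdd_belowI2 less_imp_le)
    moreover have "D_tot T \<noteq> (INF T\<in>U. D_tot T)" if "T \<in> U" for T
      unfolding inf using gt[OF that] by simp
    ultimately show "bdd_below (D_tot ` U) \<and>
          (INF T\<in>U. D_tot T) = D_tot P - real (n - k) * ?m \<and>
          (\<forall>T\<in>U. D_tot T \<noteq> (INF T\<in>U. D_tot T))"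
      using inf by blast
  qed
qed

end
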